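(* Let $Q=(u,u-r)$ with integers $u>r\ge 2$, and let $t_{\max}=\min\{u-r,\lfloor\frac{r-1}{2}\rfloor\}$, with $q_t,d_t,k_t,c_t$ as defined in the context. (a) For every integer $t$ with $1\le t\le t_{\max}$ define $$A_t=\{(k,\ell)\in\mathbb N\times\mathbb N \mid k_{t-1}\le k<k_t \text{ and } t\le \ell\le u-r\}.$$ For $T=t_{\max}+1$ define $$A_T=\{(k,\ell)\in\mathbb N\times\mathbb N\mid k=k_{t_{\max}}=r-T \text{ and } T\le\ell\le u-r\}.$$ Then $A_T\neq\emptyset$ if and only if $r$ is even and $u\ge\frac{3r}{2}$, and in that case $T=k_{t_{\max}}=\frac r2$. Moreover, for every $t\in\{1,2,\dots,T\}$ and every $(k,\ell)\in A_t$ the partition $P_{k,\ell}=([u]^k,[u-r]^\ell)$ is of type A and satisfies $\mathfrak Q(P_{k,\ell})=(u,u-r)$. (b) For every integer $t$ with $1\le t\le t_{\max}$ define $C_t=\{(k,t)\mid k_t\le k<c_t\}\subset\mathbb N\times\mathbb N$. Then for all $(k,\ell)\in C_t$ the partition $$P_{k,\ell}=\left([u-r+2t]^t,\ [u-2t-d_t(q_t-1)]^{k-d_t},\ (q_t-1)^{d_t}\right)$$ is of type C but not of type A or B, and satisfies $\mathfrak Q(P_{k,\ell})=(u,u-r)$. (c) For every integer $t$ with $1\le t\le t_{\max}$ define $$B_t=\{(k,t)\mid c_t\le k\le r-t\}\cup\{(r-t,\ell)\mid t<\ell\le u-r\}\subset\mathbb N\times\mathbb N.$$ Then for all $(k,\ell)\in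 B_t$ the partition $$P_{k,\ell}=\left([u-r+2t]^t,\ [u-2t]^{k+\ell-t}\right)$$ is of type B but not of type A, and satisfies $\mathfrak Q(P_{k,\ell})=(u,u-r)$. (d) Each pair $(k,\ell)\in\mathbb N\times\mathbb N$ with $1\le k\le r-1$ and $1\le\ell\le u-r$ belongs to one and only one of the sets $A_t$ ($1\le t\le T$), $B_t$ ($1\le t\le t_{\max}$), $C_t$ ($1\le t\le t_{\max}$). In particular, setting $P_{k,\ell}=([u]^k,[u-r]^\ell)$ if $(k,\ell)\in A_t$, $P_{k,\ell}=\left([u-r+2t]^t,[u-2t]^{k+\ell-t}\right)$ if $(k,\ell)\in B_t$, and $P_{k,\ell}=\left([u-r+2t]^t,[u-2t-d_t(q_t-1)]^{k-d_t},(q_t-1)^{d_t}\right)$ if $(k,\ell)\in C_t$, for $1\le k\le r-1$ and $1\le\ell\le u-r$, one obtains $(r-1)(u-r)$ distinct partitions $P_{k,\ell}$, each satisfying $\mathfrak Q(P_{k,\ell})=(u,u-r)$. Moreover, every partition $P_{k,\ell}$ has $k+\ell$ parts.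
   Context: Fix an infinite field $\mathsf k$. For a partition $P$ of $n$, $J_P$ denotes the $n\times n$ nilpotent Jordan matrix whose Jordan blocks have sizes the parts of $P$; the Jordan type of a nilpotent matrix is the partition of its Jordan block sizes. For $B=J_P$ let $\mathcal N_B$ be the (irreducible) variety of nilpotent matrices in $\mathrm{Mat}_n(\mathsf k)$ commuting with $B$. $\mathfrak Q(P)$ is the Jordan type of a generic element of $\mathcal N_B$, i.e. the common Jordan type of all elements of some nonempty Zariski-open subset of $\mathcal N_B$. $\mathfrak Q^{-1}(Q)$ is the set of partitions $P$ with $\mathfrak Q(P)=Q$. Notation for partitions. For $1\le k\le n$, $[n]^k$ is the unique partition of $n$ with exactly $k$ parts whose largest and smallest parts differ by at most 1. $s^k$ means $k$ parts equal to $s$. Listing several partitions between parentheses denotes the partition whose multiset of parts is the union of theirs. Types. Every $P\in\mathfrak Q^{-1}((u,u-r))$ with $u>r\ge2$ can be written $P=(a^{n_a},(a-1)^{n_{a-1}},b^{n_b},(b-1)^{n_{b-1}})$ with $a-b\ge 2$, $b\ge1$, $n_a>0$, $n_b>0$, $n_{a-1},n_{b-1}\ge 0$, and $n_{b-1}=0$ if $b=1$. $P$ is of type A if $u=an_a+(a-1)n_{a-1}$. $P$ is of type B if $u=2n_a+2n_{a-1}+bn_b+(b-1)n_{b-1}$, or if $b=a-2$, $n_{b-1}=0$ and $u=2n_a+(a-1)n_{a-1}+bn_b$. $P$ is of type C if $b=a-2$, each of $n_a,n_{a-1},n_b,n_{b-1}$ is nonzero, and $u=2n_a+(a-1)n_{a-1}+bn_b$.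 A partition may have more than one type. Table invariants. Set $k_0=1$. If $r\ge3$, then for $1\le t\le t_{\max}$ put $q_t=\lceil\frac{u-r}{t}\rceil$, $d_t=t\,q_t-(u-r)$, $k_t=\lceil\frac{u+1-t+d_t}{q_t+1}\rceil$, and $c_t=k_t$ if $d_t=0$, $c_t=\lceil\frac{u-2t+d_t}{q_t}\rceil$ if $d_t>0$. *)

theory Defs
  imports Complex_Main "HOL-Library.Multiset" "Jordan_Normal_Form.Jordan_Normal_Form"
begin

section \<open>Partitions and nilpotent Jordan types\<close>

definition is_partition :: "nat \<Rightarrow> nat multiset \<Rightarrow> bool" where
  "is_partition n P \<longleftrightarrow> (\<forall>s\<in>#P. 0 < s) \<and> sum_mset P = n"

text \<open>The partition \<open>[n]\<^sup>k\<close>; meaningful for \<open>1 \<le> k \<le> n\<close>, where it exists and is unique.\<close>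

definition alm_rect :: "nat \<Rightarrow> nat \<Rightarrow> nat multiset" where
  "alm_rect n k =
     (THE P. is_partition n P \<and> size P = k \<and> (\<forall>x\<in>#P. \<forall>y\<in>#P. x \<le> y + 1))"

definition nilp_blocks :: "nat multiset \<Rightarrow> (nat \<times> 'a::field) list" where
  "nilp_blocks P = map (\<lambda>s. (s, 0)) (rev (sorted_list_of_multiset P))"

text \<open>The Jordan matrix \<open>J\<^sub>P\<close>, with blocks in weakly decreasing order of size.\<close>

definition nilp_jordan_matrix :: "nat multiset \<Rightarrow> 'a::field mat" where
  "nilp_jordan_matrix P = jordan_matrix (nilp_blocks P)"

definition has_jordan_type :: "'a::field mat \<Rightarrow> nat multiset \<Rightarrow> bool" where
  "has_jordan_type A P \<longleftrightarrow> jordan_nf A (nilp_blocks P)"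


section \<open>The nilpotent commutator and its generic Jordan type\<close>

definition nilp_commutator :: "nat \<Rightarrow> 'a::field mat \<Rightarrow> 'a mat set" where
  "nilp_commutator n B =
     {A \<in> carrier_mat n n. A * B = B * A \<and> (\<exists>m. A ^\<^sub>m m = 0\<^sub>m n n)}"

text \<open>Polynomial functions in the \<open>n\<^sup>2\<close> entries of an \<open>n \<times> n\<close> matrix. The Zariski topology
  below is the one on the set of rational points, over the (infinite) ground field.\<close>

inductive_set mat_poly_fun :: "nat \<Rightarrow> ('a::field mat \<Rightarrow> 'a) set" for n :: nat where
  const: "(\<lambda>_. c) \<in> mat_poly_fun n"
| entry: "i < n \<Longrightarrow> j < n \<Longrightarrow> (\<lambda>A. A $$ (i, j)) \<in> mat_poly_fun n"
| add: "f \<in> mat_poly_fun n \<Longrightarrow> g \<in> mat_poly_fun n \<Longrightarrow> (\<lambda>A. f A + g A) \<in> mat_poly_fun n"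
| mult: "f \<in> mat_poly_fun n \<Longrightarrow> g \<in> mat_poly_fun n \<Longrightarrow> (\<lambda>A. f A * g A) \<in> mat_poly_fun n"

definition zariski_open_in :: "nat \<Rightarrow> 'a::field mat set \<Rightarrow> 'a mat set \<Rightarrow> bool" where
  "zariski_open_in n X U \<longleftrightarrow>
     (\<exists>F \<subseteq> mat_poly_fun n. U = X - {A \<in> carrier_mat n n. \<forall>f\<in>F. f A = 0})"

text \<open>The map \<open>\<QQ>\<close>. The ground field \<open>'a\<close> enters only through its type. For infinite \<open>'a\<close>
  the variety of nilpotent matrices commuting with \<open>J\<^sub>P\<close> is irreducible, so the partition
  described is unique.\<close>

definition generic_type :: "'a::field itself \<Rightarrow> nat multiset \<Rightarrow> nat multiset" where
  "generic_type K P =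
     (THE Q. \<exists>U. zariski_open_in (sum_mset P)
                   (nilp_commutator (sum_mset P) (nilp_jordan_matrix P)) U
                 \<and> U \<noteq> {} \<and> (\<forall>A \<in> (U :: 'a mat set). has_jordan_type A Q))"


section \<open>Types A, B and C\<close>

definition four_part :: "nat multiset \<Rightarrow> nat \<Rightarrow> nat \<Rightarrow> nat \<Rightarrow> nat \<Rightarrow> nat \<Rightarrow> nat \<Rightarrow> bool" where
  "four_part P a na na' b nb nb' \<longleftrightarrow>
     P = replicate_mset na a + replicate_mset na' (a - 1)
         + replicate_mset nb b + replicate_mset nb' (b - 1)
     \<and> a \<ge> b + 2 \<and> b \<ge> 1 \<and> na > 0 \<and> nb > 0 \<and> (b = 1 \<longrightarrow> nb' = 0)"

definition type_A :: "nat \<Rightarrow> nat multiset \<Rightarrow> bool" where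
  "type_A u P \<longleftrightarrow> (\<exists>a na na' b nb nb'. four_part P a na na' b nb nb'
     \<and> u = a * na + (a - 1) * na')"

definition type_B :: "nat \<Rightarrow> nat multiset \<Rightarrow> bool" where
  "type_B u P \<longleftrightarrow> (\<exists>a na na' b nb nb'. four_part P a na na' b nb nb'
     \<and> (u = 2 * na + 2 * na' + b * nb + (b - 1) * nb'
        \<or> (b = a - 2 \<and> nb' = 0 \<and> u = 2 * na + (a - 1) * na' + b * nb)))"

definition type_C :: "nat \<Rightarrow> nat multiset \<Rightarrow> bool" where
  "type_C u P \<longleftrightarrow> (\<exists>a na na' b nb nb'. four_part P a na na' b nb nb'
     \<and> b = a - 2 \<and> na \<noteq> 0 \<and> na' \<noteq> 0 \<and> nb \<noteq> 0 \<and> nb' \<noteq> 0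
     \<and> u = 2 * na + (a - 1) * na' + b * nb)"


section \<open>Table invariants\<close>

text \<open>The \<open>q\<close>, \<open>d\<close>, \<open>k\<close>, \<open>c\<close> are used for \<open>2 \<le> r < u\<close> and \<open>1 \<le> t \<le> t_max u r\<close> (and \<open>k\<close> at \<open>0\<close>), i.e. \<open>t \<le> u - r\<close> and
  \<open>2 * t \<le> r - 1\<close>; then no natural number subtraction below truncates.\<close>

definition t_max :: "nat \<Rightarrow> nat \<Rightarrow> nat" where
  "t_max u r = min (u - r) ((r - 1) div 2)"

definition T_idx :: "nat \<Rightarrow> nat \<Rightarrow> nat" where
  "T_idx u r = t_max u r + 1"

definition q_inv :: "nat \<Rightarrow> nat \<Rightarrow> nat \<Rightarrow> nat" where
  "q_inv u r t = nat \<lceil>(real u - real r) / real t\<rceil>"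

definition d_inv :: "nat \<Rightarrow> nat \<Rightarrow> nat \<Rightarrow> nat" where
  "d_inv u r t = t * q_inv u r t - (u - r)"

definition k_inv :: "nat \<Rightarrow> nat \<Rightarrow> nat \<Rightarrow> nat" where
  "k_inv u r t = (if t = 0 then 1
     else nat \<lceil>(real u + 1 - real t + real (d_inv u r t)) / (real (q_inv u r t) + 1)\<rceil>)"

definition c_inv :: "nat \<Rightarrow> nat \<Rightarrow> nat \<Rightarrow> nat" where
  "c_inv u r t = (if d_inv u r t = 0 then k_inv u r t
     else nat \<lceil>(real u - 2 * real t + real (d_inv u r t)) / real (q_inv u r t)\<rceil>)"


section \<open>The sets of positions and the partitions placed there\<close>

text \<open>\<open>A_set u r t\<close> is used for \<open>1 \<le> t \<le> T_idx u r\<close>, the last index being the special case.\<close>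

definition A_set :: "nat \<Rightarrow> nat \<Rightarrow> nat \<Rightarrow> (nat \<times> nat) set" where
  "A_set u r t =
     (if t \<le> t_max u r
      then {(k, l). k_inv u r (t - 1) \<le> k \<and> k < k_inv u r t \<and> t \<le> l \<and> l \<le> u - r}
      else {(k, l). k = k_inv u r (t_max u r) \<and> k = r - t \<and> t \<le> l \<and> l \<le> u - r})"

definition C_set :: "nat \<Rightarrow> nat \<Rightarrow> nat \<Rightarrow> (nat \<times> nat) set" where
  "C_set u r t = {(k, t) | k. k_inv u r t \<le> k \<and> k < c_inv u r t}"

definition B_set :: "nat \<Rightarrow> nat \<Rightarrow> nat \<Rightarrow> (nat \<times> nat) set" where
  "B_set u r t = {(k, t) | k. c_inv u r t \<le> k \<and> k \<le> r - t}
               \<union> {(r - t, l) | l. t < l \<and> l \<le> u - r}"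

definition A_part :: "nat \<Rightarrow> nat \<Rightarrow> nat \<Rightarrow> nat \<Rightarrow> nat multiset" where
  "A_part u r k l = alm_rect u k + alm_rect (u - r) l"

definition B_part :: "nat \<Rightarrow> nat \<Rightarrow> nat \<Rightarrow> nat \<Rightarrow> nat \<Rightarrow> nat multiset" where
  "B_part u r t k l = alm_rect (u - r + 2 * t) t + alm_rect (u - 2 * t) (k + l - t)"

text \<open>For \<open>(k, t) \<in> C_set u r t\<close> one has \<open>d_inv u r t < k\<close>, \<open>1 < q_inv u r t\<close> and
  \<open>2 * t + d_inv u r t * (q_inv u r t - 1) < u\<close>, so again nothing truncates.\<close>

definition C_part :: "nat \<Rightarrow> nat \<Rightarrow> nat \<Rightarrow> nat \<Rightarrow> nat multiset" where
  "C_part u r t k =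
     alm_rect (u - r + 2 * t) t
     + alm_rect (u - 2 * t - d_inv u r t * (q_inv u r t - 1)) (k - d_inv u r t)
     + replicate_mset (d_inv u r t) (q_inv u r t - 1)"

end

theory Submission
  imports Defs "Jordan_Normal_Form.DL_Rank" "Jordan_Normal_Form.Jordan_Normal_Form_Existence"
    "Jordan_Normal_Form.Jordan_Normal_Form_Uniqueness"
begin

text \<open>The matrix \<open>J\<^sub>P\<close> is the shift \<open>x\<close> along strings of basis vectors, one string per part of \<open>P\<close>. A
  nilpotent matrix commuting with \<open>x\<close> can be conjugated to one that strictly respects an order of
  the basis, and its nonzero matrix entries are too constrained to allow a walk through more basis
  vectors than a U-chain of Oblak's poset contains; so \<open>A\<^sup>u = 0\<close> once \<open>u\<close> bounds all these
  chains. Conversely, if the parts of \<open>P\<close> form two almost rectangular pieces, each piece is a single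
  string of a nilpotent \<open>z\<close> (or \<open>y\<close>) having \<open>x\<close> as a power, so that \<open>z \<oplus> y\<close> commutes with \<open>x\<close> and has
  corank 2. If \<open>N\<close> and \<open>m\<close> are the sizes of the pieces and \<open>t\<close> is the number of parts in the first, then
  \<open>z\<close> has index \<open>N\<close>, and a suitable link between the two strings yields a commuting
  nilpotent matrix of index \<open>2t + m\<close>. As the nilpotent commutator is irreducible, generic elements
  have corank at most 2 and the largest possible index, whence \<open>Q(P) = (u, u - r)\<close> when this index is \<open>u\<close>.
  The inequalities defining \<open>k\<^sub>t\<close> and \<open>c\<^sub>t\<close> say which chain is longest, and the multiplicities of
  the parts recover the position \<open>(k, l)\<close>.\<close>

section \<open>Nilpotent matrices and strings\<close>

text \<open>The field is only assumed infinite, so irreducibility is made explicit on rational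
  points: every nilpotent element of the centralizer is \<open>H * X * adj_mat H\<close> with
  \<open>H\<close> invertible in the centralizer and \<open>X\<close> in a linear space of nilpotent
  matrices, and two such elements lie on a polynomial curve. Hence small corank and large index may
  be witnessed by different matrices, even in different arrangements of the basis. This is what
  handles a longest chain through the parts \<open>a - 1\<close> and \<open>b = a - 2\<close>: the
  corank is seen on the pieces (a, a-1), (b, b-1), the index after regrouping as (a), (a-1, b),
  (b-1). The lower bound on the index is threatened by cancellation, since an entry of a power sums
  over all walks and a linked walk can enter the second string repeatedly. Scaling \<open>y\<close>
  by a parameter turns the entry into a polynomial, one of whose coefficients is 1. The upper bound
  comes from a potential on basis vectors that rises by at least 2 with every step of a walk; its
  weight is the largest number of parts of two consecutive sizes in the range visited.\<close>

lemma mult_mat_entry: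
  assumes "A \<in> carrier_mat n m" "B \<in> carrier_mat m l" "i < n" "j < l"
  shows "(A * B) $$ (i, j) = (\<Sum>k<m. A $$ (i, k) * B $$ (k, j))"
  using assms by (auto simp: times_mat_def scalar_prod_def atLeast0LessThan intro!: sum.cong)

lemma similar_mat_wit_pow_zero_iff:
  assumes "similar_mat_wit A B P Q" and "A \<in> carrier_mat n n"
  shows "A ^\<^sub>m k = 0\<^sub>m n n \<longleftrightarrow> B ^\<^sub>m k = 0\<^sub>m n n"
proof -
  have 0: "A ^\<^sub>m k = 0\<^sub>m n n" if w: "similar_mat_wit A B P Q" and A: "A \<in> carrier_mat n n"
    and B0: "B ^\<^sub>m k = 0\<^sub>m n n" for A B P Q :: "'a mat"
  proof -
    note w' = similar_mat_witD2[OF A w]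
    have "A ^\<^sub>m k = P * B ^\<^sub>m k * Q" by (rule similar_mat_wit_pow_id[OF w])
    then show ?thesis using w' B0 by simp
  qed
  show ?thesis
    using 0[OF assms] 0[OF similar_mat_wit_sym[OF assms(1)]] similar_mat_witD2[OF assms(2,1)] by blast
qed

section \<open>Triangular form and Jordan form of nilpotent matrices over the ground field\<close>

lemma ex_basis_with_first_vector:
  fixes v :: "'a::field vec"
  assumes v: "v \<in> carrier_vec n" "v \<noteq> 0\<^sub>v n" "0 < n"
  shows "\<exists>P Q. P \<in> carrier_mat n n \<and> Q \<in> carrier_mat n n \<and> P * Q = 1\<^sub>m n \<and> Q * P = 1\<^sub>m n \<and> col P 0 = v"
proof -
  interpret vec_space "TYPE('a)" n .
  note b = basis_completion[OF v(1,2)]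
  define P where "P = mat_of_cols n (basis_completion v)"
  have P: "P \<in> carrier_mat n n" unfolding P_def using b(6) by auto
  have cP: "cols P = basis_completion v" unfolding P_def using b(2,6) by (intro cols_mat_of_cols) auto
  have "rank P = n" using lin_indpt_full_rank[OF P] cP b(4,5) by simp
  then have "det P \<noteq> 0" using det_rank_iff[OF P] by simp
  from det_non_zero_imp_unit[OF P this, unfolded Units_def, of "()"]
  obtain Q where Q: "Q \<in> carrier_mat n n" "Q * P = 1\<^sub>m n" "P * Q = 1\<^sub>m n"
    by (auto simp: ring_mat_def)
  have "col P 0 = v" using b(6,7) cP P v(3)
    by (metis carrier_matD(2) cols_length cols_nth hd_conv_nth list.size(3) not_less0)
  then show ?thesis using P Q by blast
qed

lemma upper_four_block_pow:
  assumes A: "A \<in> carrier_mat n n" and B: "B \<in> carrier_mat n m" and D: "D \<in> carrier_mat m m"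
  shows "\<exists>B'. B' \<in> carrier_mat n m \<and>
    four_block_mat A B (0\<^sub>m m n) D ^\<^sub>m k = four_block_mat (A ^\<^sub>m k) B' (0\<^sub>m m n) (D ^\<^sub>m k)"
proof (induction k)
  case 0
  have "1\<^sub>m (n + m) = four_block_mat (1\<^sub>m n) (0\<^sub>m n m) (0\<^sub>m m n) (1\<^sub>m m)" by (intro eq_matI) auto
  then show ?case using A D by (intro exI[of _ "0\<^sub>m n m"]) auto
next
  case (Suc k)
  then obtain B' where B': "B' \<in> carrier_mat n m"
    "four_block_mat A B (0\<^sub>m m n) D ^\<^sub>m k = four_block_mat (A ^\<^sub>m k) B' (0\<^sub>m m n) (D ^\<^sub>m k)" by blast
  have Ak: "A ^\<^sub>m k \<in> carrier_mat n n" and Dk: "D ^\<^sub>m k \<in> carrier_mat m m" using A D by auto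
  have "four_block_mat A B (0\<^sub>m m n) D ^\<^sub>m Suc k
     = four_block_mat (A ^\<^sub>m k) B' (0\<^sub>m m n) (D ^\<^sub>m k) * four_block_mat A B (0\<^sub>m m n) D"
    by (simp add: B')
  also have "\<dots> = four_block_mat (A ^\<^sub>m Suc k) (A ^\<^sub>m k * B + B' * D) (0\<^sub>m m n) (D ^\<^sub>m Suc k)"
    by (subst mult_four_block_mat[OF Ak B'(1) zero_carrier_mat Dk A B zero_carrier_mat D])
      (use A B D B'(1) Ak Dk in auto)
  finally show ?case using Ak B B'(1) D by (intro exI[of _ "A ^\<^sub>m k * B + B' * D"]) auto
qed

text \<open>A nilpotent matrix has determinant 0, hence a kernel vector over the ground field
  itself. With this vector first in a basis, the lower right block is again nilpotent and one
  dimension smaller.\<close>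

lemma nilpotent_similar_strictly_upper:
  fixes A :: "'a::field mat"
  assumes "A \<in> carrier_mat n n" "A ^\<^sub>m m = 0\<^sub>m n n"
  shows "\<exists>T. T \<in> carrier_mat n n \<and> similar_mat A T \<and> (\<forall>i<n. \<forall>j\<le>i. T $$ (i, j) = 0)"
  using assms
proof (induction n arbitrary: A)
  case 0
  then show ?case by (intro exI[of _ A]) (auto intro: similar_mat_refl)
next
  case (Suc n)
  have "det A ^ m = det (A ^\<^sub>m m)" using Suc.prems(1)
    by (induction m) (auto simp: det_mult[of _ "Suc n"])
  also have "\<dots> = 0" unfolding Suc.prems(2) by (simp add: det_zero)
  finally have "det A = 0" by simp
  then obtain v where v: "v \<in> carrier_vec (Suc n)" "v \<noteq> 0\<^sub>v (Suc n)" "A *\<^sub>v v = 0\<^sub>v (Suc n)"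
    using det_0_iff_vec_prod_zero[OF Suc.prems(1)] by blast
  obtain P Q where PQ: "P \<in> carrier_mat (Suc n) (Suc n)" "Q \<in> carrier_mat (Suc n) (Suc n)"
    "P * Q = 1\<^sub>m (Suc n)" "Q * P = 1\<^sub>m (Suc n)" "col P 0 = v"
    using ex_basis_with_first_vector[OF v(1,2)] by blast
  define A' where "A' = Q * A * P"
  have A': "A' \<in> carrier_mat (1 + n) (1 + n)" unfolding A'_def using PQ Suc.prems by auto
  have w: "similar_mat_wit A' A Q P" by (intro similar_mat_witI[of _ _ "Suc n"]) (use PQ Suc.prems A' A'_def in auto)
  have A'm: "A' ^\<^sub>m m = 0\<^sub>m (1 + n) (1 + n)"
    using similar_mat_wit_pow_zero_iff[OF w, of "Suc n" m] A' Suc.prems(2) by simp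
  have "A' * 1\<^sub>m (Suc n) = A'" using A' by simp
  have c0: "col A' 0 = 0\<^sub>v (Suc n)"
  proof -
    have "col A' 0 = (Q * A) *\<^sub>v col P 0" unfolding A'_def
      using PQ Suc.prems by (intro col_mult2) auto
    also have "\<dots> = Q *\<^sub>v (A *\<^sub>v v)" using PQ Suc.prems v by (simp add: assoc_mult_mat_vec[of _ "Suc n" "Suc n" _ "Suc n"])
    also have "\<dots> = 0\<^sub>v (Suc n)" unfolding v(3) using PQ(2) by (intro eq_vecI) auto
    finally show ?thesis .
  qed
  obtain A1 A2 A3 A4 where sb: "split_block A' 1 1 = (A1, A2, A3, A4)" by (metis prod_cases4)
  note bl = split_block[OF sb, of n n]
  have dims: "dim_row A' = 1 + n" "dim_col A' = 1 + n" using A' by auto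
  note bl = bl[OF dims]
  have z: "A' $$ (i, 0) = 0" if "i < Suc n" for i
    using arg_cong[OF c0, of "\<lambda>v. v $ i"] that A' by simp
  have A1: "A1 = 0\<^sub>m 1 1" and A3: "A3 = 0\<^sub>m n 1"
    using sb z A' unfolding split_block_def Let_def by auto
  have blk: "A' = four_block_mat A1 A2 (0\<^sub>m n 1) A4" using bl(5) A3 by simp
  \<comment> \<open>The lower right block of a power of a block triangular matrix is the power of
    that block, so nilpotency descends to \<open>A4\<close>.\<close>
  obtain B' where B': "B' \<in> carrier_mat 1 n"
    "A' ^\<^sub>m m = four_block_mat (A1 ^\<^sub>m m) B' (0\<^sub>m n 1) (A4 ^\<^sub>m m)"
    using upper_four_block_pow[OF bl(1,2,4)] blk by metis
  have "A4 ^\<^sub>m m = 0\<^sub>m n n"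
  proof (rule eq_matI)
    fix i j assume ij: "i < dim_row (0\<^sub>m n n :: 'a mat)" "j < dim_col (0\<^sub>m n n :: 'a mat)"
    have "(A' ^\<^sub>m m) $$ (Suc i, Suc j) = (A4 ^\<^sub>m m) $$ (i, j)"
      unfolding B'(2) using ij bl B'(1) by (subst index_mat_four_block) auto
    then show "(A4 ^\<^sub>m m) $$ (i, j) = 0\<^sub>m n n $$ (i, j)" unfolding A'm using ij by simp
  qed (use bl in auto)
  with Suc.IH[OF bl(4)] obtain T where T: "T \<in> carrier_mat n n" "similar_mat A4 T"
    "\<forall>i<n. \<forall>j\<le>i. T $$ (i, j) = 0" by blast
  obtain B0 where B0: "B0 \<in> carrier_mat 1 n"
    "similar_mat A' (four_block_mat (0\<^sub>m 1 1) B0 (0\<^sub>m n 1) T)"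
    using similar_mat_four_block_0_ex[OF similar_mat_refl[OF bl(1)] T(2) bl(2,1,4)] blk A1 by metis
  have "similar_mat A A'" using w similar_mat_sym unfolding similar_mat_def by blast
  then have s: "similar_mat A (four_block_mat (0\<^sub>m 1 1) B0 (0\<^sub>m n 1) T)" using B0(2) similar_mat_trans by blast
  have "four_block_mat (0\<^sub>m 1 1) B0 (0\<^sub>m n 1) T $$ (i, j) = 0" if "i < Suc n" "j \<le> i" for i j
    using that T B0(1) by (auto simp: index_mat_four_block)
  moreover have "four_block_mat (0\<^sub>m 1 1) B0 (0\<^sub>m n 1) T \<in> carrier_mat (Suc n) (Suc n)"
    using T(1) B0(1) by (metis four_block_carrier_mat plus_1_eq_Suc zero_carrier_mat)
  ultimately show ?case using s by blast
qed

text \<open>The characteristic polynomial is the \<open>n\<close>-th power of the variable, and the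
  eigenvalue of every Jordan block is one of its roots.\<close>

lemma strictly_upper_nilpotent_blocks:
  fixes T :: "'a::field mat"
  assumes T: "T \<in> carrier_mat n n" and z: "\<forall>i<n. \<forall>j\<le>i. T $$ (i, j) = 0"
    and J: "jordan_nf T nas"
  shows "\<forall>(s, a)\<in>set nas. a = 0"
proof (intro ballI, clarify)
  fix s a assume m: "(s, a) \<in> set nas"
  have ut: "upper_triangular T" using z T by (auto simp: upper_triangular_def)
  have "char_poly T = (\<Prod>a\<leftarrow>diag_mat T. [:- a, 1:])" by (rule char_poly_upper_triangular[OF T ut])
  also have "diag_mat T = map (\<lambda>_. 0) [0..<n]" using z T by (auto simp: diag_mat_def)
  also have "(\<Prod>a\<leftarrow>map (\<lambda>_. 0 :: 'a) [0..<n]. [:- a, 1:]) = [:0, 1:] ^ n" by (induction n) auto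
  finally have cp: "char_poly T = [:0, 1:] ^ n" .
  have "s > 0" using J m unfolding jordan_nf_def by force
  moreover have "s \<le> Polynomial.order a (char_poly T)" by (rule jordan_nf_block_size_order_bound[OF J m])
  ultimately have "poly (char_poly T) a = 0" by (metis gr_zeroI leD order_0I)
  then show "a = 0" unfolding cp by (cases "n = 0") auto
qed

lemma jordan_nf_nilpotent:
  fixes A :: "'a::field mat"
  assumes "A \<in> carrier_mat n n" "A ^\<^sub>m m = 0\<^sub>m n n"
  shows "\<exists>xs. jordan_nf A (map (\<lambda>s. (s, 0)) xs)"
proof -
  obtain T where T: "T \<in> carrier_mat n n" "similar_mat A T" "\<forall>i<n. \<forall>j\<le>i. T $$ (i, j) = 0"
    using nilpotent_similar_strictly_upper[OF assms] by blast
  have ut: "upper_triangular T" using T by (auto simp: upper_triangular_def)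
  from triangular_to_jnf_vector[OF T(1) ut] obtain nas where J: "jordan_nf T nas" by blast
  have "map (\<lambda>s. (s, 0)) (map fst nas) = nas"
    using strictly_upper_nilpotent_blocks[OF T(1,3) J] by (induction nas) auto
  moreover have "jordan_nf A nas" using J T(2) similar_mat_trans unfolding jordan_nf_def by blast
  ultimately show ?thesis by metis
qed

text \<open>Basis vector number \<open>i\<close> is the \<open>c i\<close>-th of the string \<open>g i\<close>, which has length \<open>sz (g i)\<close>.\<close>

definition shift_model :: "nat \<Rightarrow> nat set \<Rightarrow> (nat \<Rightarrow> nat) \<Rightarrow> (nat \<Rightarrow> nat) \<Rightarrow> (nat \<Rightarrow> nat) \<Rightarrow> bool" where
  "shift_model n G sz g c \<longleftrightarrow> finite G \<and> (\<forall>\<gamma>\<in>G. 0 < sz \<gamma>)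
     \<and> bij_betw (\<lambda>i. (g i, c i)) {..<n} (SIGMA \<gamma>:G. {..<sz \<gamma>})"

definition shift_mat :: "nat \<Rightarrow> (nat \<Rightarrow> nat) \<Rightarrow> (nat \<Rightarrow> nat) \<Rightarrow> 'a::field mat" where
  "shift_mat n g c = mat n n (\<lambda>(i, j). if g i = g j \<and> c i = Suc (c j) then 1 else 0)"

definition shift_type :: "nat set \<Rightarrow> (nat \<Rightarrow> nat) \<Rightarrow> nat multiset" where
  "shift_type G sz = image_mset sz (mset_set G)"

lemma shift_mat_carrier [simp]: "shift_mat n g c \<in> carrier_mat n n"
  by (simp add: shift_mat_def)

lemma shift_mat_dims [simp]: "dim_row (shift_mat n g c) = n" "dim_col (shift_mat n g c) = n"
  by (simp_all add: shift_mat_def)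

lemma shift_mat_entry:
  "i < n \<Longrightarrow> j < n \<Longrightarrow> shift_mat n g c $$ (i, j) = (if g i = g j \<and> c i = Suc (c j) then 1 else 0)"
  by (simp add: shift_mat_def)

lemma shift_model_dim: "shift_model n G sz g c \<Longrightarrow> sum_mset (shift_type G sz) = n"
  unfolding shift_model_def shift_type_def
  by (auto dest!: bij_betw_same_card simp: sum_unfold_sum_mset[symmetric])

lemma shift_modelD:
  assumes "shift_model n G sz g c"
  shows "finite G" "\<gamma> \<in> G \<Longrightarrow> 0 < sz \<gamma>" "i < n \<Longrightarrow> g i \<in> G" "i < n \<Longrightarrow> c i < sz (g i)"
    "i < n \<Longrightarrow> j < n \<Longrightarrow> g i = g j \<Longrightarrow> c i = c j \<Longrightarrow> i = j"
    "\<gamma> \<in> G \<Longrightarrow> x < sz \<gamma> \<Longrightarrow> \<exists>i<n. g i = \<gamma> \<and> c i = x"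
proof -
  have b: "inj_on (\<lambda>i. (g i, c i)) {..<n}" "(\<lambda>i. (g i, c i)) ` {..<n} = (SIGMA \<gamma>:G. {..<sz \<gamma>})"
    using assms by (auto simp: shift_model_def bij_betw_def)
  show "finite G" "\<gamma> \<in> G \<Longrightarrow> 0 < sz \<gamma>" using assms by (auto simp: shift_model_def)
  show "i < n \<Longrightarrow> j < n \<Longrightarrow> g i = g j \<Longrightarrow> c i = c j \<Longrightarrow> i = j" using b(1) by (auto simp: inj_on_def)
  have "i < n \<Longrightarrow> (g i, c i) \<in> (SIGMA \<gamma>:G. {..<sz \<gamma>})" unfolding b(2)[symmetric] by blast
  then show "i < n \<Longrightarrow> g i \<in> G" "i < n \<Longrightarrow> c i < sz (g i)" by auto
  show "\<exists>i<n. g i = \<gamma> \<and> c i = x" if "\<gamma> \<in> G" "x < sz \<gamma>"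
  proof -
    have "(\<gamma>, x) \<in> (\<lambda>i. (g i, c i)) ` {..<n}" unfolding b(2) using that by simp
    then show ?thesis by auto
  qed
qed

section \<open>Shift matrices as representatives of Jordan types\<close>

lemma similar_mat_permuted:
  fixes A B :: "'a::field mat"
  assumes A: "A \<in> carrier_mat n n" and B: "B \<in> carrier_mat n n" and p: "bij_betw p {..<n} {..<n}"
    and e: "\<And>i j. i < n \<Longrightarrow> j < n \<Longrightarrow> A $$ (i, j) = B $$ (p i, p j)"
  shows "similar_mat A B"
proof -
  define P where "P = mat n n (\<lambda>(i, j). if j = p i then 1 else 0 :: 'a)"
  define Q where "Q = mat n n (\<lambda>(i, j). if i = p j then 1 else 0 :: 'a)"
  have pn: "p i < n" if "i < n" for i using p that by (auto simp: bij_betw_def)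
  have inj: "p i = p j \<longleftrightarrow> i = j" if "i < n" "j < n" for i j
    using p that by (auto simp: bij_betw_def inj_on_def)
  have PQc: "P \<in> carrier_mat n n" "Q \<in> carrier_mat n n" by (auto simp: P_def Q_def)
  have PX: "(P * X) $$ (i, j) = X $$ (p i, j)" if "X \<in> carrier_mat n n" "i < n" "j < n" for X i j
    using that pn by (subst mult_mat_entry[OF PQc(1) that]) (auto simp: P_def if_distrib[of "\<lambda>x. x * _"] cong: if_cong)
  have XQ: "(X * Q) $$ (i, j) = X $$ (i, p j)" if "X \<in> carrier_mat n n" "i < n" "j < n" for X i j
    using that pn by (subst mult_mat_entry[OF that(1) PQc(2) that(2,3)]) (auto simp: Q_def if_distrib[of "\<lambda>x. _ * x"] cong: if_cong)
  have PQ: "P * Q = 1\<^sub>m n"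
    by (intro eq_matI) (use PX[OF PQc(2)] PQc pn inj in \<open>auto simp: Q_def\<close>)
  have QP: "Q * P = 1\<^sub>m n" by (rule mat_mult_left_right_inverse[OF PQc PQ])
  have "A = P * B * Q"
    by (intro eq_matI) (use XQ[of "P * B"] PX[OF B] e A B PQc pn in auto)
  then show ?thesis using A B PQc PQ QP by (intro similar_matI[of A B P Q n]) auto
qed

text \<open>Used to match the strings of two models by length; removing one matched pair at a time
  copes with repeated lengths.\<close>

lemma bij_betw_of_image_mset_eq:
  assumes "finite A" "finite B" "image_mset f (mset_set A) = image_mset h (mset_set B)"
  shows "\<exists>p. bij_betw p A B \<and> (\<forall>a\<in>A. h (p a) = f a)"
  using assms
proof (induction A arbitrary: B rule: finite_induct)
  case empty
  have "image_mset h (mset_set B) = {#}" unfolding empty.prems(2)[symmetric] by simp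
  then have "B = {}" using empty.prems(1) by (simp add: mset_set_empty_iff)
  then show ?case by (simp add: bij_betw_def)
next
  case (insert x F)
  have "f x \<in># image_mset f (mset_set (insert x F))" using insert.hyps by simp
  then have "f x \<in># image_mset h (mset_set B)" unfolding insert.prems(2) .
  then obtain y where y: "y \<in> B" "h y = f x" using insert.prems(1) by auto
  have "image_mset f (mset_set F) = image_mset h (mset_set (B - {y}))"
    using insert.prems insert.hyps y by (simp add: mset_set.remove)
  then obtain p where p: "bij_betw p F (B - {y})" "\<forall>a\<in>F. h (p a) = f a"
    using insert.IH[of "B - {y}"] insert.prems(1) by auto
  have "bij_betw (p(x := y)) F (B - {y})"
    using p(1) insert.hyps by (subst bij_betw_cong[of F _ p]) auto
  then have "bij_betw (p(x := y)) (F \<union> {x}) ((B - {y}) \<union> {(p(x := y)) x})"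
    by (subst notIn_Un_bij_betw3[symmetric]) (use insert.hyps in auto)
  moreover have "F \<union> {x} = insert x F" "(B - {y}) \<union> {(p(x := y)) x} = B" using y by auto
  ultimately have "bij_betw (p(x := y)) (insert x F) B" by simp
  moreover have "\<forall>a\<in>insert x F. h ((p(x := y)) a) = f a" using p y insert.hyps by auto
  ultimately show ?case by blast
qed

text \<open>Strings of equal length are matched and positions on them kept. Only the multiset of
  lengths matters, so the Jordan matrix can be replaced by whatever arrangement of the basis suits a
  construction.\<close>

lemma shift_models_similar:
  assumes m: "shift_model n G sz g c" and m': "shift_model n' G' sz' g' c'"
    and t: "shift_type G sz = shift_type G' sz'"
  shows "similar_mat (shift_mat n g c :: 'a::field mat) (shift_mat n' g' c')"
proof -
  have nn: "n' = n" using shift_model_dim[OF m] shift_model_dim[OF m'] t by simp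
  note m' = m'[unfolded nn]
  obtain \<beta> where \<beta>: "bij_betw \<beta> G G'" "\<forall>\<gamma>\<in>G. sz' (\<beta> \<gamma>) = sz \<gamma>"
    using bij_betw_of_image_mset_eq[of G G' sz sz'] shift_modelD(1)[OF m] shift_modelD(1)[OF m'] t
    unfolding shift_type_def by blast
  note D = shift_modelD[OF m] and D' = shift_modelD[OF m']
  have "\<exists>k<n. g' k = \<beta> (g i) \<and> c' k = c i" if "i < n" for i
    using D(3,4)[OF that] \<beta> D'(6) by (auto simp: bij_betw_def)
  then obtain p where p: "\<And>i. i < n \<Longrightarrow> p i < n \<and> g' (p i) = \<beta> (g i) \<and> c' (p i) = c i" by metis
  have \<beta>i: "\<beta> x = \<beta> y \<longleftrightarrow> x = y" if "x \<in> G" "y \<in> G" for x y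
    using \<beta>(1) that by (auto simp: bij_betw_def inj_on_def)
  have "inj_on p {..<n}"
  proof (rule inj_onI)
    fix i j assume ij: "i \<in> {..<n}" "j \<in> {..<n}" "p i = p j"
    then show "i = j" using p[of i] p[of j] \<beta>i D(3) D(5)[of i j] by simp
  qed
  moreover have "p ` {..<n} \<subseteq> {..<n}" using p by auto
  ultimately have "bij_betw p {..<n} {..<n}" by (simp add: bij_betw_def endo_inj_surj)
  then show ?thesis unfolding nn
    by (rule similar_mat_permuted[rotated 2]) (use p \<beta>i D(3) in \<open>auto simp: shift_mat_entry\<close>)
qed

lemma jordan_matrix_shift_model:
  assumes "\<forall>s\<in>set xs. 0 < s"
  shows "\<exists>g c. shift_model (sum_list xs) {..<length xs} ((!) xs) g c
     \<and> jordan_matrix (map (\<lambda>s. (s, 0)) xs) = (shift_mat (sum_list xs) g c :: 'a::field mat)"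
  using assms
proof (induction xs)
  case Nil
  show ?case by (intro exI conjI) (auto simp: shift_model_def bij_betw_def jordan_matrix_def shift_mat_def)
next
  case (Cons s xs)
  let ?n = "sum_list xs"
  from Cons obtain g c where m: "shift_model ?n {..<length xs} ((!) xs) g c"
    and J: "jordan_matrix (map (\<lambda>s. (s, 0)) xs) = (shift_mat ?n g c :: 'a mat)" by auto
  note D = shift_modelD[OF m]
  define g' where "g' = (\<lambda>i. if i < s then 0 else Suc (g (i - s)))"
  \<comment> \<open>A Jordan block has its ones above the diagonal, so its string runs from the last
    index of the block to the first.\<close>
  define c' where "c' = (\<lambda>i. if i < s then s - 1 - i else c (i - s))"
  have "shift_model (sum_list (s # xs)) {..<length (s # xs)} ((!) (s # xs)) g' c'"
    unfolding shift_model_def bij_betw_def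
  proof (intro conjI)
    show "\<forall>\<gamma>\<in>{..<length (s # xs)}. 0 < (s # xs) ! \<gamma>" using Cons.prems nth_mem by (metis lessThan_iff)
    show "inj_on (\<lambda>i. (g' i, c' i)) {..<sum_list (s # xs)}"
    proof (rule inj_onI)
      fix i j assume a: "i \<in> {..<sum_list (s # xs)}" "j \<in> {..<sum_list (s # xs)}" "(g' i, c' i) = (g' j, c' j)"
      show "i = j"
      proof (cases "i < s")
        case True
        then have "j < s" using a by (auto simp: g'_def split: if_splits)
        then show ?thesis using True a by (auto simp: c'_def)
      next
        case False
        then have "\<not> j < s" using a by (auto simp: g'_def split: if_splits)
        then have "i - s = j - s" using D(5)[of "i - s" "j - s"] False a by (auto simp: g'_def c'_def)
        then show ?thesis using False \<open>\<not> j < s\<close> by simp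
      qed
    qed
    show "(\<lambda>i. (g' i, c' i)) ` {..<sum_list (s # xs)} = (SIGMA \<gamma>:{..<length (s # xs)}. {..<(s # xs) ! \<gamma>})"
    proof (intro equalityI subsetI)
      fix y assume "y \<in> (\<lambda>i. (g' i, c' i)) ` {..<sum_list (s # xs)}"
      then obtain i where i: "i < s + ?n" "y = (g' i, c' i)" by auto
      show "y \<in> (SIGMA \<gamma>:{..<length (s # xs)}. {..<(s # xs) ! \<gamma>})"
        using i D(3)[of "i - s"] D(4)[of "i - s"] by (cases "i < s") (auto simp: g'_def c'_def)
    next
      fix y assume "y \<in> (SIGMA \<gamma>:{..<length (s # xs)}. {..<(s # xs) ! \<gamma>})"
      then obtain \<gamma> x where y: "y = (\<gamma>, x)" "\<gamma> < Suc (length xs)" "x < (s # xs) ! \<gamma>" by auto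
      show "y \<in> (\<lambda>i. (g' i, c' i)) ` {..<sum_list (s # xs)}"
      proof (cases \<gamma>)
        case 0
        then have "x < s" using y by simp
        then show ?thesis using y 0 by (intro image_eqI[of _ _ "s - 1 - x"]) (auto simp: g'_def c'_def)
      next
        case (Suc \<delta>)
        then obtain i where "i < ?n" "g i = \<delta>" "c i = x" using D(6)[of \<delta> x] y by auto
        then show ?thesis using y Suc by (intro image_eqI[of _ _ "s + i"]) (auto simp: g'_def c'_def)
      qed
    qed
  qed auto
  moreover have "jordan_matrix (map (\<lambda>s. (s, 0)) (s # xs)) = (shift_mat (sum_list (s # xs)) g' c' :: 'a mat)"
  proof -
    have "sum_list (map fst (map (\<lambda>s. (s, 0 :: 'a)) xs)) = ?n" by (simp add: o_def)
    then show ?thesis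
      by (simp only: list.map jordan_matrix_Cons J, intro eq_matI)
        (auto simp: shift_mat_entry g'_def c'_def index_mat_four_block)
  qed
  ultimately show ?case by blast
qed

lemma shift_type_nth: "shift_type {..<length xs} ((!) xs) = mset xs"
  unfolding shift_type_def by (metis map_nth mset_map mset_set_upto_eq_mset_upto)

lemma has_jordan_type_shift_mat:
  assumes m: "shift_model n G sz g c"
  shows "has_jordan_type (shift_mat n g c :: 'a::field mat) (shift_type G sz)"
proof -
  let ?xs = "rev (sorted_list_of_multiset (shift_type G sz))"
  have "\<forall>s\<in>set ?xs. 0 < s" using shift_modelD(1,2)[OF m] by (auto simp: shift_type_def)
  from jordan_matrix_shift_model[OF this, where 'a = 'a]
  obtain g' c' where *: "shift_model (sum_list ?xs) {..<length ?xs} ((!) ?xs) g' c'"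
     "jordan_matrix (map (\<lambda>s. (s, 0)) ?xs) = (shift_mat (sum_list ?xs) g' c' :: 'a mat)" by (elim exE conjE)
  have "similar_mat (shift_mat n g c :: 'a mat) (shift_mat (sum_list ?xs) g' c')"
    by (rule shift_models_similar[OF m *(1)]) (unfold shift_type_nth, simp)
  then show ?thesis
    unfolding has_jordan_type_def jordan_nf_def nilp_blocks_def *(2)
    using \<open>\<forall>s\<in>set ?xs. 0 < s\<close> by auto
qed

lemma has_jordan_typeE:
  fixes A :: "'a::field mat"
  assumes "has_jordan_type A P"
  obtains G sz g c where "shift_model (sum_mset P) G sz g c" "shift_type G sz = P"
    "similar_mat A (shift_mat (sum_mset P) g c)"
proof -
  let ?xs = "rev (sorted_list_of_multiset P)"
  have "0 \<notin> fst ` set (map (\<lambda>s. (s, 0 :: 'a)) ?xs)"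
    using assms unfolding has_jordan_type_def jordan_nf_def nilp_blocks_def by blast
  then have "0 \<notin> set ?xs" by (simp add: image_image)
  then have p: "\<forall>s\<in>set ?xs. 0 < s" by (metis gr_zeroI)
  have "sum_list ?xs = sum_mset (mset ?xs)" by (simp only: sum_mset_sum_list)
  then have s: "sum_list ?xs = sum_mset P" by simp
  from jordan_matrix_shift_model[OF p, where 'a = 'a]
  obtain g c where *: "shift_model (sum_list ?xs) {..<length ?xs} ((!) ?xs) g c"
     "jordan_matrix (map (\<lambda>s. (s, 0)) ?xs) = (shift_mat (sum_list ?xs) g c :: 'a mat)" by (elim exE conjE)
  have "similar_mat A (shift_mat (sum_mset P) g c)"
    using assms unfolding has_jordan_type_def jordan_nf_def nilp_blocks_def *(2) s by blast
  moreover have "shift_type {..<length ?xs} ((!) ?xs) = P" unfolding shift_type_nth by simp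
  ultimately show thesis using that *(1)[unfolded s] by blast
qed

lemma nilpotent_has_jordan_type:
  fixes A :: "'a::field mat"
  assumes "A \<in> carrier_mat n n" "A ^\<^sub>m m = 0\<^sub>m n n"
  shows "\<exists>P. has_jordan_type A P"
proof -
  obtain xs where J: "jordan_nf A (map (\<lambda>s. (s, 0)) xs)" using jordan_nf_nilpotent[OF assms] by blast
  then have "0 \<notin> fst ` set (map (\<lambda>s. (s, 0 :: 'a)) xs)" unfolding jordan_nf_def by blast
  then have "0 \<notin> set xs" by (simp add: image_image)
  then have p: "\<forall>s\<in>set xs. 0 < s" by (metis gr_zeroI)
  from jordan_matrix_shift_model[OF p, where 'a = 'a]
  obtain g c where *: "shift_model (sum_list xs) {..<length xs} ((!) xs) g c"
     "jordan_matrix (map (\<lambda>s. (s, 0)) xs) = (shift_mat (sum_list xs) g c :: 'a mat)" by (elim exE conjE)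
  have "similar_mat A (shift_mat (sum_list xs) g c)" using J unfolding jordan_nf_def *(2) by blast
  then have "has_jordan_type A (shift_type {..<length xs} ((!) xs))"
    using has_jordan_type_shift_mat[OF *(1), where 'a = 'a] similar_mat_trans[of A]
    unfolding has_jordan_type_def jordan_nf_def by metis
  then show ?thesis by blast
qed

text \<open>The number of blocks of each positive size is computed from the matrix alone, and size 0
  does not occur in a Jordan form.\<close>

lemma has_jordan_type_unique:
  fixes A :: "'a::field mat"
  assumes "has_jordan_type A P" "has_jordan_type A Q"
  shows "P = Q"
proof (rule multiset_eqI)
  fix s
  have c: "count R s = (if s = 0 then 0 else compute_nr_of_jordan_blocks A 0 s)" if "has_jordan_type A R" for R
  proof (cases "s = 0")
    case True
    have "0 \<notin> fst ` set (nilp_blocks R :: (nat \<times> 'a) list)"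
      using that unfolding has_jordan_type_def jordan_nf_def by blast
    then have "0 \<notin># R" by (simp add: nilp_blocks_def image_image)
    then show ?thesis using True by (simp add: not_in_iff)
  next
    case False
    have "compute_nr_of_jordan_blocks A 0 s = length (filter ((=) (s, 0)) (nilp_blocks R :: (nat \<times> 'a) list))"
      using that False unfolding has_jordan_type_def by (rule compute_nr_of_jordan_blocks)
    also have "\<dots> = count (mset (rev (sorted_list_of_multiset R))) s"
    proof -
      have "length (filter ((=) (s, 0)) (map (\<lambda>s. (s, 0 :: 'a)) xs)) = count (mset xs) s" for xs
        by (induction xs) auto
      then show ?thesis unfolding nilp_blocks_def .
    qed
    finally show ?thesis using False by simp
  qed
  show "count P s = count Q s" using c[OF assms(1)] c[OF assms(2)] by simp
qed

lemma shift_mat_pow_entry: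
  assumes m: "shift_model n G sz g c" and ij: "i < n" "j < n"
  shows "(shift_mat n g c ^\<^sub>m k :: 'a::field mat) $$ (i, j) = (if g i = g j \<and> c i = c j + k then 1 else 0)"
  using ij
proof (induction k arbitrary: i j)
  case 0
  then have "g i = g j \<and> c i = c j \<longleftrightarrow> i = j" using shift_modelD(5)[OF m 0] by blast
  then show ?case using 0 by simp
next
  case (Suc k)
  have "(shift_mat n g c ^\<^sub>m Suc k :: 'a mat) $$ (i, j) = (\<Sum>l<n. (shift_mat n g c ^\<^sub>m k) $$ (i, l) * shift_mat n g c $$ (l, j))"
    unfolding pow_mat.simps using Suc.prems by (intro mult_mat_entry) auto
  also have "\<dots> = (\<Sum>l<n. if g i = g l \<and> c i = c l + k \<and> g l = g j \<and> c l = Suc (c j) then 1 else 0)"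
    using Suc.prems by (intro sum.cong) (simp_all add: shift_mat_entry Suc.IH)
  also have "\<dots> = (if g i = g j \<and> c i = c j + Suc k then 1 else 0)"
  proof (cases "g i = g j \<and> c i = c j + Suc k")
    case True
    have "Suc (c j) < sz (g j)" using shift_modelD(4)[OF m Suc.prems(1)] True by simp
    then obtain l where l: "l < n" "g l = g j" "c l = Suc (c j)"
      using shift_modelD(6)[OF m shift_modelD(3)[OF m Suc.prems(2)]] by blast
    have "(\<Sum>l'<n. if g i = g l' \<and> c i = c l' + k \<and> g l' = g j \<and> c l' = Suc (c j) then 1 else 0 :: 'a)
       = (\<Sum>l'<n. if l' = l then 1 else 0)"
    proof (rule sum.cong[OF refl])
      fix l' assume "l' \<in> {..<n}"
      then have "g l' = g j \<and> c l' = Suc (c j) \<longleftrightarrow> l' = l" using shift_modelD(5)[OF m, of l' l] l by auto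
      then show "(if g i = g l' \<and> c i = c l' + k \<and> g l' = g j \<and> c l' = Suc (c j) then 1 else 0 :: 'a)
        = (if l' = l then 1 else 0)" using True by auto
    qed
    then show ?thesis using True l(1) by simp
  next
    case False
    then show ?thesis by (subst sum.neutral) auto
  qed
  finally show ?case .
qed

text \<open>The largest part is read off the nilpotency index. For a type with at most two parts,
  this and the dimension determine everything.\<close>

lemma has_jordan_type_pow_zero_iff:
  fixes A :: "'a::field mat"
  assumes A: "A \<in> carrier_mat n n" and t: "has_jordan_type A P"
  shows "A ^\<^sub>m k = 0\<^sub>m n n \<longleftrightarrow> (\<forall>s\<in>#P. s \<le> k)" "sum_mset P = n"
proof -
  obtain G sz g c where m: "shift_model (sum_mset P) G sz g c" "shift_type G sz = P"
    "similar_mat A (shift_mat (sum_mset P) g c)" using has_jordan_typeE[OF t] .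
  then obtain S R where w: "similar_mat_wit A (shift_mat (sum_mset P) g c) S R" unfolding similar_mat_def by blast
  show n: "sum_mset P = n" using similar_mat_witD2[OF A w] by (metis carrier_matD(1) shift_mat_dims(1))
  note m = m[unfolded n] and w = w[unfolded n]
  note D = shift_modelD[OF m(1)]
  have "A ^\<^sub>m k = 0\<^sub>m n n \<longleftrightarrow> (shift_mat n g c ^\<^sub>m k :: 'a mat) = 0\<^sub>m n n"
    by (rule similar_mat_wit_pow_zero_iff[OF w A])
  also have "\<dots> \<longleftrightarrow> (\<forall>\<gamma>\<in>G. sz \<gamma> \<le> k)"
  proof (intro iffI ballI)
    fix \<gamma> assume z: "(shift_mat n g c ^\<^sub>m k :: 'a mat) = 0\<^sub>m n n" and \<gamma>: "\<gamma> \<in> G"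
    show "sz \<gamma> \<le> k"
    proof (rule ccontr)
      assume "\<not> sz \<gamma> \<le> k"
      then obtain i j where ij: "i < n" "g i = \<gamma>" "c i = k" "j < n" "g j = \<gamma>" "c j = 0"
        using D(6)[OF \<gamma>, of k] D(6)[OF \<gamma>, of 0] D(2)[OF \<gamma>] by auto
      then have "(shift_mat n g c ^\<^sub>m k :: 'a mat) $$ (i, j) = 1" by (subst shift_mat_pow_entry[OF m(1)]) auto
      then show False using z ij by simp
    qed
  next
    assume a: "\<forall>\<gamma>\<in>G. sz \<gamma> \<le> k"
    show "(shift_mat n g c ^\<^sub>m k :: 'a mat) = 0\<^sub>m n n"
    proof (rule eq_matI)
      fix i j assume ij: "i < dim_row (0\<^sub>m n n :: 'a mat)" "j < dim_col (0\<^sub>m n n :: 'a mat)"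
      then have "c i < k" using a D(3,4)[of i] by force
      then show "(shift_mat n g c ^\<^sub>m k) $$ (i, j) = (0\<^sub>m n n :: 'a mat) $$ (i, j)"
        using ij by (subst shift_mat_pow_entry[OF m(1)]) auto
    qed auto
  qed
  also have "\<dots> \<longleftrightarrow> (\<forall>s\<in>#P. s \<le> k)" using m(2) D(1) by (auto simp: shift_type_def)
  finally show "A ^\<^sub>m k = 0\<^sub>m n n \<longleftrightarrow> (\<forall>s\<in>#P. s \<le> k)" .
qed

section \<open>The centralizer of a shift\<close>

locale shift =
  fixes n :: nat and G :: "nat set" and sz g c :: "nat \<Rightarrow> nat"
  assumes model: "shift_model n G sz g c"
begin

lemmas fin = shift_modelD(1)[OF model]
  and sz_pos = shift_modelD(2)[OF model]
  and g_in = shift_modelD(3)[OF model]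
  and c_less = shift_modelD(4)[OF model]
  and idx_eqI = shift_modelD(5)[OF model]
  and idx_ex = shift_modelD(6)[OF model]

abbreviation S :: "'a::field mat" where "S \<equiv> shift_mat n g c"

definition succ_of :: "nat \<Rightarrow> nat \<Rightarrow> bool" where
  "succ_of i' i \<longleftrightarrow> i < n \<and> i' < n \<and> g i' = g i \<and> c i' = Suc (c i)"

lemma ex_succ: "i < n \<Longrightarrow> Suc (c i) < sz (g i) \<Longrightarrow> \<exists>i'. succ_of i' i"
  using idx_ex[OF g_in, of i "Suc (c i)"] unfolding succ_of_def by auto

lemma ex_pred: "i < n \<Longrightarrow> 0 < c i \<Longrightarrow> \<exists>i'. succ_of i i'"
  using idx_ex[OF g_in, of i "c i - 1"] c_less[of i] unfolding succ_of_def by force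

lemma mult_S:
  fixes A :: "'a::field mat"
  assumes A: "A \<in> carrier_mat n n" and ij: "i < n" "j < n"
  shows "succ_of j' j \<Longrightarrow> (A * S) $$ (i, j) = A $$ (i, j')"
    and "Suc (c j) = sz (g j) \<Longrightarrow> (A * S) $$ (i, j) = 0"
    and "succ_of i i' \<Longrightarrow> (S * A) $$ (i, j) = A $$ (i', j)"
    and "c i = 0 \<Longrightarrow> (S * A) $$ (i, j) = 0"
proof -
  have AS: "(A * S) $$ (i, j) = (\<Sum>k<n. A $$ (i, k) * S $$ (k, j))"
    by (rule mult_mat_entry[OF A shift_mat_carrier ij])
  have SA: "(S * A) $$ (i, j) = (\<Sum>k<n. S $$ (i, k) * A $$ (k, j))"
    by (rule mult_mat_entry[OF shift_mat_carrier A ij])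
  show "(A * S) $$ (i, j) = A $$ (i, j')" if s: "succ_of j' j"
  proof -
    have "A $$ (i, k) * S $$ (k, j) = (if k = j' then A $$ (i, j') else 0)" if k: "k < n" for k
    proof -
      have "g k = g j \<and> c k = Suc (c j) \<longleftrightarrow> k = j'"
        using idx_eqI[OF k, of j'] s unfolding succ_of_def by metis
      then show ?thesis by (simp add: shift_mat_entry[OF k ij(2)])
    qed
    then show ?thesis unfolding AS using s by (simp add: succ_of_def)
  qed
  show "(A * S) $$ (i, j) = 0" if s: "Suc (c j) = sz (g j)"
    unfolding AS
  proof (intro sum.neutral ballI)
    fix k assume "k \<in> {..<n}"
    then show "A $$ (i, k) * S $$ (k, j) = 0" using c_less[of k] s ij by (auto simp: shift_mat_entry)
  qed
  show "(S * A) $$ (i, j) = A $$ (i', j)" if s: "succ_of i i'"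
  proof -
    have "S $$ (i, k) * A $$ (k, j) = (if k = i' then A $$ (i', j) else 0)" if k: "k < n" for k
    proof -
      have "g i = g k \<and> c i = Suc (c k) \<longleftrightarrow> k = i'"
        using idx_eqI[OF k, of i'] s unfolding succ_of_def by (metis Suc_inject)
      then show ?thesis by (simp add: shift_mat_entry[OF ij(1) k])
    qed
    then show ?thesis unfolding SA using s by (simp add: succ_of_def)
  qed
  show "(S * A) $$ (i, j) = 0" if s: "c i = 0"
    unfolding SA by (intro sum.neutral ballI) (use s ij in \<open>auto simp: shift_mat_entry\<close>)
qed

definition comm :: "'a::field mat \<Rightarrow> bool" where
  "comm A \<longleftrightarrow> A \<in> carrier_mat n n \<and> A * S = S * A"

text \<open>In \<open>A * S\<close> the column index moves to its successor, in \<open>S * A\<close>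
  the row index to its predecessor. The three conditions are the cases where both neighbours exist
  or exactly one of them does; if neither exists, both products vanish.\<close>

lemma commI:
  fixes A :: "'a::field mat"
  assumes A: "A \<in> carrier_mat n n"
    and 1: "\<And>i' i j' j. succ_of i' i \<Longrightarrow> succ_of j' j \<Longrightarrow> A $$ (i', j') = A $$ (i, j)"
    and 2: "\<And>i' i j. succ_of i' i \<Longrightarrow> j < n \<Longrightarrow> Suc (c j) = sz (g j) \<Longrightarrow> A $$ (i, j) = 0"
    and 3: "\<And>i j' j. succ_of j' j \<Longrightarrow> i < n \<Longrightarrow> c i = 0 \<Longrightarrow> A $$ (i, j') = 0"
  shows "comm A"
  unfolding comm_def
proof (intro conjI A eq_matI)
  fix i j assume "i < dim_row (S * A)" "j < dim_col (S * A)"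
  then have ij: "i < n" "j < n" using A by auto
  note m = mult_S[OF A ij]
  have j: "Suc (c j) = sz (g j) \<or> (\<exists>j'. succ_of j' j)" using ex_succ[OF ij(2)] c_less[OF ij(2)] by force
  have i: "c i = 0 \<or> (\<exists>i'. succ_of i i')" using ex_pred[OF ij(1)] by auto
  show "(A * S) $$ (i, j) = (S * A) $$ (i, j)"
    using i j m 1[of i _ _ j] 2[of i _ j] 3[of _ j i] ij by (elim disjE exE) metis+
qed (use A in auto)

lemma commD:
  fixes A :: "'a::field mat"
  assumes "comm A"
  shows "A \<in> carrier_mat n n"
    "succ_of i' i \<Longrightarrow> succ_of j' j \<Longrightarrow> A $$ (i', j') = A $$ (i, j)"
    "succ_of i' i \<Longrightarrow> j < n \<Longrightarrow> Suc (c j) = sz (g j) \<Longrightarrow> A $$ (i, j) = 0"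
    "succ_of j' j \<Longrightarrow> i < n \<Longrightarrow> c i = 0 \<Longrightarrow> A $$ (i, j') = 0"
proof -
  have A: "A \<in> carrier_mat n n" and AS: "A * S = S * A" using assms by (auto simp: comm_def)
  show "A \<in> carrier_mat n n" by fact
  show "A $$ (i', j') = A $$ (i, j)" if "succ_of i' i" "succ_of j' j"
    using mult_S(1)[OF A, of i' j j'] mult_S(3)[OF A, of i' j i] AS that by (auto simp: succ_of_def)
  show "A $$ (i, j) = 0" if "succ_of i' i" "j < n" "Suc (c j) = sz (g j)"
    using mult_S(2)[OF A, of i' j] mult_S(3)[OF A, of i' j i] AS that by (auto simp: succ_of_def)
  show "A $$ (i, j') = 0" if "succ_of j' j" "i < n" "c i = 0"
    using mult_S(1)[OF A, of i j j'] mult_S(4)[OF A, of i j] AS that by (auto simp: succ_of_def)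
qed

lemma comm_mult:
  assumes "comm A" "comm B"
  shows "comm (A * B)"
proof -
  have c: "A \<in> carrier_mat n n" "B \<in> carrier_mat n n" and AB: "A * S = S * A" "B * S = S * B"
    using assms by (auto simp: comm_def)
  have "A * B * S = A * (B * S)" by (rule assoc_mult_mat[OF c shift_mat_carrier])
  also have "\<dots> = A * S * B"
    unfolding AB(2) by (rule assoc_mult_mat[symmetric, OF c(1) shift_mat_carrier c(2)])
  also have "\<dots> = S * (A * B)" unfolding AB(1) by (rule assoc_mult_mat[OF shift_mat_carrier c])
  finally show ?thesis using c by (auto simp: comm_def)
qed

lemma comm_one: "comm (1\<^sub>m n)"
  unfolding comm_def
  by (simp only: left_mult_one_mat[OF shift_mat_carrier] right_mult_one_mat[OF shift_mat_carrier]
      one_carrier_mat simp_thms)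

lemma comm_pow: "comm A \<Longrightarrow> comm (A ^\<^sub>m k)"
proof (induction k)
  case 0
  then have "dim_row A = n" by (auto simp: comm_def)
  then show ?case using comm_one by simp
next
  case (Suc k)
  then show ?case by (simp add: comm_mult)
qed

text \<open>Slide the entry along its strings, one place in row and column at a time. Going down,
  the row must not reach the start before the column does; going up, the column must not reach the
  end before the row does. In module terms, a map commuting with the shift can neither lower the
  depth of an element nor raise the power of the shift that kills it.\<close>

lemma comm_entry_le:
  fixes A :: "'a::field mat"
  assumes A: "comm A" and "i < n" "j < n" "A $$ (i, j) \<noteq> 0"
  shows "c j \<le> c i" "sz (g i) + c j \<le> sz (g j) + c i"
proof -
  note D = commD[OF A]
  show "c j \<le> c i" using assms(2-)
  proof (induction "c j" arbitrary: i j)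
    case (Suc x)
    obtain j0 where j0: "succ_of j j0" using ex_pred[of j] Suc by auto
    have "c i \<noteq> 0" using D(4)[OF j0] Suc.prems by blast
    then obtain i0 where i0: "succ_of i i0" using ex_pred[of i] Suc by auto
    have "c j0 \<le> c i0"
      by (rule Suc.hyps(1)) (use j0 i0 Suc D(2)[OF i0 j0] in \<open>auto simp: succ_of_def\<close>)
    then show ?case using j0 i0 by (simp add: succ_of_def)
  qed simp
  show "sz (g i) + c j \<le> sz (g j) + c i" using assms(2-)
  proof (induction "sz (g j) - c j" arbitrary: i j)
    case 0
    then show ?case using c_less[of j] by simp
  next
    case (Suc x)
    show ?case
    proof (cases "Suc (c i) = sz (g i)")
      case True
      then show ?thesis using c_less[OF Suc.prems(2)] by simp
    next
      case False
      then obtain i' where i': "succ_of i' i" using ex_succ[of i] c_less[of i] Suc.prems by force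
      then have "Suc (c j) \<noteq> sz (g j)" using D(3)[OF i'] Suc.prems by blast
      then obtain j' where j': "succ_of j' j" using ex_succ[of j] c_less[of j] Suc.prems by force
      have "sz (g i') + c j' \<le> sz (g j') + c i'"
        by (rule Suc.hyps(1)) (use j' i' Suc D(2)[OF i' j'] in \<open>auto simp: succ_of_def\<close>)
      then show ?thesis using j' i' by (simp add: succ_of_def)
    qed
  qed
qed

section \<open>The centralizer modulo its radical: one matrix algebra for each string length\<close>

definition cell :: "nat \<Rightarrow> nat \<Rightarrow> nat set" where
  "cell p x = {k. k < n \<and> c k = x \<and> sz (g k) = p}"

definition mult_of :: "nat \<Rightarrow> nat" where
  "mult_of p = card {\<gamma> \<in> G. sz \<gamma> = p}"

text \<open>Counted from the largest label downwards, so that strictly upper triangular matrices in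
  these ranks are those whose nonzero entries raise the label \<open>g\<close>. The string matrices
  constructed later raise it.\<close>

definition rank_of :: "nat \<Rightarrow> nat" where
  "rank_of \<gamma> = card {\<delta> \<in> G. sz \<delta> = sz \<gamma> \<and> \<gamma> < \<delta>}"

lemma rank_less: "\<gamma> \<in> G \<Longrightarrow> rank_of \<gamma> < mult_of (sz \<gamma>)"
  unfolding rank_of_def mult_of_def using fin by (intro psubset_card_mono) auto

lemma rank_antimono: "\<gamma> \<in> G \<Longrightarrow> \<delta> \<in> G \<Longrightarrow> sz \<gamma> = sz \<delta> \<Longrightarrow> \<gamma> < \<delta> \<Longrightarrow> rank_of \<delta> < rank_of \<gamma>"
  unfolding rank_of_def using fin by (intro psubset_card_mono) auto

lemma rank_less_iff: "\<gamma> \<in> G \<Longrightarrow> \<delta> \<in> G \<Longrightarrow> sz \<gamma> = sz \<delta> \<Longrightarrow> rank_of \<delta> < rank_of \<gamma> \<longleftrightarrow> \<gamma> < \<delta>"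
  by (metis rank_antimono linorder_neqE_nat not_less_iff_gr_or_eq)

lemma rank_eq_iff: "\<gamma> \<in> G \<Longrightarrow> \<delta> \<in> G \<Longrightarrow> sz \<gamma> = sz \<delta> \<Longrightarrow> rank_of \<delta> = rank_of \<gamma> \<longleftrightarrow> \<gamma> = \<delta>"
  by (metis rank_antimono linorder_neqE_nat not_less_iff_gr_or_eq)

lemma bij_rank_cell:
  assumes "x < p"
  shows "bij_betw (\<lambda>k. rank_of (g k)) (cell p x) {..<mult_of p}"
proof -
  have i: "inj_on (\<lambda>k. rank_of (g k)) (cell p x)"
  proof (rule inj_onI)
    fix k l assume a: "k \<in> cell p x" "l \<in> cell p x" "rank_of (g k) = rank_of (g l)"
    then have "k < n" "l < n" "sz (g k) = sz (g l)" "c k = c l" by (auto simp: cell_def)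
    moreover from this have "g k = g l" using rank_eq_iff[OF g_in g_in] a(3) by metis
    ultimately show "k = l" using idx_eqI by blast
  qed
  have s: "(\<lambda>k. rank_of (g k)) ` cell p x \<subseteq> {..<mult_of p}"
    using rank_less[OF g_in] by (auto simp: cell_def)
  have "bij_betw g (cell p x) {\<gamma> \<in> G. sz \<gamma> = p}"
    unfolding bij_betw_def
  proof (intro conjI inj_onI equalityI subsetI)
    fix k l assume "k \<in> cell p x" "l \<in> cell p x" "g k = g l"
    moreover from this have "k < n" "l < n" "c k = c l" by (auto simp: cell_def)
    ultimately show "k = l" using idx_eqI by blast
  next
    fix \<gamma> assume "\<gamma> \<in> g ` cell p x"
    then show "\<gamma> \<in> {\<gamma> \<in> G. sz \<gamma> = p}" using g_in by (auto simp: cell_def)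
  next
    fix \<gamma> assume "\<gamma> \<in> {\<gamma> \<in> G. sz \<gamma> = p}"
    then show "\<gamma> \<in> g ` cell p x" using idx_ex[of \<gamma> x] assms by (auto simp: cell_def image_iff)
  qed
  then have "card (cell p x) = mult_of p" unfolding mult_of_def by (rule bij_betw_same_card)
  then have "(\<lambda>k. rank_of (g k)) ` cell p x = {..<mult_of p}"
    using card_image[OF i] s by (intro card_subset_eq) auto
  with i show ?thesis by (simp add: bij_betw_def)
qed

text \<open>If \<open>i\<close> and \<open>j\<close> lie in one cell and both factors are nonzero,
  the two inequalities of \<open>comm_entry_le\<close>, applied to each factor, squeeze
  \<open>k\<close> into the same cell.\<close>

lemma comm_mult_cell:
  fixes A B :: "'a::field mat"
  assumes A: "comm A" and B: "comm B" and ij: "i \<in> cell p x" "j \<in> cell p x"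
  shows "(A * B) $$ (i, j) = (\<Sum>k\<in>cell p x. A $$ (i, k) * B $$ (k, j))"
proof -
  have "(A * B) $$ (i, j) = (\<Sum>k<n. A $$ (i, k) * B $$ (k, j))"
    by (rule mult_mat_entry[OF commD(1)[OF A] commD(1)[OF B]]) (use ij in \<open>auto simp: cell_def\<close>)
  also have "\<dots> = (\<Sum>k\<in>cell p x. A $$ (i, k) * B $$ (k, j))"
  proof (rule sum.mono_neutral_right)
    show "\<forall>k\<in>{..<n} - cell p x. A $$ (i, k) * B $$ (k, j) = 0"
    proof (intro ballI, rule ccontr)
      fix k assume k: "k \<in> {..<n} - cell p x" and nz: "A $$ (i, k) * B $$ (k, j) \<noteq> 0"
      then have "A $$ (i, k) \<noteq> 0" "B $$ (k, j) \<noteq> 0" by auto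
      with comm_entry_le[OF A _ _ this(1)] comm_entry_le[OF B _ _ this(2)]
      show False using k ij by (auto simp: cell_def)
    qed
  qed (auto simp: cell_def)
  finally show ?thesis .
qed

definition pos :: "nat \<Rightarrow> nat \<Rightarrow> nat \<Rightarrow> nat" where
  "pos p x = the_inv_into (cell p x) (\<lambda>k. rank_of (g k))"

lemma pos_props:
  assumes "x < p" "a < mult_of p"
  shows "pos p x a \<in> cell p x" "rank_of (g (pos p x a)) = a"
  using bij_rank_cell[OF assms(1)] assms(2) unfolding pos_def
  by (auto simp: bij_betw_def intro!: the_inv_into_into f_the_inv_into_f[of "\<lambda>k. rank_of (g k)"])

lemma pos_rank:
  assumes "k \<in> cell p x"
  shows "pos p x (rank_of (g k)) = k"
proof -
  have "x < p" using assms c_less[of k] by (auto simp: cell_def)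
  then show ?thesis unfolding pos_def using bij_rank_cell assms
    by (intro the_inv_into_f_f) (auto simp: bij_betw_def)
qed

lemma succ_pos:
  assumes "Suc x < p" "a < mult_of p"
  shows "succ_of (pos p (Suc x) a) (pos p x a)"
proof -
  note 1 = pos_props[OF assms] and 2 = pos_props[of x p a]
  have "pos p (Suc x) a < n" "pos p x a < n" "sz (g (pos p (Suc x) a)) = sz (g (pos p x a))"
    using 1 2 assms by (auto simp: cell_def)
  then have "g (pos p (Suc x) a) = g (pos p x a)"
    using rank_eq_iff[OF g_in g_in] 1(2) 2(2) assms by (metis Suc_lessD)
  then show ?thesis using 1 2 assms by (auto simp: succ_of_def cell_def)
qed

text \<open>The block on the heads of all strings of length \<open>p\<close>. Together these blocks
  are the image of \<open>A\<close> in the quotient of the centralizer by its radical.\<close>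

definition level :: "'a::field mat \<Rightarrow> nat \<Rightarrow> 'a mat" where
  "level A p = mat (mult_of p) (mult_of p) (\<lambda>(a, b). A $$ (pos p 0 a, pos p 0 b))"

lemma level_carrier [simp]: "level A p \<in> carrier_mat (mult_of p) (mult_of p)"
  by (simp add: level_def)

text \<open>Entries are constant along simultaneous shifts of row and column, so the block found at
  the heads recurs at every position \<open>x\<close>.\<close>

lemma level_entry:
  fixes A :: "'a::field mat"
  assumes A: "comm A" and ij: "i \<in> cell p x" "j \<in> cell p x"
  shows "A $$ (i, j) = level A p $$ (rank_of (g i), rank_of (g j))"
proof -
  have ab: "rank_of (g i) < mult_of p" "rank_of (g j) < mult_of p"
    using ij rank_less[OF g_in, of i] rank_less[OF g_in, of j] by (auto simp: cell_def)
  have "x < p" using ij c_less[of i] by (auto simp: cell_def)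
  then have "A $$ (pos p x a, pos p x b) = A $$ (pos p 0 a, pos p 0 b)" if "a < mult_of p" "b < mult_of p" for a b
  proof (induction x)
    case (Suc x)
    then show ?case using commD(2)[OF A succ_pos[of x p a] succ_pos[of x p b]] that by simp
  qed simp
  from this[OF ab] show ?thesis using pos_rank[OF ij(1)] pos_rank[OF ij(2)] ab by (simp add: level_def)
qed

lemma level_mult:
  fixes A B :: "'a::field mat"
  assumes A: "comm A" and B: "comm B" and p: "0 < p"
  shows "level (A * B) p = level A p * level B p"
proof (rule eq_matI)
  fix a b assume "a < dim_row (level A p * level B p)" "b < dim_col (level A p * level B p)"
  then have ab: "a < mult_of p" "b < mult_of p" by (auto simp: level_def)
  note at = pos_props[OF p]
  have "level (A * B) p $$ (a, b) = (\<Sum>k\<in>cell p 0. A $$ (pos p 0 a, k) * B $$ (k, pos p 0 b))"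
    using ab comm_mult_cell[OF A B at(1) at(1)] by (simp add: level_def)
  also have "\<dots> = (\<Sum>k\<in>cell p 0. level A p $$ (a, rank_of (g k)) * level B p $$ (rank_of (g k), b))"
    using level_entry[OF A at(1)] level_entry[OF B _ at(1)] at(2) ab by (intro sum.cong) auto
  also have "\<dots> = (\<Sum>l<mult_of p. level A p $$ (a, l) * level B p $$ (l, b))"
    by (rule sum.reindex_bij_betw[OF bij_rank_cell[OF p]])
  also have "\<dots> = (level A p * level B p) $$ (a, b)"
    using ab by (subst mult_mat_entry[OF level_carrier level_carrier]) auto
  finally show "level (A * B) p $$ (a, b) = (level A p * level B p) $$ (a, b)" .
qed (auto simp: level_def)

lemma level_one: "0 < p \<Longrightarrow> level (1\<^sub>m n) p = 1\<^sub>m (mult_of p)"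
proof (rule eq_matI)
  fix a b assume p: "0 < p" and "a < dim_row (1\<^sub>m (mult_of p) :: 'a mat)" "b < dim_col (1\<^sub>m (mult_of p) :: 'a mat)"
  then have ab: "a < mult_of p" "b < mult_of p" by auto
  have "pos p 0 a = pos p 0 b \<longleftrightarrow> a = b" using pos_props(2)[OF p] ab by metis
  then show "level (1\<^sub>m n) p $$ (a, b) = (1\<^sub>m (mult_of p) :: 'a mat) $$ (a, b)"
    using ab pos_props(1)[OF p] by (simp add: level_def cell_def)
qed (auto simp: level_def)

lemma level_pow:
  fixes A :: "'a::field mat"
  assumes "comm A" "0 < p"
  shows "level (A ^\<^sub>m k) p = level A p ^\<^sub>m k"
proof (induction k)
  case 0
  have "dim_row A = n" using commD(1)[OF assms(1)] by simp
  then show ?case using level_one[OF assms(2)] by (simp add: level_def)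
next
  case (Suc k)
  then show ?case using level_mult[OF comm_pow[OF assms(1)] assms] by simp
qed

text \<open>A section of the map to the blocks: \<open>M p\<close> acts on the set of strings of
  length \<open>p\<close>, in the same way at each position. It carries changes of basis in the
  blocks back to the centralizer.\<close>

definition spread :: "(nat \<Rightarrow> 'a::field mat) \<Rightarrow> 'a mat" where
  "spread M = mat n n (\<lambda>(i, j). if c i = c j \<and> sz (g i) = sz (g j)
     then M (sz (g i)) $$ (rank_of (g i), rank_of (g j)) else 0)"

lemma comm_spread: "comm (spread M)"
proof (rule commI)
  fix i' i j assume *: "succ_of i' i" "j < n" "Suc (c j) = sz (g j)"
  then show "spread M $$ (i, j) = 0" using c_less[of i'] by (auto simp: spread_def succ_of_def)
qed (auto simp: spread_def succ_of_def)

lemma level_spread: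
  assumes "0 < p" "M p \<in> carrier_mat (mult_of p) (mult_of p)"
  shows "level (spread M) p = M p"
  using assms pos_props[of 0 p] by (intro eq_matI) (auto simp: level_def spread_def cell_def)

lemma spread_inverse:
  fixes P Q :: "nat \<Rightarrow> 'a::field mat"
  assumes P: "\<And>p. P p \<in> carrier_mat (mult_of p) (mult_of p)" and Q: "\<And>p. Q p \<in> carrier_mat (mult_of p) (mult_of p)"
    and PQ: "\<And>p. P p * Q p = 1\<^sub>m (mult_of p)"
  shows "spread P * spread Q = 1\<^sub>m n"
proof (rule eq_matI)
  fix i j assume "i < dim_row (1\<^sub>m n :: 'a mat)" "j < dim_col (1\<^sub>m n :: 'a mat)"
  then have ij: "i < n" "j < n" by auto
  have c: "spread X \<in> carrier_mat n n" for X :: "nat \<Rightarrow> 'a mat" by (simp add: spread_def)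
  show "(spread P * spread Q) $$ (i, j) = 1\<^sub>m n $$ (i, j)"
  proof (cases "c i = c j \<and> sz (g i) = sz (g j)")
    case False
    have "(spread P * spread Q) $$ (i, j) = (\<Sum>k<n. spread P $$ (i, k) * spread Q $$ (k, j))"
      by (rule mult_mat_entry[OF c c ij])
    also have "\<dots> = 0" using False ij by (intro sum.neutral) (auto simp: spread_def)
    finally show ?thesis using False ij by auto
  next
    case True
    let ?p = "sz (g i)"
    have p: "0 < ?p" using sz_pos[OF g_in[OF ij(1)]] .
    have cl: "i \<in> cell ?p (c i)" "j \<in> cell ?p (c i)" using True ij by (auto simp: cell_def)
    have "(spread P * spread Q) $$ (i, j) = level (spread P * spread Q) ?p $$ (rank_of (g i), rank_of (g j))"
      by (rule level_entry[OF comm_mult[OF comm_spread comm_spread] cl])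
    also have "level (spread P * spread Q) ?p = 1\<^sub>m (mult_of ?p)"
      using level_mult[OF comm_spread comm_spread p, of P Q]
        level_spread[of ?p P, OF p P] level_spread[of ?p Q, OF p Q] PQ[of ?p] by simp
    also have "1\<^sub>m (mult_of ?p) $$ (rank_of (g i), rank_of (g j)) = (1\<^sub>m n $$ (i, j) :: 'a)"
    proof -
      have "rank_of (g i) = rank_of (g j) \<longleftrightarrow> i = j"
        using rank_eq_iff[OF g_in[OF ij(2)] g_in[OF ij(1)]] idx_eqI[OF ij] True by metis
      moreover have "rank_of (g i) < mult_of ?p" "rank_of (g j) < mult_of ?p"
        using True rank_less[OF g_in[OF ij(1)]] rank_less[OF g_in[OF ij(2)]] by simp_all
      ultimately show ?thesis using ij by simp
    qed
    finally show ?thesis .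
  qed
qed (auto simp: spread_def)

text \<open>The members of the centralizer whose blocks are all strictly triangular. This is a
  linear space, which later allows elements to be joined by lines.\<close>

definition strict_comm :: "'a::field mat \<Rightarrow> bool" where
  "strict_comm A \<longleftrightarrow> comm A \<and>
     (\<forall>i<n. \<forall>j<n. c i = c j \<longrightarrow> sz (g i) = sz (g j) \<longrightarrow> A $$ (i, j) \<noteq> 0 \<longrightarrow> g j < g i)"

text \<open>Each block of a nilpotent \<open>A\<close> is nilpotent, so it has a strictly triangular
  form; spreading the conjugating matrices of all blocks gives an invertible element of the
  centralizer that achieves this for all of them at once.\<close>

lemma conj_into_strict_comm:
  fixes A :: "'a::field mat"
  assumes A: "comm A" and nil: "A ^\<^sub>m m = 0\<^sub>m n n"
  shows "\<exists>H H' X. comm H \<and> comm H' \<and> H * H' = 1\<^sub>m n \<and> H' * H = 1\<^sub>m n \<and> strict_comm X \<and> A = H * X * H'"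
proof -
  have "\<exists>T P Q. similar_mat_wit (level A p) T P Q \<and> (\<forall>i<mult_of p. \<forall>j\<le>i. T $$ (i, j) = 0)" for p
  proof (cases "0 < p")
    case True
    have "level A p ^\<^sub>m m = 0\<^sub>m (mult_of p) (mult_of p)"
      unfolding level_pow[OF A True, symmetric] nil
      using pos_props(1)[OF True] by (intro eq_matI) (auto simp: level_def cell_def)
    from nilpotent_similar_strictly_upper[OF level_carrier this] show ?thesis
      unfolding similar_mat_def by blast
  next
    case False
    \<comment> \<open>There are no strings of length 0, so this block is an empty matrix.\<close>
    then have "{\<gamma> \<in> G. sz \<gamma> = p} = {}" using sz_pos by fastforce
    then have z: "mult_of p = 0" unfolding mult_of_def by (simp only: card.empty)
    then show ?thesis using similar_mat_wit_refl[OF level_carrier[of A p]] by auto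
  qed
  then have "\<forall>p. \<exists>T P Q. similar_mat_wit (level A p) T P Q \<and> (\<forall>i<mult_of p. \<forall>j\<le>i. T $$ (i, j) = 0)"
    by blast
  then obtain T P Q where TPQ: "\<forall>p. similar_mat_wit (level A p) (T p) (P p) (Q p)
      \<and> (\<forall>i<mult_of p. \<forall>j\<le>i. T p $$ (i, j) = 0)"
    unfolding choice_iff by (elim exE)
  have w: "similar_mat_wit (level A p) (T p) (P p) (Q p)" for p using TPQ by blast
  have T: "T p $$ (i, j) = 0" if "i < mult_of p" "j \<le> i" for p i j using TPQ that by blast
  note W = similar_mat_witD2[OF level_carrier w]
  let ?H = "spread P" and ?H' = "spread Q"
  have HH: "?H * ?H' = 1\<^sub>m n" "?H' * ?H = 1\<^sub>m n"     using spread_inverse[of P Q] spread_inverse[of Q P] W by blast+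
  define X where "X = ?H' * A * ?H"
  have X: "comm X" unfolding X_def using comm_mult comm_spread A by blast
  have lX: "level X p = T p" if "0 < p" for p
  proof -
    have "level X p = Q p * level A p * P p"
      unfolding X_def level_mult[OF comm_mult[OF comm_spread A] comm_spread that]
        level_mult[OF comm_spread A that]
      using W[of p] level_spread[of p P, OF that] level_spread[of p Q, OF that] by simp
    also have "\<dots> = T p"
      by (rule similar_mat_witD2(3)[OF W(5)[of p] similar_mat_wit_sym[OF w[of p]], symmetric])
    finally show ?thesis .
  qed
  have "strict_comm X"
    unfolding strict_comm_def
  proof (intro conjI X allI impI)
    fix i j assume ij: "i < n" "j < n" "c i = c j" "sz (g i) = sz (g j)" "X $$ (i, j) \<noteq> 0"
    let ?p = "sz (g i)"
    have "i \<in> cell ?p (c i)" "j \<in> cell ?p (c i)" using ij by (auto simp: cell_def)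
    from level_entry[OF X this] ij(5) have "T ?p $$ (rank_of (g i), rank_of (g j)) \<noteq> 0"
      using lX sz_pos[OF g_in[OF ij(1)]] by simp
    \<comment> \<open>A nonzero entry lies strictly above the diagonal, and ranks run against the
      labels.\<close>
    then have "rank_of (g i) < rank_of (g j)"
      using T[OF rank_less[OF g_in[OF ij(1)]], of "rank_of (g j)"] by force
    then show "g j < g i" using rank_less_iff[of "g j" "g i"] g_in ij by simp
  qed
  moreover have "A = ?H * X * ?H'"
  proof -
    have cs: "?H \<in> carrier_mat n n" "?H' \<in> carrier_mat n n" "A \<in> carrier_mat n n"
      using comm_spread A unfolding comm_def by blast+
    have "similar_mat_wit X A ?H' ?H"
      using HH cs unfolding X_def by (intro similar_mat_witI[of _ _ n]) auto
    from similar_mat_witD2(3)[OF cs(3) similar_mat_wit_sym[OF this]] show ?thesis .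
  qed
  ultimately show ?thesis using HH comm_spread by blast
qed

end

section \<open>Bounding the nilpotency index\<close>

text \<open>The number of basis vectors on the \<open>i\<close>-th U-chain of Oblak's poset: all those in strings of
  length \<open>i\<close> or \<open>i - 1\<close>, and the two ends of every longer string.\<close>

definition oblak :: "nat \<Rightarrow> nat multiset \<Rightarrow> nat" where
  "oblak i P = (\<Sum>s\<in>#P. if s = i \<or> Suc s = i then s else if i < s then 2 else 0)"

text \<open>A nonzero sum over walks has a nonzero summand. The walk runs from the column index to
  the row index.\<close>

lemma walk_of_pow_entry:
  fixes A :: "'a::field mat"
  assumes A: "A \<in> carrier_mat n n" and "i < n" "j < n" "(A ^\<^sub>m k) $$ (i, j) \<noteq> 0"
  shows "\<exists>v. v 0 = j \<and> v k = i \<and> (\<forall>t\<le>k. v t < n) \<and> (\<forall>t<k. A $$ (v (Suc t), v t) \<noteq> 0)"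
  using assms(2-)
proof (induction k arbitrary: j)
  case 0
  have "(A ^\<^sub>m 0) $$ (i, j) = (if i = j then 1 else 0)" using A 0(1,2) by simp
  then have "i = j" using 0(3) by metis
  then show ?case using 0(1) by (intro exI[of _ "\<lambda>_. i"]) simp
next
  case (Suc k)
  have "(A ^\<^sub>m Suc k) $$ (i, j) = (\<Sum>l<n. (A ^\<^sub>m k) $$ (i, l) * A $$ (l, j))"
    unfolding pow_mat.simps by (rule mult_mat_entry[OF pow_carrier_mat[OF A] A Suc.prems(1,2)])
  with Suc.prems(3) have "(\<Sum>l<n. (A ^\<^sub>m k) $$ (i, l) * A $$ (l, j)) \<noteq> 0" by metis
  then obtain l where l: "l \<in> {..<n}" "(A ^\<^sub>m k) $$ (i, l) * A $$ (l, j) \<noteq> 0"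
    by (rule sum.not_neutral_contains_not_neutral)
  then have l: "l < n" "(A ^\<^sub>m k) $$ (i, l) \<noteq> 0" "A $$ (l, j) \<noteq> 0" by auto
  from Suc.IH[OF Suc.prems(1) l(1,2)]
  obtain v where v: "v 0 = l" "v k = i" "\<forall>t\<le>k. v t < n" "\<forall>t<k. A $$ (v (Suc t), v t) \<noteq> 0"
    by blast
  define w where "w = (\<lambda>t. case t of 0 \<Rightarrow> j | Suc t \<Rightarrow> v t)"
  have "w 0 = j" "w (Suc k) = i" using v by (auto simp: w_def)
  moreover have "\<forall>t\<le>Suc k. w t < n" using v Suc.prems by (auto simp: w_def split: nat.splits)
  moreover have "\<forall>t<Suc k. A $$ (w (Suc t), w t) \<noteq> 0"
    using v l by (auto simp: w_def split: nat.splits)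
  ultimately show ?case by blast
qed

context shift
begin

text \<open>The number of strings that the chain of index \<open>q\<close> traverses in full.
  Integers are used because signed differences follow.\<close>

definition pair_mult :: "nat \<Rightarrow> int" where
  "pair_mult q = int (mult_of q) + int (mult_of (q - 1))"

text \<open>For \<open>w\<close> an upper bound of \<open>pair_mult\<close>, this is the slack
  accumulated between the lengths \<open>m\<close> and \<open>p\<close>. It corrects the potential
  for lengths at which fewer than \<open>w\<close> strings are available.\<close>

definition excess :: "int \<Rightarrow> nat \<Rightarrow> nat \<Rightarrow> int" where
  "excess w m p = (\<Sum>q\<in>{m<..p}. w - pair_mult q)"

lemma excess_Suc: "m \<le> p \<Longrightarrow> excess w m (Suc p) = excess w m p + w - int (mult_of (Suc p)) - int (mult_of p)"
proof -
  assume "m \<le> p"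
  then have "{m<..Suc p} = insert (Suc p) {m<..p}" by auto
  then show ?thesis by (simp add: excess_def pair_mult_def)
qed

lemma excess_mono:
  assumes "m \<le> p" "p \<le> q" "\<forall>r\<in>{m<..q}. pair_mult r \<le> w"
  shows "excess w m p \<le> excess w m q"
  unfolding excess_def using assms by (intro sum_mono2) auto

text \<open>In the sum of \<open>pair_mult\<close> from \<open>p + 1\<close> to \<open>q\<close> the
  lengths strictly between occur twice and the two outer ones once; the bound keeps only the outer
  ones.\<close>

lemma excess_diff_le:
  assumes "p < q" "m \<le> p"
  shows "excess w m q - excess w m p \<le> w * (int q - int p) - int (mult_of q) - int (mult_of p)"
  using assms(1)
proof (induction q)
  case (Suc q)
  show ?case
  proof (cases "p = q")
    case True
    then show ?thesis using excess_Suc[of m q w] assms(2) by (simp add: algebra_simps)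
  next
    case False
    then show ?thesis using excess_Suc[of m q w] assms(2) Suc by (simp add: algebra_simps)
  qed
qed simp

text \<open>The coordinate \<open>2 c - p + 1\<close> (with \<open>p\<close> the size of the block) turns the order on basis vectors
  into a light cone: a nonzero entry can change the block size by at most the increase of this
  coordinate. The two signs \<open>s = 1\<close> and \<open>s = -1\<close> serve the part of a chain before and after
  its visit to the smallest block size \<open>m\<close>.\<close>

definition height :: "int \<Rightarrow> nat \<Rightarrow> int \<Rightarrow> nat \<Rightarrow> int" where
  "height w m s i = w * (2 * int (c i) - int (sz (g i)) + 1) + s * excess w m (sz (g i))
     + int (mult_of (sz (g i))) - 1 - 2 * int (rank_of (g i))"

text \<open>There are three kinds of steps. At equal length and position the rank drops. At equal
  length and a later position the gain of at least \<open>2 * w\<close> outweighs any change of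
  rank, as ranks stay below \<open>mult_of\<close>. Between different lengths the light cone yields
  \<open>w\<close> times the change of length; what \<open>excess_diff_le\<close> leaves over is the
  two multiplicities, and these pay for the ranks.\<close>

lemma height_step:
  fixes A :: "'a::field mat"
  assumes A: "strict_comm A" and ij: "i < n" "j < n" and nz: "A $$ (i, j) \<noteq> 0"
    and m: "m \<le> sz (g i)" "m \<le> sz (g j)" and M: "sz (g i) \<le> M" "sz (g j) \<le> M"
    and w: "\<forall>r\<in>{m<..M}. pair_mult r \<le> w" and w': "\<forall>r\<in>{m..M}. int (mult_of r) \<le> w"
    and s: "s = 1 \<or> s = -1"
  shows "height w m s j + 2 \<le> height w m s i"
proof -
  let ?p = "sz (g i)" and ?q = "sz (g j)"
  have cA: "comm A" using A by (simp add: strict_comm_def)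
  note le = comm_entry_le[OF cA ij nz]
  have ri: "int (rank_of (g i)) \<le> int (mult_of ?p) - 1" and rj: "int (rank_of (g j)) \<le> int (mult_of ?q) - 1"
    using rank_less[OF g_in[OF ij(1)]] rank_less[OF g_in[OF ij(2)]] by linarith+
  have w0: "int (mult_of ?p) \<le> w" "0 \<le> w" using w' m M by force+
  show ?thesis
  proof (cases "?p = ?q")
    case True
    have eq: "height w m s i - height w m s j
      = 2 * (w * (int (c i) - int (c j))) - 2 * int (rank_of (g i)) + 2 * int (rank_of (g j))"
      unfolding height_def True by (simp add: algebra_simps)
    show ?thesis
    proof (cases "c i = c j")
      case c: True
      then have "g j < g i" using A ij nz True by (auto simp: strict_comm_def)
      then have "rank_of (g i) < rank_of (g j)" using rank_less_iff[of "g j" "g i"] g_in ij True by simp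
      then show ?thesis using eq c by simp
    next
      case False
      then have "w * 1 \<le> w * (int (c i) - int (c j))" using le w0 by (intro mult_left_mono) auto
      then show ?thesis using eq ri w0 by linarith
    qed
  next
    case False
    define D where "D = 2 * (int (c i) - int (c j)) - (int ?p - int ?q)"
    have "int (c j) \<le> int (c i)" "int ?p + int (c j) \<le> int ?q + int (c i)" using le by linarith+
    then have D: "\<bar>int ?p - int ?q\<bar> \<le> D" by (simp add: D_def abs_le_iff)
    have eq: "height w m s i - height w m s j = w * D + s * (excess w m ?p - excess w m ?q)
       + int (mult_of ?p) - int (mult_of ?q) - 2 * int (rank_of (g i)) + 2 * int (rank_of (g j))"
      unfolding height_def D_def by (simp add: algebra_simps)
    have "\<bar>excess w m ?p - excess w m ?q\<bar> \<le> w * \<bar>int ?p - int ?q\<bar> - int (mult_of ?p) - int (mult_of ?q)"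
    proof (cases "?p < ?q")
      case True
      then show ?thesis using excess_diff_le[OF True m(1), of w] excess_mono[of m ?p ?q w] m M w by (force simp: abs_if)
    next
      case False
      then have "?q < ?p" using \<open>?p \<noteq> ?q\<close> by simp
      then show ?thesis using excess_diff_le[OF _ m(2), of ?p w] excess_mono[of m ?q ?p w] m M w by (force simp: abs_if)
    qed
    moreover have "w * \<bar>int ?p - int ?q\<bar> \<le> w * D" using D w0 by (intro mult_left_mono) auto
    moreover have "- \<bar>excess w m ?p - excess w m ?q\<bar> \<le> s * (excess w m ?p - excess w m ?q)"
      using s by auto
    ultimately show ?thesis using eq ri by linarith
  qed
qed

text \<open>A walk of \<open>u\<close> steps raises the potential by at least \<open>2 * u\<close>.
  Switching the sign of the correction at the shortest string visited costs nothing, since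
  \<open>excess\<close> vanishes there, and afterwards the correction works in favour of the bound
  at both ends: each end contributes at most \<open>E M - 1\<close>.\<close>

lemma strict_comm_pow_zero_aux:
  fixes A :: "'a::field mat"
  assumes A: "strict_comm A" and M: "\<forall>\<gamma>\<in>G. sz \<gamma> \<le> M"
    and w: "\<And>m. m \<in> sz ` G \<Longrightarrow> \<exists>w. (\<forall>r\<in>{m<..M}. pair_mult r \<le> w) \<and> (\<forall>r\<in>{m..M}. int (mult_of r) \<le> w)
       \<and> w * (int M - 1) - excess w m M + int (mult_of M) \<le> int u"
  shows "A ^\<^sub>m u = 0\<^sub>m n n"
proof (rule ccontr)
  assume nz: "A ^\<^sub>m u \<noteq> 0\<^sub>m n n"
  have Ac: "A \<in> carrier_mat n n" using A unfolding strict_comm_def comm_def by blast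
  obtain i j where ij: "i < n" "j < n" "(A ^\<^sub>m u) $$ (i, j) \<noteq> 0"
  proof (rule ccontr)
    assume "\<not> thesis"
    then have "A ^\<^sub>m u = 0\<^sub>m n n" using that Ac by (intro eq_matI) auto
    then show False using nz by simp
  qed
  obtain v where v: "\<forall>t\<le>u. v t < n" "\<forall>t<u. A $$ (v (Suc t), v t) \<noteq> 0"
    using walk_of_pow_entry[OF Ac ij] by blast
  obtain h where h: "h \<le> u" "\<forall>t\<le>u. sz (g (v h)) \<le> sz (g (v t))"
    using ex_min_if_finite[of "(\<lambda>t. sz (g (v t))) ` {..u}"]
    by (force simp: not_less)
  define m where "m = sz (g (v h))"
  have "m \<in> sz ` G" unfolding m_def using g_in v h by blast
  from w[OF this] obtain w where w: "\<forall>r\<in>{m<..M}. pair_mult r \<le> w" "\<forall>r\<in>{m..M}. int (mult_of r) \<le> w"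
    "w * (int M - 1) - excess w m M + int (mult_of M) \<le> int u" by blast
  have bd: "m \<le> sz (g (v t))" "sz (g (v t)) \<le> M" if "t \<le> u" for t
    using that h M g_in v by (auto simp: m_def)
  have step: "height w m s (v t) + 2 \<le> height w m s (v (Suc t))" if t: "t < u" and s: "s = 1 \<or> s = -1" for t s
  proof -
    have "v (Suc t) < n" "v t < n" "A $$ (v (Suc t), v t) \<noteq> 0" using v t by auto
    from height_step[OF A this _ _ _ _ w(1,2) s] show ?thesis using bd[of t] bd[of "Suc t"] t by simp
  qed
  have up: "height w m s (v t) + 2 * int k \<le> height w m s (v (t + k))" if "t + k \<le> u" "s = 1 \<or> s = -1" for t k s
    using that(1)
  proof (induction k)
    case (Suc k)
    then show ?case using step[of "t + k" s] that(2) by simp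
  qed simp
  have "height w m 1 (v h) = height w m (-1) (v h)"
    unfolding height_def by (simp add: m_def excess_def)
  with up[of 0 h 1] up[of h "u - h" "-1"] h(1)
  have *: "2 * int u \<le> height w m (-1) (v u) - height w m 1 (v 0)" by simp
  have w0: "0 \<le> w" using w(2) bd[of 0] by force
  define E where "E = (\<lambda>p. w * (int p - 1) - excess w m p + int (mult_of p))"
  have E: "E p \<le> E M" if "m \<le> p" "p \<le> M" for p
    using that(2,1)
  proof (induction M rule: dec_induct)
    case (step q)
    \<comment> \<open>Each longer string adds 2, as do its two ends in a U-chain.\<close>
    have "E (Suc q) = E q + 2 * int (mult_of (Suc q))"
      using excess_Suc[of m q w] step by (simp add: E_def algebra_simps)
    then show ?case using step by simp
  qed simp
  have "height w m (-1) (v u) \<le> E (sz (g (v u))) - 1"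
  proof -
    have "int (c (v u)) + 1 \<le> int (sz (g (v u)))" using c_less[of "v u"] v by force
    then have "w * (2 * int (c (v u)) - int (sz (g (v u))) + 1) \<le> w * (int (sz (g (v u))) - 1)"
      using w0 by (intro mult_left_mono) auto
    then show ?thesis unfolding height_def E_def by simp
  qed
  moreover have "1 - E (sz (g (v 0))) \<le> height w m 1 (v 0)"
  proof -
    have "int (rank_of (g (v 0))) + 1 \<le> int (mult_of (sz (g (v 0))))"
      using rank_less[OF g_in[of "v 0"]] v by force
    moreover have "w * (1 - int (sz (g (v 0)))) \<le> w * (2 * int (c (v 0)) - int (sz (g (v 0))) + 1)"
      using w0 by (intro mult_left_mono) auto
    ultimately show ?thesis unfolding height_def E_def by (simp add: algebra_simps)
  qed
  ultimately have "2 * int u \<le> 2 * (E M - 1)"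
    using * E[OF bd, of u] E[OF bd, of 0] by simp
  then show False using w(3) unfolding E_def by simp
qed

lemma oblak_shift_type:
  assumes M: "\<forall>\<gamma>\<in>G. sz \<gamma> \<le> M"
  shows "oblak i (shift_type G sz) = (\<Sum>q\<le>M. mult_of q * (if q = i \<or> Suc q = i then q else if i < q then 2 else 0))"
    (is "_ = (\<Sum>q\<le>M. mult_of q * ?f q)")
proof -
  have "oblak i (shift_type G sz) = (\<Sum>\<gamma>\<in>G. ?f (sz \<gamma>))"
    unfolding oblak_def shift_type_def by (simp add: sum_unfold_sum_mset image_mset.compositionality o_def)
  also have "\<dots> = (\<Sum>q\<le>M. \<Sum>\<gamma>\<in>{\<gamma> \<in> G. sz \<gamma> = q}. ?f (sz \<gamma>))"
    using M fin by (intro sum.group[symmetric]) auto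
  also have "\<dots> = (\<Sum>q\<le>M. mult_of q * ?f q)"
    unfolding mult_of_def by (intro sum.cong) auto
  finally show ?thesis .
qed

lemma pair_mult_telescope:
  "j \<le> M \<Longrightarrow> (\<Sum>q\<in>{j<..M}. pair_mult q) + int (mult_of M) = 2 * (\<Sum>q\<in>{j<..M}. int (mult_of q)) + int (mult_of j)"
proof (induction M rule: dec_induct)
  case (step q)
  have "{j<..Suc q} = insert (Suc q) {j<..q}" using step by auto
  then show ?case using step by (simp add: pair_mult_def)
qed simp

lemma strict_comm_pow_zero:
  fixes A :: "'a::field mat"
  assumes A: "strict_comm A" and ob: "\<And>i. 1 \<le> i \<Longrightarrow> oblak i (shift_type G sz) \<le> u"
  shows "A ^\<^sub>m u = 0\<^sub>m n n"
proof -
  define M where "M = Max (insert 0 (sz ` G))"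
  have M: "\<forall>\<gamma>\<in>G. sz \<gamma> \<le> M" unfolding M_def using fin by auto
  have U: "int j * int (mult_of j) + (int j - 1) * int (mult_of (j - 1)) + 2 * (\<Sum>q\<in>{j<..M}. int (mult_of q)) \<le> int u"
    if j: "1 \<le> j" "j \<le> M" for j
  proof -
    let ?f = "\<lambda>q. if q = j \<or> Suc q = j then q else if j < q then 2 else 0"
    have "(\<Sum>q\<in>{j - 1, j} \<union> {j<..M}. mult_of q * ?f q) \<le> (\<Sum>q\<le>M. mult_of q * ?f q)"
      using j by (intro sum_mono2) auto
    also have "\<dots> \<le> u" using ob[OF j(1)] oblak_shift_type[OF M, of j] by simp
    also have "(\<Sum>q\<in>{j - 1, j} \<union> {j<..M}. mult_of q * ?f q)
      = (\<Sum>q\<in>{j - 1, j}. mult_of q * ?f q) + (\<Sum>q\<in>{j<..M}. mult_of q * ?f q)"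
      by (rule sum.union_disjoint) auto
    also have "(\<Sum>q\<in>{j<..M}. mult_of q * ?f q) = 2 * (\<Sum>q\<in>{j<..M}. mult_of q)"
      unfolding sum_distrib_left by (intro sum.cong) auto
    also have "(\<Sum>q\<in>{j - 1, j}. mult_of q * ?f q) = j * mult_of j + (j - 1) * mult_of (j - 1)"
      using j by (auto simp: mult.commute)
    finally have "int (j * mult_of j + (j - 1) * mult_of (j - 1) + 2 * (\<Sum>q\<in>{j<..M}. mult_of q)) \<le> int u"
      by (simp only: of_nat_le_iff)
    then show ?thesis using j by (simp add: of_nat_diff)
  qed
  show ?thesis
  proof (rule strict_comm_pow_zero_aux[OF A M])
    fix m assume m: "m \<in> sz ` G"
    then have m1: "1 \<le> m" "m \<le> M" using sz_pos M by (auto simp: Suc_le_eq)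
    show "\<exists>w. (\<forall>r\<in>{m<..M}. pair_mult r \<le> w) \<and> (\<forall>r\<in>{m..M}. int (mult_of r) \<le> w)
       \<and> w * (int M - 1) - excess w m M + int (mult_of M) \<le> int u"
    proof (cases "m = M")
      \<comment> \<open>Only the longest strings are visited. Their number serves as weight, and the
        chain of index \<open>M\<close> contains all of them.\<close>
      case True
      have "0 \<le> (int M - 1) * int (mult_of (M - 1))" using m1 True by (intro mult_nonneg_nonneg) auto
      moreover have "2 * (\<Sum>q\<in>{M<..M}. int (mult_of q)) = 0" by simp
      moreover have "1 \<le> M" using m1 True by simp
      ultimately have "int M * int (mult_of M) \<le> int u" using U[of M] by linarith
      then show ?thesis using True by (intro exI[of _ "int (mult_of M)"]) (simp add: excess_def algebra_simps)
    next
      case False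
      then have "pair_mult ` {m<..M} \<noteq> {}" "finite (pair_mult ` {m<..M})" using m1 by auto
      from Max_in[OF this(2,1)] obtain j where j: "j \<in> {m<..M}" "pair_mult j = Max (pair_mult ` {m<..M})" by auto
      have w: "pair_mult r \<le> pair_mult j" if "r \<in> {m<..M}" for r
        using that j(2) by simp
      have w': "int (mult_of r) \<le> pair_mult j" if "r \<in> {m..M}" for r
      proof (cases "r = m")
        case True
        then show ?thesis using w[of "Suc m"] False m1 by (simp add: pair_mult_def)
      next
        case False
        then show ?thesis using w[of r] that by (simp add: pair_mult_def)
      qed
      let ?w = "pair_mult j"
      have "0 \<le> excess ?w m j" unfolding excess_def by (intro sum_nonneg) (use w j in auto)
      moreover have "excess ?w m M = excess ?w m j + (\<Sum>q\<in>{j<..M}. ?w - pair_mult q)"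
        unfolding excess_def using j by (subst sum.union_disjoint[symmetric]) (auto intro!: sum.cong)
      moreover have "(\<Sum>q\<in>{j<..M}. ?w - pair_mult q) = ?w * (int M - int j) - (\<Sum>q\<in>{j<..M}. pair_mult q)"
        using j by (simp add: sum_subtractf of_nat_diff)
      ultimately have "?w * (int M - 1) - excess ?w m M + int (mult_of M)
         \<le> ?w * (int j - 1) + (\<Sum>q\<in>{j<..M}. pair_mult q) + int (mult_of M)"
        by (simp add: algebra_simps)
      also have "\<dots> = ?w * (int j - 1) + 2 * (\<Sum>q\<in>{j<..M}. int (mult_of q)) + int (mult_of j)"
        using pair_mult_telescope[of j M] j by simp
      also have "\<dots> = int j * int (mult_of j) + (int j - 1) * int (mult_of (j - 1))
          + 2 * (\<Sum>q\<in>{j<..M}. int (mult_of q))"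
        unfolding pair_mult_def by (simp add: algebra_simps)
      also have "\<dots> \<le> int u" using U[of j] j(1) m1 by simp
      finally show ?thesis using w w' by blast
    qed
  qed
qed

lemma comm_nilpotent_pow_zero:
  fixes A :: "'a::field mat"
  assumes A: "comm A" "A ^\<^sub>m m = 0\<^sub>m n n" and ob: "\<And>i. 1 \<le> i \<Longrightarrow> oblak i (shift_type G sz) \<le> u"
  shows "A ^\<^sub>m u = 0\<^sub>m n n"
proof -
  obtain H H' X where *: "comm H" "comm H'" "H * H' = 1\<^sub>m n" "H' * H = 1\<^sub>m n" "strict_comm X" "A = H * X * H'"
    using conj_into_strict_comm[OF A] by blast
  have c: "H \<in> carrier_mat n n" "H' \<in> carrier_mat n n" "X \<in> carrier_mat n n" "A \<in> carrier_mat n n"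
    using * A unfolding strict_comm_def comm_def by blast+
  have "similar_mat_wit A X H H'" using * c by (intro similar_mat_witI[of _ _ n]) auto
  from similar_mat_wit_pow_zero_iff[OF this c(4)] strict_comm_pow_zero[OF *(5) ob] show ?thesis by blast
qed

text \<open>The sum of \<open>s + 2\<close> over all parts is a crude bound for every U-chain. Thus
  the whole linear space \<open>strict_comm\<close> consists of nilpotent matrices.\<close>

lemma strict_comm_nilpotent:
  fixes A :: "'a::field mat"
  assumes "strict_comm A"
  shows "\<exists>m. A ^\<^sub>m m = 0\<^sub>m n n"
proof -
  let ?u = "\<Sum>s\<in>#shift_type G sz. s + 2"
  have "oblak i (shift_type G sz) \<le> ?u" for i
    unfolding oblak_def by (rule sum_mset_mono) auto
  then show ?thesis using strict_comm_pow_zero[OF assms] by blast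
qed

end

section \<open>Irreducibility of the nilpotent commutator\<close>

definition poly_fun :: "('a::field \<Rightarrow> 'a) \<Rightarrow> bool" where
  "poly_fun f \<longleftrightarrow> (\<exists>p. \<forall>s. f s = poly p s)"

lemma poly_fun_const: "poly_fun (\<lambda>_. a)"
  unfolding poly_fun_def by (intro exI[of _ "[:a:]"]) simp

lemma poly_fun_add: "poly_fun f \<Longrightarrow> poly_fun h \<Longrightarrow> poly_fun (\<lambda>s. f s + h s)"
  unfolding poly_fun_def by (metis poly_add)

lemma poly_fun_mult: "poly_fun f \<Longrightarrow> poly_fun h \<Longrightarrow> poly_fun (\<lambda>s. f s * h s)"
  unfolding poly_fun_def by (metis poly_mult)

text \<open>A nonzero product of polynomials has finitely many roots. This is how two open
  conditions are met at one point of a curve.\<close>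

lemma poly_fun_common_nonzero:
  fixes f h :: "'a::field \<Rightarrow> 'a"
  assumes inf: "infinite (UNIV :: 'a set)" and "poly_fun f" "poly_fun h" "f a \<noteq> 0" "h b \<noteq> 0"
  shows "\<exists>s. f s \<noteq> 0 \<and> h s \<noteq> 0"
proof -
  obtain p q where pq: "\<And>s. f s = poly p s" "\<And>s. h s = poly q s"
    using assms(2,3) unfolding poly_fun_def by blast
  have "p * q \<noteq> 0" using assms(4,5) pq by auto
  then have "finite {s. poly (p * q) s = 0}" by (rule poly_roots_finite)
  then obtain s where "poly (p * q) s \<noteq> 0" using inf by (metis (mono_tags, lifting) UNIV_eq_I mem_Collect_eq)
  then show ?thesis using pq by auto
qed

text \<open>Agreement with a polynomial function is asked for on \<open>carrier_mat n n\<close>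
  only, because powers, products and determinants depend on the dimensions of their
  argument.\<close>

definition regular :: "nat \<Rightarrow> ('a::field mat \<Rightarrow> 'a) \<Rightarrow> bool" where
  "regular n f \<longleftrightarrow> (\<exists>h\<in>mat_poly_fun n. \<forall>A\<in>carrier_mat n n. f A = h A)"

lemma regularI: "h \<in> mat_poly_fun n \<Longrightarrow> (\<And>A. A \<in> carrier_mat n n \<Longrightarrow> f A = h A) \<Longrightarrow> regular n f"
  unfolding regular_def by blast

lemma regularE:
  assumes "regular n f"
  obtains h where "h \<in> mat_poly_fun n" "\<And>A. A \<in> carrier_mat n n \<Longrightarrow> f A = h A"
  using assms unfolding regular_def by blast

lemma regular_const: "regular n (\<lambda>_. a)"
  by (rule regularI[OF mat_poly_fun.const]) (rule refl)

lemma regular_entry: "i < n \<Longrightarrow> j < n \<Longrightarrow> regular n (\<lambda>A. A $$ (i, j))"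
  by (rule regularI[OF mat_poly_fun.entry]) (assumption | rule refl)+

lemma regular_add: "regular n f \<Longrightarrow> regular n h \<Longrightarrow> regular n (\<lambda>A. f A + h A)"
  by (elim regularE, rule regularI, rule mat_poly_fun.add) auto

lemma regular_mult: "regular n f \<Longrightarrow> regular n h \<Longrightarrow> regular n (\<lambda>A. f A * h A)"
  by (elim regularE, rule regularI, rule mat_poly_fun.mult) auto

lemma regular_sum: "(\<And>x. x \<in> I \<Longrightarrow> regular n (f x)) \<Longrightarrow> regular n (\<lambda>A. \<Sum>x\<in>I. f x A)"
  by (induction I rule: infinite_finite_induct) (auto intro: regular_const regular_add)

lemma regular_prod: "(\<And>x. x \<in> I \<Longrightarrow> regular n (f x)) \<Longrightarrow> regular n (\<lambda>A. \<Prod>x\<in>I. f x A)"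
  by (induction I rule: infinite_finite_induct) (auto intro: regular_const regular_mult)

lemma regular_cong: "(\<And>A. A \<in> carrier_mat n n \<Longrightarrow> f A = h A) \<Longrightarrow> regular n f \<longleftrightarrow> regular n h"
  unfolding regular_def by auto

lemma regular_det:
  assumes "\<And>i j. i < m \<Longrightarrow> j < m \<Longrightarrow> regular n (\<lambda>A. e i j A)"
  shows "regular n (\<lambda>A. det (mat m m (\<lambda>(i, j). e i j A)))"
proof -
  have eq: "det (mat m m (\<lambda>(i, j). e i j A))
      = (\<Sum>p\<in>{p. p permutes {0..<m}}. signof p * (\<Prod>i = 0..<m. e i (p i) A))" for A
    by (subst det_def'[of _ m]) (auto intro!: sum.cong prod.cong simp: permutes_in_image)
  have "regular n (e i (p i))" if "p permutes {0..<m}" "i \<in> {0..<m}" for p i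
    using assms[of i "p i"] that permutes_in_image[of p "{0..<m}" i] by simp
  then show ?thesis
    unfolding eq by (intro regular_sum regular_mult regular_const regular_prod) auto
qed

lemma regular_pow_entry:
  "i < n \<Longrightarrow> j < n \<Longrightarrow> regular n (\<lambda>A :: 'a::field mat. (A ^\<^sub>m k) $$ (i, j))"
proof (induction k arbitrary: i j)
  case 0
  have "regular n (\<lambda>A :: 'a mat. (A ^\<^sub>m 0) $$ (i, j)) \<longleftrightarrow> regular n (\<lambda>A :: 'a mat. if i = j then 1 else 0)"
    using 0 by (intro regular_cong) auto
  then show ?case using regular_const[of n "if i = j then 1 else 0 :: 'a"] by blast
next
  case (Suc k)
  have "regular n (\<lambda>A :: 'a mat. (A ^\<^sub>m Suc k) $$ (i, j)) \<longleftrightarrow> regular n (\<lambda>A :: 'a mat. \<Sum>l<n. (A ^\<^sub>m k) $$ (i, l) * A $$ (l, j))"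
    unfolding pow_mat.simps
    by (rule regular_cong) (rule mult_mat_entry[OF pow_carrier_mat _ Suc.prems], assumption+)
  then show ?case using Suc by (simp only:) (intro regular_sum regular_mult regular_entry Suc.IH; simp)
qed

lemma regular_det_affine:
  assumes "U \<in> carrier_mat n n" "V \<in> carrier_mat n n"
  shows "regular n (\<lambda>A. det (A * U + V))"
proof -
  have "regular n (\<lambda>A. det (A * U + V))
     \<longleftrightarrow> regular n (\<lambda>A. det (mat n n (\<lambda>(i, j). (\<Sum>k<n. A $$ (i, k) * U $$ (k, j)) + V $$ (i, j))))"
  proof (rule regular_cong)
    fix A :: "'a mat" assume A: "A \<in> carrier_mat n n"
    have "A * U + V = mat n n (\<lambda>(i, j). (\<Sum>k<n. A $$ (i, k) * U $$ (k, j)) + V $$ (i, j))"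
      using A assms mult_mat_entry[OF A assms(1)] by (intro eq_matI) auto
    then show "det (A * U + V) = det (mat n n (\<lambda>(i, j). (\<Sum>k<n. A $$ (i, k) * U $$ (k, j)) + V $$ (i, j)))"
      by simp
  qed
  moreover have "regular n (\<lambda>A. det (mat n n (\<lambda>(i, j). (\<Sum>k<n. A $$ (i, k) * U $$ (k, j)) + V $$ (i, j))))"
    by (intro regular_det regular_add regular_sum regular_mult regular_const regular_entry) auto
  ultimately show ?thesis by blast
qed

lemma regular_conj:
  assumes f: "regular n f" and R: "R \<in> carrier_mat n n" "R' \<in> carrier_mat n n"
  shows "regular n (\<lambda>A. f (R * A * R'))"
proof -
  obtain h where h: "h \<in> mat_poly_fun n" "\<forall>A\<in>carrier_mat n n. f A = h A" using f unfolding regular_def by blast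
  have "regular n (\<lambda>A. h (R * A * R'))" if "h \<in> mat_poly_fun n" for h
    using that
  proof induction
    case (entry i j)
    have "(R * A * R') $$ (i, j) = (\<Sum>l<n. (\<Sum>k<n. R $$ (i, k) * A $$ (k, l)) * R' $$ (l, j))"
      if A: "A \<in> carrier_mat n n" for A
      using mult_mat_entry[OF mult_carrier_mat[OF R(1) A] R(2) entry] mult_mat_entry[OF R(1) A entry(1)] by simp
    then have "regular n (\<lambda>A. (R * A * R') $$ (i, j))
      \<longleftrightarrow> regular n (\<lambda>A. \<Sum>l<n. (\<Sum>k<n. R $$ (i, k) * A $$ (k, l)) * R' $$ (l, j))"
      by (rule regular_cong)
    then show ?case
      by (simp only:) (intro regular_sum regular_mult regular_const regular_entry; simp)
  qed (auto intro: regular_const regular_add regular_mult)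
  from this[OF h(1)] show ?thesis using h(2) R
    by (subst regular_cong[of n _ "\<lambda>A. h (R * A * R')"]) auto
qed

lemma poly_fun_sum: "(\<And>x. x \<in> I \<Longrightarrow> poly_fun (f x)) \<Longrightarrow> poly_fun (\<lambda>s. \<Sum>x\<in>I. f x s)"
  by (induction I rule: infinite_finite_induct) (auto intro: poly_fun_const poly_fun_add)

lemma regular_poly_fun:
  fixes Y :: "'a::field \<Rightarrow> 'a mat"
  assumes f: "regular n f" and Y: "\<And>s. Y s \<in> carrier_mat n n"
    and p: "\<And>i j. i < n \<Longrightarrow> j < n \<Longrightarrow> poly_fun (\<lambda>s. Y s $$ (i, j))"
  shows "poly_fun (\<lambda>s. f (Y s))"
proof -
  obtain h where h: "h \<in> mat_poly_fun n" "\<forall>A\<in>carrier_mat n n. f A = h A" using f unfolding regular_def by blast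
  have "poly_fun (\<lambda>s. h (Y s))" if "h \<in> mat_poly_fun n" for h
    using that by induction (auto intro: poly_fun_const poly_fun_add poly_fun_mult p)
  from this[OF h(1)] show ?thesis using h(2) Y by simp
qed

text \<open>Cofactors are polynomial in the entries, which is why the adjugate replaces the inverse
  when conjugating along a curve.\<close>

lemma regular_adj_entry:
  assumes "i < n" "j < n"
  shows "regular n (\<lambda>A :: 'a::field mat. adj_mat A $$ (i, j))"
proof -
  have "regular n (\<lambda>A :: 'a mat. adj_mat A $$ (i, j)) \<longleftrightarrow> regular n (\<lambda>A :: 'a mat. (-1) ^ (j + i) *
      det (mat (n - 1) (n - 1) (\<lambda>(k, l). A $$ (if k < j then k else Suc k, if l < i then l else Suc l))))"
    by (rule regular_cong) (use assms in \<open>auto simp: adj_mat_def cofactor_def mat_delete_def\<close>)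
  then show ?thesis
    by (simp only:) (intro regular_mult regular_const regular_det regular_entry; use assms in auto)
qed

lemma poly_fun_mult_entry:
  fixes X Y :: "'a::field \<Rightarrow> 'a mat"
  assumes "\<And>s. X s \<in> carrier_mat n n" "\<And>s. Y s \<in> carrier_mat n n"
    and "\<And>i j. i < n \<Longrightarrow> j < n \<Longrightarrow> poly_fun (\<lambda>s. X s $$ (i, j))"
    and "\<And>i j. i < n \<Longrightarrow> j < n \<Longrightarrow> poly_fun (\<lambda>s. Y s $$ (i, j))"
    and ij: "i < n" "j < n"
  shows "poly_fun (\<lambda>s. (X s * Y s) $$ (i, j))"
proof -
  have "poly_fun (\<lambda>s. X s $$ (i, k) * Y s $$ (k, j))" if "k \<in> {..<n}" for k
    using poly_fun_mult[OF assms(3)[of i k] assms(4)[of k j]] ij that by simp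
  then have "poly_fun (\<lambda>s. \<Sum>k<n. X s $$ (i, k) * Y s $$ (k, j))" by (rule poly_fun_sum)
  moreover have "(X s * Y s) $$ (i, j) = (\<Sum>k<n. X s $$ (i, k) * Y s $$ (k, j))" for s
    by (rule mult_mat_entry[OF assms(1,2) ij])
  ultimately show ?thesis by presburger
qed

section \<open>Conjugation of nilpotent commutators, and curves inside them\<close>

lemma nilp_commutator_conj:
  fixes A B :: "'a::field mat"
  assumes w: "similar_mat_wit B' B R R'" and B: "B \<in> carrier_mat n n" and A: "A \<in> nilp_commutator n B"
  shows "R * A * R' \<in> nilp_commutator n B'"
proof -
  have "n = dim_row B'" using carrier_matD(1)[OF similar_mat_witD(5)[OF refl w]] carrier_matD(1)[OF B] by metis
  from similar_mat_witD(4)[OF this w] have B': "B' \<in> carrier_mat n n" .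
  note W = similar_mat_witD2[OF B' w]
  obtain m where Ac: "A \<in> carrier_mat n n" "A * B = B * A" "A ^\<^sub>m m = 0\<^sub>m n n"
    using A unfolding nilp_commutator_def by blast
  have wA: "similar_mat_wit (R * A * R') A R R'"
    by (rule similar_mat_witI[of _ _ n]) (use W(1,2,6,7) Ac(1) in auto)
  have conj_mult: "(R * X * R') * (R * Y * R') = R * (X * Y) * R'"
    if "X \<in> carrier_mat n n" "Y \<in> carrier_mat n n" for X Y
  proof -
    have c: "R \<in> carrier_mat n n" "R' \<in> carrier_mat n n" by (rule W)+
    have "(R * X * R') * (R * Y * R') = R * X * (R' * R) * Y * R'"
      using c that by (simp add: assoc_mult_mat[of _ n n _ n _ n])
    also have "\<dots> = R * X * Y * R'" unfolding W(2) using c that by (simp add: right_mult_one_mat[of _ n n])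
    finally show ?thesis using c that by (simp add: assoc_mult_mat[of _ n n _ n _ n])
  qed
  have "(R * A * R') * B' = B' * (R * A * R')"
    unfolding W(3) conj_mult[OF Ac(1) B] conj_mult[OF B Ac(1)] Ac(2) ..
  moreover have "(R * A * R') ^\<^sub>m m = 0\<^sub>m n n"
    using similar_mat_wit_pow_zero_iff[OF wA mult_carrier_mat[OF mult_carrier_mat[OF W(6) Ac(1)] W(7)]] Ac(3)
    by blast
  moreover have "R * A * R' \<in> carrier_mat n n"
    by (rule mult_carrier_mat[OF mult_carrier_mat[OF W(6) Ac(1)] W(7)])
  ultimately show ?thesis unfolding nilp_commutator_def by blast
qed

lemma smult_smult_mat: "a \<cdot>\<^sub>m (b \<cdot>\<^sub>m A) = (a * b) \<cdot>\<^sub>m (A :: 'a::field mat)"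
  by (intro eq_matI) (auto simp: mult.assoc)

lemma one_smult_mat: "1 \<cdot>\<^sub>m A = (A :: 'a::field mat)"
  by (intro eq_matI) auto

context shift
begin

lemma comm_lincomb:
  fixes X Y :: "'a::field mat"
  assumes X: "comm X" and Y: "comm Y"
  shows "comm (a \<cdot>\<^sub>m X + b \<cdot>\<^sub>m Y)"
proof -
  have c: "X \<in> carrier_mat n n" "Y \<in> carrier_mat n n" and S: "X * S = S * X" "Y * S = S * Y"
    using assms by (auto simp: comm_def)
  have "(a \<cdot>\<^sub>m X + b \<cdot>\<^sub>m Y) * S = a \<cdot>\<^sub>m (X * S) + b \<cdot>\<^sub>m (Y * S)"
    using c add_mult_distrib_mat[of "a \<cdot>\<^sub>m X" n n "b \<cdot>\<^sub>m Y" S n]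
    by (simp add: mult_smult_assoc_mat[of _ n n _ n])
  also have "\<dots> = S * (a \<cdot>\<^sub>m X + b \<cdot>\<^sub>m Y)"
    using c mult_add_distrib_mat[of S n n "a \<cdot>\<^sub>m X" n "b \<cdot>\<^sub>m Y"] by (simp add: mult_smult_distrib[of _ n n _ n] S)
  finally show "comm (a \<cdot>\<^sub>m X + b \<cdot>\<^sub>m Y)" using c by (auto simp: comm_def)
qed

lemma strict_comm_lincomb:
  fixes X Y :: "'a::field mat"
  assumes X: "strict_comm X" and Y: "strict_comm Y"
  shows "strict_comm (a \<cdot>\<^sub>m X + b \<cdot>\<^sub>m Y)"
proof -
  have c: "X \<in> carrier_mat n n" "Y \<in> carrier_mat n n"
    using assms by (auto simp: strict_comm_def comm_def)
  have "comm (a \<cdot>\<^sub>m X + b \<cdot>\<^sub>m Y)" using assms by (auto simp: strict_comm_def intro: comm_lincomb)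
  moreover have "\<forall>i<n. \<forall>j<n. c i = c j \<longrightarrow> sz (g i) = sz (g j) \<longrightarrow> (a \<cdot>\<^sub>m X + b \<cdot>\<^sub>m Y) $$ (i, j) \<noteq> 0 \<longrightarrow> g j < g i"
  proof (intro allI impI)
    fix i j assume ij: "i < n" "j < n" "c i = c j" "sz (g i) = sz (g j)" "(a \<cdot>\<^sub>m X + b \<cdot>\<^sub>m Y) $$ (i, j) \<noteq> 0"
    then have "X $$ (i, j) \<noteq> 0 \<or> Y $$ (i, j) \<noteq> 0" using c by auto
    then show "g j < g i" using assms ij unfolding strict_comm_def by blast
  qed
  ultimately show ?thesis by (simp add: strict_comm_def)
qed

lemma strict_comm_smult: "strict_comm X \<Longrightarrow> strict_comm (a \<cdot>\<^sub>m X)"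
proof -
  assume X: "strict_comm X"
  have "a \<cdot>\<^sub>m X + 0 \<cdot>\<^sub>m X = a \<cdot>\<^sub>m X" by (intro eq_matI) auto
  then show ?thesis using strict_comm_lincomb[OF X X, of a 0] by simp
qed

text \<open>The product is the conjugate of \<open>det H\<close> times \<open>X\<close> by
  \<open>H\<close>, and conjugation by \<open>H\<close> fixes \<open>S\<close>.\<close>

lemma conj_strict_comm_mem:
  fixes H X :: "'a::field mat"
  assumes H: "comm H" and d: "det H \<noteq> 0" and X: "strict_comm X"
  shows "H * X * adj_mat H \<in> nilp_commutator n S"
proof -
  have c: "H \<in> carrier_mat n n" "X \<in> carrier_mat n n" using H X by (auto simp: strict_comm_def comm_def)
  note adj = adj_mat[OF c(1)]
  define H' where "H' = inverse (det H) \<cdot>\<^sub>m adj_mat H"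
  have H': "H' \<in> carrier_mat n n" using adj by (simp add: H'_def)
  have HH': "H * H' = 1\<^sub>m n" "H' * H = 1\<^sub>m n"
    using adj d c unfolding H'_def
    by (simp_all add: mult_smult_distrib[of _ n n _ n] mult_smult_assoc_mat[of _ n n _ n] smult_smult_mat one_smult_mat)
  have HS: "H * S * H' = S"
  proof -
    have "H * S * H' = S * H * H'" using H by (simp only: comm_def)
    also have "\<dots> = S * (H * H')" by (rule assoc_mult_mat[OF shift_mat_carrier c(1) H'])
    finally show ?thesis by (simp only: HH' right_mult_one_mat[OF shift_mat_carrier])
  qed
  have w: "similar_mat_wit S S H H'"
    by (rule similar_mat_witI[OF HH' HS[symmetric] shift_mat_carrier shift_mat_carrier c(1) H'])
  have dX: "strict_comm (det H \<cdot>\<^sub>m X)" by (rule strict_comm_smult[OF X])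
  then have "det H \<cdot>\<^sub>m X \<in> nilp_commutator n S"
    using strict_comm_nilpotent[OF dX] by (auto simp: nilp_commutator_def strict_comm_def comm_def)
  from nilp_commutator_conj[OF w shift_mat_carrier this]
  have "H * (det H \<cdot>\<^sub>m X) * H' \<in> nilp_commutator n S" .
  moreover have "H * (det H \<cdot>\<^sub>m X) * H' = H * X * adj_mat H"
    using d c adj unfolding H'_def
    by (simp add: mult_smult_distrib[of _ n n _ n] mult_smult_assoc_mat[of _ n n _ n] smult_smult_mat one_smult_mat)
  ultimately show ?thesis by simp
qed

text \<open>Interpolating \<open>H\<close> and \<open>X\<close> linearly between the two given
  elements produces a polynomial curve \<open>Y\<close> through both, with values in the commutator
  wherever \<open>det (H s)\<close> is nonzero.\<close>

lemma nilp_commutator_irreducible: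
  fixes f1 f2 :: "'a::field mat \<Rightarrow> 'a"
  assumes inf: "infinite (UNIV :: 'a set)" and f: "regular n f1" "regular n f2"
    and A: "A1 \<in> nilp_commutator n S" "A2 \<in> nilp_commutator n S" and nz: "f1 A1 \<noteq> 0" "f2 A2 \<noteq> 0"
  shows "\<exists>A\<in>nilp_commutator n S. f1 A \<noteq> 0 \<and> f2 A \<noteq> 0"
proof -
  have "\<exists>H X. comm H \<and> det H \<noteq> 0 \<and> strict_comm X \<and> A = H * X * adj_mat H"
    if A: "A \<in> nilp_commutator n S" for A :: "'a mat"
  proof -
    have cA: "comm A" using A by (auto simp: nilp_commutator_def comm_def)
    obtain m where "A ^\<^sub>m m = 0\<^sub>m n n" using A by (auto simp: nilp_commutator_def)
    from conj_into_strict_comm[OF cA this] obtain H H' X where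
      *: "comm H" "comm H'" "H * H' = 1\<^sub>m n" "H' * H = 1\<^sub>m n" "strict_comm X" "A = H * X * H'" by blast
    have c: "H \<in> carrier_mat n n" "H' \<in> carrier_mat n n" "X \<in> carrier_mat n n"
      using * by (auto simp: strict_comm_def comm_def)
    have d: "det H \<noteq> 0" using det_mult[OF c(1,2)] *(3) by auto
    note adj = adj_mat[OF c(1)]
    have "adj_mat H = (H' * H) * adj_mat H" using * adj by simp
    also have "\<dots> = H' * (H * adj_mat H)" using c adj(1) by (intro assoc_mult_mat)
    also have "\<dots> = det H \<cdot>\<^sub>m H'" using adj(2) c by (simp add: mult_smult_distrib[of _ n n _ n])
    finally have a: "adj_mat H = det H \<cdot>\<^sub>m H'" .
    have "strict_comm (inverse (det H) \<cdot>\<^sub>m X)" by (rule strict_comm_smult[OF *(5)])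
    moreover have "H * (inverse (det H) \<cdot>\<^sub>m X) * adj_mat H = A"
      unfolding a *(6) using d c
      by (simp add: mult_smult_distrib[of _ n n _ n] mult_smult_assoc_mat[of _ n n _ n] smult_smult_mat one_smult_mat)
    ultimately show ?thesis using *(1) d by metis
  qed
  from this[OF A(1)] this[OF A(2)] obtain H1 X1 H2 X2 where
    1: "comm H1" "det H1 \<noteq> 0" "strict_comm X1" "A1 = H1 * X1 * adj_mat H1" and
    2: "comm H2" "det H2 \<noteq> 0" "strict_comm X2" "A2 = H2 * X2 * adj_mat H2" by blast
  define H where "H = (\<lambda>s. (1 - s) \<cdot>\<^sub>m H1 + s \<cdot>\<^sub>m H2)"
  define X where "X = (\<lambda>s. (1 - s) \<cdot>\<^sub>m X1 + s \<cdot>\<^sub>m X2)"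
  define Y where "Y = (\<lambda>s. H s * X s * adj_mat (H s))"
  have c: "H1 \<in> carrier_mat n n" "H2 \<in> carrier_mat n n" "X1 \<in> carrier_mat n n" "X2 \<in> carrier_mat n n"
    using 1 2 by (auto simp: strict_comm_def comm_def)
  have cs: "H s \<in> carrier_mat n n" "X s \<in> carrier_mat n n" "H s * X s \<in> carrier_mat n n"
     "adj_mat (H s) \<in> carrier_mat n n" "Y s \<in> carrier_mat n n" for s
    using c adj_mat(1)[of "H s" n] by (auto simp: H_def X_def Y_def)
  have lin: "poly_fun (\<lambda>s. (1 - s) * a + s * b)" for a b :: 'a
    unfolding poly_fun_def by (intro exI[of _ "[:a, b - a:]"]) (simp add: algebra_simps)
  have pH: "poly_fun (\<lambda>s. H s $$ (i, j))" and pX: "poly_fun (\<lambda>s. X s $$ (i, j))" if "i < n" "j < n" for i j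
    using c that lin by (simp_all add: H_def X_def)
  have pA: "poly_fun (\<lambda>s. adj_mat (H s) $$ (i, j))" if "i < n" "j < n" for i j
    by (rule regular_poly_fun[OF regular_adj_entry[OF that] cs(1) pH])
  have pY: "poly_fun (\<lambda>s. Y s $$ (i, j))" if "i < n" "j < n" for i j
    unfolding Y_def by (rule poly_fun_mult_entry[OF cs(3,4) poly_fun_mult_entry[OF cs(1,2) pH pX] pA that])
  have "regular n (\<lambda>A :: 'a mat. det (A * 1\<^sub>m n + 0\<^sub>m n n))" by (rule regular_det_affine) auto
  then have "poly_fun (\<lambda>s. det (H s * 1\<^sub>m n + 0\<^sub>m n n))" by (rule regular_poly_fun[OF _ cs(1) pH])
  then have pd: "poly_fun (\<lambda>s. det (H s))"
    unfolding right_mult_one_mat[OF cs(1)] right_add_zero_mat[OF cs(1)] .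
  \<comment> \<open>The extra factor \<open>det (H s)\<close> ensures that the parameter found below
    keeps \<open>H s\<close> invertible.\<close>
  have p1: "poly_fun (\<lambda>s. f1 (Y s) * det (H s))"
    by (rule poly_fun_mult[OF regular_poly_fun[OF f(1) cs(5) pY] pd])
  have p2: "poly_fun (\<lambda>s. f2 (Y s))"
    by (rule regular_poly_fun[OF f(2) cs(5) pY])
  have "H 0 = H1" "X 0 = X1" "H 1 = H2" "X 1 = X2"
    using c by (auto simp: H_def X_def intro!: eq_matI)
  then have "f1 (Y 0) * det (H 0) \<noteq> 0" "f2 (Y 1) \<noteq> 0" using 1 2 nz by (auto simp: Y_def)
  from poly_fun_common_nonzero[OF inf p1 p2 this]
  obtain s where s: "f1 (Y s) \<noteq> 0" "det (H s) \<noteq> 0" "f2 (Y s) \<noteq> 0" by auto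
  have "Y s \<in> nilp_commutator n S"
    unfolding Y_def using s(2) 1 2
    by (intro conj_strict_comm_mem) (auto simp: H_def X_def intro: comm_lincomb strict_comm_lincomb)
  then show ?thesis using s by blast
qed

end

section \<open>Corank at most two as a determinant condition\<close>

text \<open>Three rows supported in two columns lie in a plane, hence are dependent, and the
  dependency is a kernel vector of the transpose.\<close>

lemma det_zero_if_three_rows_in_two_cols:
  fixes Z :: "'a::field mat" and i :: "nat \<Rightarrow> nat"
  assumes Z: "Z \<in> carrier_mat n n" and i: "\<And>k. k < 3 \<Longrightarrow> i k < n" "inj_on i {..<3}"
    and z: "\<And>k l. k < 3 \<Longrightarrow> l < n \<Longrightarrow> l \<noteq> s1 \<Longrightarrow> l \<noteq> s2 \<Longrightarrow> Z $$ (i k, l) = 0"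
  shows "det Z = 0"
proof -
  \<comment> \<open>The third row is zero, so that \<open>M\<close> is square and singular and the
    determinant criterion yields the dependency. Columns out of range are read as 0.\<close>
  define M where "M = mat 3 3 (\<lambda>(l, k). if l = 0 then (if s1 < n then Z $$ (i k, s1) else 0)
    else if l = 1 then (if s2 < n then Z $$ (i k, s2) else 0) else 0)"
  have M: "M \<in> carrier_mat 3 3" by (simp add: M_def)
  have "det M = 0"
    by (subst laplace_expansion_row[OF M, of 2]) (auto simp: M_def)
  then obtain a where a: "a \<in> carrier_vec 3" "a \<noteq> 0\<^sub>v 3" "M *\<^sub>v a = 0\<^sub>v 3"
    using det_0_iff_vec_prod_zero[OF M] by blast
  have Ma: "(\<Sum>k<3. M $$ (l, k) * a $ k) = 0" if "l < 3" for l
    using arg_cong[OF a(3), of "\<lambda>v. v $ l"] that M a(1)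
    by (simp add: scalar_prod_def atLeast0LessThan)
  define x where "x = vec n (\<lambda>r. \<Sum>k<3. if r = i k then a $ k else 0)"
  have x: "x $ i k = a $ k" if "k < 3" for k
  proof -
    have "x $ i k = (\<Sum>k'<3. if i k = i k' then a $ k' else 0)"
      using i(1)[OF that] unfolding x_def by simp
    also have "\<dots> = (\<Sum>k'<3. if k' = k then a $ k else 0)"
    proof (rule sum.cong[OF refl])
      fix k' :: nat assume "k' \<in> {..<3}"
      then have "i k = i k' \<longleftrightarrow> k' = k" using i(2) that by (auto simp: inj_on_def)
      then show "(if i k = i k' then a $ k' else 0) = (if k' = k then a $ k else 0)" by auto
    qed
    finally show ?thesis using that by simp
  qed
  have "transpose_mat Z *\<^sub>v x = 0\<^sub>v n"
  proof (rule eq_vecI)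
    fix l assume "l < dim_vec (0\<^sub>v n :: 'a vec)"
    then have l: "l < n" by simp
    have "(transpose_mat Z *\<^sub>v x) $ l = (\<Sum>r<n. Z $$ (r, l) * (\<Sum>k<3. if r = i k then a $ k else 0))"
      using Z l by (auto simp: scalar_prod_def x_def atLeast0LessThan intro!: sum.cong)
    also have "\<dots> = (\<Sum>r<n. \<Sum>k<3. if r = i k then Z $$ (i k, l) * a $ k else 0)"
      unfolding sum_distrib_left by (intro sum.cong) auto
    also have "\<dots> = (\<Sum>k<3. \<Sum>r<n. if r = i k then Z $$ (i k, l) * a $ k else 0)"
      by (rule sum.swap)
    also have "\<dots> = (\<Sum>k<3. Z $$ (i k, l) * a $ k)"
      using i by (intro sum.cong) auto
    also have "\<dots> = 0"
    proof (cases "l = s1 \<or> l = s2")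
      case True
      then show ?thesis using Ma[of 0] Ma[of 1] l by (auto simp: M_def cong: sum.cong_simp)
    next
      case False
      then show ?thesis using z l by (intro sum.neutral) auto
    qed
    finally show "(transpose_mat Z *\<^sub>v x) $ l = 0\<^sub>v n $ l" using l by simp
  qed (use Z in auto)
  moreover have "x \<noteq> 0\<^sub>v n"
  proof
    assume "x = 0\<^sub>v n"
    then have "a $ k = 0" if "k < 3" for k using x[OF that] i(1)[OF that] by simp
    then have "a = 0\<^sub>v 3" using a(1) by (intro eq_vecI) auto
    then show False using a(2) by simp
  qed
  moreover have "x \<in> carrier_vec n" by (simp add: x_def)
  ultimately have "det (transpose_mat Z) = 0"
    using det_0_iff_vec_prod_zero[of "transpose_mat Z" n] Z by auto
  then show ?thesis using det_transpose[OF Z] by simp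
qed

text \<open>A fixed pair \<open>U\<close>, \<open>V\<close> replaces the vanishing of minors by one
  polynomial condition. With three or more strings, a change of basis makes three rows of the part
  coming from \<open>A * U\<close> vanish, those at the starts of strings, and only the columns
  \<open>s1\<close> and \<open>s2\<close> of \<open>V\<close> are left to fill them.\<close>

lemma jordan_type_size_le_2:
  fixes A :: "'a::field mat"
  assumes A: "A \<in> carrier_mat n n" and t: "has_jordan_type A Q"
    and UV: "U \<in> carrier_mat n n" "V \<in> carrier_mat n n" and d: "det (A * U + V) \<noteq> 0"
    and V: "\<And>i l. i < n \<Longrightarrow> l < n \<Longrightarrow> l \<noteq> s1 \<Longrightarrow> l \<noteq> s2 \<Longrightarrow> V $$ (i, l) = 0"
  shows "size Q \<le> 2"
proof (rule ccontr)
  assume "\<not> size Q \<le> 2"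
  have nQ: "sum_mset Q = n" by (rule has_jordan_type_pow_zero_iff(2)[OF A t])
  obtain G sz g c where m: "shift_model n G sz g c" "shift_type G sz = Q" "similar_mat A (shift_mat n g c)"
    using has_jordan_typeE[OF t] nQ by metis
  have "3 \<le> card G" using \<open>\<not> size Q \<le> 2\<close> m(2) by (auto simp: shift_type_def)
  then obtain T where T: "T \<subseteq> G" "card T = 3" by (meson obtain_subset_with_card_n)
  then have "finite T" using card.infinite by fastforce
  then obtain \<gamma> where \<gamma>: "bij_betw \<gamma> {..<3::nat} T" using T(2) ex_bij_betw_nat_finite[of T] by (auto simp: atLeast0LessThan)
  have "\<exists>r<n. g r = \<gamma> k \<and> c r = 0" if "k < 3" for k
  proof -
    have "\<gamma> k \<in> G" using \<gamma> T(1) that by (auto simp: bij_betw_def)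
    then show ?thesis using shift_modelD(6)[OF m(1)] shift_modelD(2)[OF m(1)] by blast
  qed
  then obtain i :: "nat \<Rightarrow> nat" where i: "\<And>k. k < 3 \<Longrightarrow> i k < n \<and> g (i k) = \<gamma> k \<and> c (i k) = 0" by metis
  have inj: "inj_on i {..<3}"
  proof (rule inj_onI)
    fix k l assume kl: "k \<in> {..<3}" "l \<in> {..<3}" "i k = i l"
    then have "\<gamma> k = \<gamma> l" using i[of k] i[of l] by auto
    then show "k = l" using \<gamma> kl by (auto simp: bij_betw_def inj_on_def)
  qed
  obtain P R where w: "similar_mat_wit A (shift_mat n g c) P R" using m(3) unfolding similar_mat_def by blast
  note W = similar_mat_witD2[OF A w]
  let ?S = "shift_mat n g c :: 'a mat"
  have SR: "?S * R \<in> carrier_mat n n" and RU: "R * U \<in> carrier_mat n n" and AU: "A * U \<in> carrier_mat n n"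
    using W(5,7) A UV by auto
  have "R * A = R * (P * (?S * R))"
    by (simp only: W(3) assoc_mult_mat[OF W(6,5,7)])
  also have "\<dots> = (R * P) * (?S * R)" by (rule assoc_mult_mat[symmetric, OF W(7,6) SR])
  finally have RA: "R * A = ?S * R" by (simp only: W(2) left_mult_one_mat[OF SR])
  have "R * (A * U) = ?S * (R * U)"
    by (simp only: assoc_mult_mat[symmetric, OF W(7) A UV(1)] RA assoc_mult_mat[OF W(5,7) UV(1)])
  then have "R * (A * U + V) = ?S * (R * U) + R * V"
    by (simp only: mult_add_distrib_mat[OF W(7) AU UV(2)])
  moreover have "(?S * (R * U)) $$ (i k, l) = 0" if "k < 3" "l < n" for k l
  proof -
    have "(?S * (R * U)) $$ (i k, l) = (\<Sum>r<n. ?S $$ (i k, r) * (R * U) $$ (r, l))"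
      by (rule mult_mat_entry[OF W(5) RU]) (use i[OF that(1)] that in auto)
    also have "\<dots> = 0" using i[OF that(1)] by (intro sum.neutral) (auto simp: shift_mat_entry)
    finally show ?thesis .
  qed
  moreover have "(R * V) $$ (i k, l) = 0" if "k < 3" "l < n" "l \<noteq> s1" "l \<noteq> s2" for k l
    using mult_mat_entry[OF W(7) UV(2), of "i k" l] i[OF that(1)] that V by simp
  ultimately have "(R * (A * U + V)) $$ (i k, l) = 0" if "k < 3" "l < n" "l \<noteq> s1" "l \<noteq> s2" for k l
    using that i[OF that(1)] W(7) UV(2) by (simp del: index_mult_mat(1))
  then have "det (R * (A * U + V)) = 0"
    using i W(7) AU UV(2) by (intro det_zero_if_three_rows_in_two_cols[of _ n i s1 s2, OF _ _ inj]) auto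
  then have "det R * det (A * U + V) = 0" using W(7) UV AU det_mult[of R n "A * U + V"] by simp
  moreover have "det R \<noteq> 0" using det_mult[OF W(6,7)] W(1) by auto
  ultimately show False using d by simp
qed

section \<open>Almost rectangular pieces\<close>

text \<open>The \<open>t\<close>-th power of a single string of length \<open>N\<close> splits it
  into residue classes modulo \<open>t\<close>; the length of a string is the number of members of
  its class below \<open>N\<close>.\<close>

lemma shift_model_string:
  assumes "t \<le> N" "t = 0 \<Longrightarrow> N = 0"
  shows "shift_model N {..<t} (\<lambda>\<gamma>. (N - 1 - \<gamma>) div t + 1) (\<lambda>i. i mod t) (\<lambda>i. i div t)"
  unfolding shift_model_def bij_betw_def
proof (intro conjI)
  show "inj_on (\<lambda>i. (i mod t, i div t)) {..<N}"
    by (intro inj_onI) (metis div_mult_mod_eq prod.inject)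
  show "(\<lambda>i. (i mod t, i div t)) ` {..<N} = (SIGMA \<gamma>:{..<t}. {..<(N - 1 - \<gamma>) div t + 1})"
  proof (intro equalityI subsetI)
    fix y assume "y \<in> (\<lambda>i. (i mod t, i div t)) ` {..<N}"
    then obtain i where i: "i < N" "y = (i mod t, i div t)" by auto
    then have t: "0 < t" using assms by auto
    have "i div t * t \<le> N - 1 - i mod t" using i(1) div_mult_mod_eq[of i t] by linarith
    then have "i div t \<le> (N - 1 - i mod t) div t" using t by (simp add: less_eq_div_iff_mult_less_eq)
    then show "y \<in> (SIGMA \<gamma>:{..<t}. {..<(N - 1 - \<gamma>) div t + 1})" using i(2) t by simp
  next
    fix y assume "y \<in> (SIGMA \<gamma>:{..<t}. {..<(N - 1 - \<gamma>) div t + 1})"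
    then obtain \<gamma> x where y: "y = (\<gamma>, x)" "\<gamma> < t" "x \<le> (N - 1 - \<gamma>) div t" by auto
    then have t: "0 < t" by auto
    then have "x * t \<le> N - 1 - \<gamma>" using y by (simp add: less_eq_div_iff_mult_less_eq)
    then have "\<gamma> + x * t < N" using y(2) assms(1) by linarith
    moreover have "(\<gamma> + x * t) mod t = \<gamma>" "(\<gamma> + x * t) div t = x" using y(2) t by auto
    ultimately show "y \<in> (\<lambda>i. (i mod t, i div t)) ` {..<N}"
      using y(1) by (intro image_eqI[of _ _ "\<gamma> + x * t"]) auto
  qed
qed auto

lemma shift_model_append:
  assumes m1: "shift_model n1 {..<t1} sz1 g1 c1" and m2: "shift_model n2 {..<t2} sz2 g2 c2"
  shows "shift_model (n1 + n2) {..<t1 + t2} (\<lambda>\<gamma>. if \<gamma> < t1 then sz1 \<gamma> else sz2 (\<gamma> - t1))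
    (\<lambda>i. if i < n1 then g1 i else t1 + g2 (i - n1)) (\<lambda>i. if i < n1 then c1 i else c2 (i - n1))"
    (is "shift_model _ _ ?sz ?g ?c")
  unfolding shift_model_def bij_betw_def
proof (intro conjI)
  note D1 = shift_modelD[OF m1] and D2 = shift_modelD[OF m2]
  show "\<forall>\<gamma>\<in>{..<t1 + t2}. 0 < ?sz \<gamma>" using D1(2) D2(2) by auto
  show "inj_on (\<lambda>i. (?g i, ?c i)) {..<n1 + n2}"
  proof (rule inj_onI)
    fix i j assume a: "i \<in> {..<n1 + n2}" "j \<in> {..<n1 + n2}" "(?g i, ?c i) = (?g j, ?c j)"
    consider "i < n1" "j < n1" | "i < n1" "\<not> j < n1" | "\<not> i < n1" "j < n1" | "\<not> i < n1" "\<not> j < n1" by blast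
    then show "i = j"
    proof cases
      case 1
      then show ?thesis using a D1(5)[of i j] by simp
    next
      case 2
      then show ?thesis using a D1(3)[of i] by simp
    next
      case 3
      then show ?thesis using a D1(3)[of j] by simp
    next
      case 4
      then have "i - n1 = j - n1" using a D2(5)[of "i - n1" "j - n1"] by auto
      then show ?thesis using 4 by simp
    qed
  qed
  show "(\<lambda>i. (?g i, ?c i)) ` {..<n1 + n2} = (SIGMA \<gamma>:{..<t1 + t2}. {..<?sz \<gamma>})"
  proof (intro equalityI subsetI)
    fix y assume "y \<in> (\<lambda>i. (?g i, ?c i)) ` {..<n1 + n2}"
    then obtain i where i: "i < n1 + n2" "y = (?g i, ?c i)" by auto
    show "y \<in> (SIGMA \<gamma>:{..<t1 + t2}. {..<?sz \<gamma>})"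
    proof (cases "i < n1")
      case True
      then show ?thesis using i D1(3)[OF True] D1(4)[OF True] by simp
    next
      case False
      then have "i - n1 < n2" using i by simp
      then show ?thesis using False i D2(3)[of "i - n1"] D2(4)[of "i - n1"] by simp
    qed
  next
    fix y assume "y \<in> (SIGMA \<gamma>:{..<t1 + t2}. {..<?sz \<gamma>})"
    then obtain \<gamma> x where y: "y = (\<gamma>, x)" "\<gamma> < t1 + t2" "x < ?sz \<gamma>" by auto
    show "y \<in> (\<lambda>i. (?g i, ?c i)) ` {..<n1 + n2}"
    proof (cases "\<gamma> < t1")
      case True
      then obtain i where "i < n1" "g1 i = \<gamma>" "c1 i = x" using D1(6)[of \<gamma> x] y by auto
      then show ?thesis using y by (intro image_eqI[of _ _ i]) auto
    next
      case False
      then have "\<gamma> - t1 \<in> {..<t2}" "x < sz2 (\<gamma> - t1)" using y by auto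
      then obtain i where "i < n2" "g2 i = \<gamma> - t1" "c2 i = x" using D2(6) by blast
      then show ?thesis using y False by (intro image_eqI[of _ _ "n1 + i"]) auto
    qed
  qed
qed auto

lemma shift_type_append:
  "shift_type {..<t1 + t2} (\<lambda>\<gamma>. if \<gamma> < t1 then sz1 \<gamma> else sz2 (\<gamma> - t1))
     = shift_type {..<t1} sz1 + shift_type {..<t2} sz2"
  unfolding shift_type_def
proof (induction t2)
  case (Suc t2)
  have "{..<t1 + Suc t2} = insert (t1 + t2) {..<t1 + t2}" "{..<Suc t2} = insert t2 {..<t2}" by auto
  then show ?case using Suc by simp
qed (auto intro!: image_mset_cong)

text \<open>For \<open>1 \<le> t \<le> N\<close> this is \<open>[N]^t\<close>, obtained as the type
  of the \<open>t\<close>-th power of one string of length \<open>N\<close>. For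
  \<open>t = 0\<close> it is empty.\<close>

definition strip :: "nat \<Rightarrow> nat \<Rightarrow> nat multiset" where
  "strip N t = shift_type {..<t} (\<lambda>\<gamma>. (N - 1 - \<gamma>) div t + 1)"

lemma strip_eq:
  assumes "0 < k" "1 < a \<or> k' = 0" "0 < a"
  shows "strip (a * k + (a - 1) * k') (k + k') = replicate_mset k a + replicate_mset k' (a - 1)"
proof -
  let ?N = "a * k + (a - 1) * k'"
  define T where "T = k + k'"
  have T: "0 < T" using assms(1) by (simp add: T_def)
  have N: "?N = (a - 1) * T + k" unfolding T_def using assms(3) by (cases a) (auto simp: algebra_simps)
  have 1: "(?N - 1 - \<gamma>) div T + 1 = a" if "\<gamma> < k" for \<gamma>
  proof -
    have "?N - 1 - \<gamma> = (k - 1 - \<gamma>) + (a - 1) * T" using N that by simp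
    moreover have "k - 1 - \<gamma> < T" using assms(1) by (simp add: T_def)
    ultimately have "(?N - 1 - \<gamma>) div T = a - 1" using T by simp
    then show ?thesis using assms(3) by simp
  qed
  have 2: "(?N - 1 - (k + \<gamma>)) div T + 1 = a - 1" if "\<gamma> < k'" for \<gamma>
  proof -
    have a: "1 < a" using assms(2) that by auto
    define a' where "a' = a - 2"
    then have a': "a = a' + 2" using a by simp
    have "(a - 1) * T = a' * T + T" using a' by simp
    with N have "?N = a' * T + T + k" by linarith
    then have "?N - 1 - (k + \<gamma>) = (T - 1 - \<gamma>) + a' * T" using that by (simp add: T_def)
    moreover have "T - 1 - \<gamma> < T" using T by simp
    ultimately have "(?N - 1 - (k + \<gamma>)) div T = a'" using T by simp
    then show ?thesis using a' by simp
  qed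
  have "strip ?N T = shift_type {..<T} (\<lambda>\<gamma>. if \<gamma> < k then a else a - 1)"
    unfolding strip_def shift_type_def
  proof (intro image_mset_cong)
    fix \<gamma> assume "\<gamma> \<in># mset_set {..<T}"
    then have \<gamma>: "\<gamma> < T" by simp
    show "(?N - 1 - \<gamma>) div T + 1 = (if \<gamma> < k then a else a - 1)"
    proof (cases "\<gamma> < k")
      case False
      then have "\<gamma> - k < k'" "k + (\<gamma> - k) = \<gamma>" using \<gamma> by (auto simp: T_def)
      then show ?thesis using 2[of "\<gamma> - k"] False by simp
    qed (use 1 in simp)
  qed
  also have "\<dots> = shift_type {..<k} (\<lambda>_. a) + shift_type {..<k'} (\<lambda>_. a - 1)"
    unfolding T_def by (rule shift_type_append)
  finally show ?thesis unfolding T_def by (simp add: shift_type_def image_mset_const_eq)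
qed

text \<open>Three strings \<open>z\<^sup>i\<close>, \<open>y\<^sup>j\<close> and a third one, on which \<open>x\<close> acts as \<open>z\<^sup>t\<close>, \<open>y\<^sup>w\<close> and an \<open>e\<close>-th power.\<close>

locale strings =
  fixes N t m w l e n :: nat and sz g c :: "nat \<Rightarrow> nat"
  assumes t: "0 < t" "t \<le> N" and w: "0 < w" "w \<le> m" and e: "e \<le> l" "e = 0 \<Longrightarrow> l = 0"
    and n_def: "n = N + (m + l)"
    and g_def: "g = (\<lambda>i. if i < N then i mod t else t + (if i - N < m then (i - N) mod w else w + (i - N - m) mod e))"
    and c_def: "c = (\<lambda>i. if i < N then i div t else if i - N < m then (i - N) div w else (i - N - m) div e)"
    and sz_def: "sz = (\<lambda>\<gamma>. if \<gamma> < t then (N - 1 - \<gamma>) div t + 1 else if \<gamma> - t < w then (m - 1 - (\<gamma> - t)) div w + 1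
       else (l - 1 - (\<gamma> - t - w)) div e + 1)"
begin

lemma string_model: "shift_model n {..<t + (w + e)} sz g c"
  unfolding n_def g_def c_def sz_def
  by (intro shift_model_append shift_model_string) (use t w e in auto)

lemma string_type: "shift_type {..<t + (w + e)} sz = strip N t + (strip m w + strip l e)"
proof -
  have "shift_type {..<t + (w + e)} sz = strip N t + shift_type {..<w + e}
      (\<lambda>\<gamma>. if \<gamma> < w then (m - 1 - \<gamma>) div w + 1 else (l - 1 - (\<gamma> - w)) div e + 1)"
    unfolding sz_def strip_def
    by (rule shift_type_append[where ?sz2.0 = "\<lambda>\<gamma>. if \<gamma> < w then (m - 1 - \<gamma>) div w + 1 else (l - 1 - (\<gamma> - w)) div e + 1"])
  also have "shift_type {..<w + e} (\<lambda>\<gamma>. if \<gamma> < w then (m - 1 - \<gamma>) div w + 1 else (l - 1 - (\<gamma> - w)) div e + 1)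
      = strip m w + strip l e"
    unfolding strip_def by (rule shift_type_append)
  finally show ?thesis .
qed

sublocale shift n "{..<t + (w + e)}" sz g c
  by unfold_locales (rule string_model)

lemma succ_string_iff:
  assumes "i < N + m"
  shows "succ_of i' i \<longleftrightarrow> (i < N \<and> i' = i + t \<and> i' < N) \<or> (N \<le> i \<and> i' = i + w \<and> i' < N + m)"
proof -
  have dm: "a mod s = b mod s \<and> a div s = Suc (b div s) \<longleftrightarrow> a = b + s" if "0 < s" for a b s :: nat
  proof
    assume "a mod s = b mod s \<and> a div s = Suc (b div s)"
    then show "a = b + s" by (metis add.commute add.left_commute div_mult_mod_eq mult_Suc)
  qed (use that in auto)
  consider "i < N" "i' < N" | "i < N" "N \<le> i'" | "N \<le> i" "i' < N" | "N \<le> i" "N \<le> i'" "i' < N + m"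
    | "N \<le> i" "N + m \<le> i'" by linarith
  then show ?thesis
  proof cases
    case 1
    then show ?thesis using dm[OF t(1), of i' i] unfolding succ_of_def by (auto simp: g_def c_def n_def)
  next
    case 2
    have "g i < t" using 2 t by (simp add: g_def)
    moreover have "t \<le> g i'" using 2 by (simp add: g_def)
    ultimately show ?thesis using 2 by (auto simp: succ_of_def)
  next
    case 3
    have "g i' < t" using 3 t by (simp add: g_def)
    moreover have "t \<le> g i" using 3 by (simp add: g_def)
    ultimately show ?thesis using 3 by (auto simp: succ_of_def)
  next
    case 4
    have "i - N < m" "i' - N < m" using 4 assms by auto
    then have "succ_of i' i \<longleftrightarrow> i' - N = i - N + w"
      using 4 assms dm[OF w(1), of "i' - N" "i - N"] unfolding succ_of_def by (auto simp: g_def c_def n_def)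
    then show ?thesis using 4 by auto
  next
    case 5
    have "i - N < m" using 5 assms by auto
    then have "g i < t + w" using 5 w by (simp add: g_def)
    moreover have "t + w \<le> g i'" using 5 by (simp add: g_def)
    ultimately show ?thesis using 5 by (auto simp: succ_of_def)
  qed
qed

lemma succ_string_rest: "succ_of i' i \<Longrightarrow> N + m \<le> i \<Longrightarrow> N + m \<le> i'"
proof (rule ccontr)
  assume s: "succ_of i' i" and i: "N + m \<le> i" and n: "\<not> N + m \<le> i'"
  have "t + w \<le> g i" using i by (simp add: g_def)
  moreover have "g i' < t + w"
  proof (cases "i' < N")
    case True
    then have "g i' < t" using t by (simp add: g_def)
    then show ?thesis by simp
  next
    case False
    then have "i' - N < m" using n by auto
    then show ?thesis using w False by (simp add: g_def)
  qed
  ultimately show False using s by (simp add: succ_of_def)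
qed

lemma c_zero_string: "c i = 0 \<Longrightarrow> i < t \<or> (N \<le> i \<and> i < N + w) \<or> N + m \<le> i"
  using t w by (auto simp: c_def div_eq_0_iff split: if_splits)

lemma last_string:
  assumes "Suc (c j) = sz (g j)" "j < N + m"
  shows "if j < N then N \<le> j + t else N + m \<le> j + w"
proof (rule ccontr)
  assume "\<not> ?thesis"
  then obtain j' where "succ_of j' j" using succ_string_iff[OF assms(2)] by (auto split: if_splits)
  then have "c j' < sz (g j)" "c j' = Suc (c j)" using c_less[of j'] by (auto simp: succ_of_def)
  then show False using assms(1) by simp
qed

end

context strings
begin

section \<open>Linking the two strings\<close>

text \<open>To be read as a map from \<open>j\<close> to \<open>i\<close>. The witness
  \<open>D\<close> counts shift steps back from the socle of the second string, the witness
  \<open>x\<close> shift steps forward from \<open>z^(t-1)\<close>. The links open the walk through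
  \<open>z^0, ..., z^(t-1)\<close>, the entire second string and
  \<open>z^(N-t), ..., z^(N-1)\<close>: these are \<open>2 * t + m\<close> basis vectors, as many as
  in the U-chain.\<close>

definition link :: "nat \<Rightarrow> nat \<Rightarrow> bool" where
  "link i j \<longleftrightarrow> (\<exists>D. i + Suc D * t = N \<and> j + D * w + 1 = N + m \<and> N \<le> j)
     \<or> (\<exists>x. i = N + x * w \<and> i < N + m \<and> j + 1 = Suc x * t)"

text \<open>The matrix of \<open>z \<oplus> a y\<close>, with the two strings linked if \<open>r\<close> holds: the links send
  \<open>z\<^sup>t\<^sup>-\<^sup>1\<close> to \<open>1\<close> and the socle \<open>y\<^sup>m\<^sup>-\<^sup>1\<close> to \<open>z\<^sup>N\<^sup>-\<^sup>t\<close>, and are extended linearly over \<open>x\<close>.\<close>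

definition ent :: "bool \<Rightarrow> 'a::field \<Rightarrow> nat \<Rightarrow> nat \<Rightarrow> 'a" where
  "ent r a i j = (if i = Suc j \<and> i \<noteq> N \<and> i < N + m then (if i < N then 1 else a) else 0)
     + (if r \<and> link i j then 1 else 0)"

definition string_mat :: "bool \<Rightarrow> 'a::field \<Rightarrow> 'a mat" where
  "string_mat r a = mat n n (\<lambda>(i, j). ent r a i j)"

text \<open>The number \<open>b\<close> is the greatest length of a shift string in the second
  piece, and all those in the first piece have length at least \<open>b + 1\<close>. So the links
  extend along the shift within both pieces, and they only join strings of different
  lengths.\<close>

definition linkable :: "nat \<Rightarrow> bool" where
  "linkable b \<longleftrightarrow> 0 < b \<and> Suc b * t \<le> N \<and> m \<le> b * w \<and> (\<forall>x<b. x * w < m)"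

text \<open>The last inequality of each case keeps the end of the link that lies on the first string
  away from its start, respectively from its end.\<close>

lemma link_cases [consumes 2]:
  assumes b: "linkable b" and l: "link i j"
  obtains D where "D < b" "i + Suc D * t = N" "j + D * w + 1 = N + m" "N \<le> j" "i < N" "j < N + m" "b * t \<le> i + D * t"
  | x where "x < b" "i = N + x * w" "i < N + m" "j + 1 = Suc x * t" "j < N" "j + b * t < N + x * t"
proof -
  have lt: "D < b" if "D * w < m" for D
  proof -
    have "D * w < b * w" using that b unfolding linkable_def by linarith
    then show ?thesis by simp
  qed
  from l consider (1) D where "i + Suc D * t = N" "j + D * w + 1 = N + m" "N \<le> j"
    | (2) x where "i = N + x * w" "i < N + m" "j + 1 = Suc x * t"
    unfolding link_def by blast
  then show thesis
  proof cases
    case 1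
    then have D: "D < b" by (intro lt) linarith
    have "i < N" using 1(1) t by simp
    moreover have "b * t \<le> i + D * t" using 1(1) b by (simp add: linkable_def)
    ultimately show ?thesis using that(1)[OF D 1] 1 by simp
  next
    case 2
    then have x: "x < b" by (intro lt) linarith
    then have "Suc x * t \<le> b * t" by (intro mult_le_mono1) simp
    then have "j < N" using 2(3) b t by (simp add: linkable_def)
    moreover have "j + b * t < N + x * t" using 2(3) b t by (simp add: linkable_def)
    ultimately show ?thesis using that(2)[OF x 2] by simp
  qed
qed

lemma link_shift:
  assumes "i < N \<Longrightarrow> N \<le> j \<and> i + t < N \<and> j + w < N + m \<and> i' = i + t \<and> j' = j + w"
    and "N \<le> i \<Longrightarrow> j < N \<and> i + w < N + m \<and> j + t < N \<and> i' = i + w \<and> j' = j + t"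
  shows "link i' j' \<longleftrightarrow> link i j"
proof (cases "i < N")
  case True
  note a = assms(1)[OF True]
  have "(\<exists>D. i' + Suc D * t = N \<and> j' + D * w + 1 = N + m) \<longleftrightarrow> (\<exists>D. i + Suc D * t = N \<and> j + D * w + 1 = N + m)"
  proof
    assume "\<exists>D. i' + Suc D * t = N \<and> j' + D * w + 1 = N + m"
    then obtain D where "i' + Suc D * t = N" "j' + D * w + 1 = N + m" by blast
    then show "\<exists>D. i + Suc D * t = N \<and> j + D * w + 1 = N + m" using a by (intro exI[of _ "Suc D"]) simp
  next
    assume "\<exists>D. i + Suc D * t = N \<and> j + D * w + 1 = N + m"
    then obtain D where D: "i + Suc D * t = N" "j + D * w + 1 = N + m" by blast
    then have "D \<noteq> 0" using a by (intro notI) simp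
    then obtain D' where "D = Suc D'" by (cases D) auto
    then show "\<exists>D. i' + Suc D * t = N \<and> j' + D * w + 1 = N + m" using a D by (intro exI[of _ D']) simp
  qed
  then show ?thesis using a True by (auto simp: link_def)
next
  case False
  note a = assms(2)[OF leI[OF False]]
  have "(\<exists>x. i' = N + x * w \<and> j' + 1 = Suc x * t) \<longleftrightarrow> (\<exists>x. i = N + x * w \<and> j + 1 = Suc x * t)"
  proof
    assume "\<exists>x. i' = N + x * w \<and> j' + 1 = Suc x * t"
    then obtain x where x: "i' = N + x * w" "j' + 1 = Suc x * t" by blast
    then have "x \<noteq> 0" using a False w by (intro notI) simp
    then obtain x' where "x = Suc x'" by (cases x) auto
    then show "\<exists>x. i = N + x * w \<and> j + 1 = Suc x * t" using a x by (intro exI[of _ x']) simp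
  next
    assume "\<exists>x. i = N + x * w \<and> j + 1 = Suc x * t"
    then obtain x where "i = N + x * w" "j + 1 = Suc x * t" by blast
    then show "\<exists>x. i' = N + x * w \<and> j' + 1 = Suc x * t" using a by (intro exI[of _ "Suc x"]) simp
  qed
  moreover have "i' + Suc D * t \<noteq> N" "i + Suc D * t \<noteq> N" for D using a False t by auto
  moreover have "i' < N + m" "i < N + m" using a by auto
  ultimately show ?thesis unfolding link_def by blast
qed

lemma ent_zeroI:
  assumes "\<not> (r \<and> link i j)" "\<not> (i = Suc j \<and> i \<noteq> N \<and> i < N + m)"
  shows "ent r a i j = 0"
  unfolding ent_def if_not_P[OF assms(1)] if_not_P[OF assms(2)] by simp

lemma ent_zero:
  assumes "r \<Longrightarrow> linkable b" "N + m \<le> i \<or> N + m \<le> j"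
  shows "ent r a i j = 0"
proof -
  have "\<not> (r \<and> link i j)"
  proof
    assume "r \<and> link i j"
    then have "linkable b" "link i j" using assms(1) by auto
    then show False using assms(2) by (cases rule: link_cases) auto
  qed
  then show ?thesis using assms(2) by (auto simp: ent_def)
qed

lemma comm_string_mat:
  fixes a :: "'a::field"
  assumes r: "r \<Longrightarrow> linkable b"
  shows "comm (string_mat r a)"
proof (rule commI)
  show "string_mat r a \<in> carrier_mat n n" by (simp add: string_mat_def)
  have link_dom: "i < N \<longleftrightarrow> N \<le> j" if "r" "link i j" for i j
    using r[OF that(1)] that(2) by (cases rule: link_cases) auto
  have E: "string_mat r a $$ (i, j) = ent r a i j" if "i < n" "j < n" for i j
    using that by (simp add: string_mat_def)
  fix i' i j' j
  assume si: "succ_of i' i" and sj: "succ_of j' j"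
  have n: "i < n" "i' < n" "j < n" "j' < n" using si sj by (auto simp: succ_of_def)
  have "ent r a i' j' = ent r a i j"
  proof (cases "N + m \<le> i \<or> N + m \<le> j")
    case True
    then have "N + m \<le> i' \<or> N + m \<le> j'" using si sj succ_string_rest by blast
    then show ?thesis using ent_zero[OF r] True by metis
  next
    case False
    then have ij: "i < N + m" "j < N + m" by auto
    note I = si[unfolded succ_string_iff[OF ij(1)]] and J = sj[unfolded succ_string_iff[OF ij(2)]]
    consider "i < N" "j < N" | "i < N" "N \<le> j" | "N \<le> i" "j < N" | "N \<le> i" "N \<le> j" by linarith
    then show ?thesis
    proof cases
      case 1
      then have *: "i' = i + t" "i' < N" "j' = j + t" "j' < N" using I J by auto
      then have "\<not> (r \<and> link i j)" "\<not> (r \<and> link i' j')" using 1 link_dom by force+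
      then show ?thesis using 1 * unfolding ent_def by auto
    next
      case 2
      then have *: "i' = i + t" "i' < N" "j' = j + w" "j' < N + m" using I J by auto
      then have "link i' j' \<longleftrightarrow> link i j" using 2 by (intro link_shift) auto
      then show ?thesis using 2 * unfolding ent_def by auto
    next
      case 3
      then have *: "i' = i + w" "i' < N + m" "j' = j + t" "j' < N" using I J by auto
      then have "link i' j' \<longleftrightarrow> link i j" using 3 by (intro link_shift) auto
      then show ?thesis using 3 * unfolding ent_def by auto
    next
      case 4
      then have *: "i' = i + w" "i' < N + m" "j' = j + w" "j' < N + m" using I J by auto
      then have "\<not> (r \<and> link i j)" "\<not> (r \<and> link i' j')" using 4 link_dom by force+
      then show ?thesis using 4 * unfolding ent_def by auto
    qed
  qed
  then show "string_mat r a $$ (i', j') = string_mat r a $$ (i, j)" using E n by simp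
next
  fix i' i j
  assume si: "succ_of i' i" and j: "j < n" "Suc (c j) = sz (g j)"
  have i: "i < n" using si by (simp add: succ_of_def)
  have "ent r a i j = 0"
  proof (cases "N + m \<le> i \<or> N + m \<le> j")
    case True
    then show ?thesis using ent_zero[OF r] by blast
  next
    case False
    then have ij: "i < N + m" "j < N + m" by auto
    note I = si[unfolded succ_string_iff[OF ij(1)]] and J = last_string[OF j(2) ij(2)]
    have "\<not> (r \<and> link i j)"
    proof
      assume rl: "r \<and> link i j"
      then have b: "linkable b" using r by blast
      from rl have l: "link i j" by blast
      from b l show False
      proof (cases rule: link_cases)
        case (1 D)
        have "N + m \<le> j + w" using J 1(4) by (simp split: if_splits)
        then have "D * w < w" using 1(3) by linarith
        then have "D = 0" by (cases D) auto
        then show False using 1 I by auto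
      next
        case (2 x)
        have "N \<le> j + t" using J 2(5) by simp
        then have "Suc b * t < Suc (Suc x) * t" using b 2(4) by (simp add: linkable_def)
        then have "b < Suc x" by (metis Suc_less_eq mult_less_cancel2)
        then show False using 2(1) by simp
      qed
    qed
    moreover have "\<not> (i = Suc j \<and> i \<noteq> N \<and> i < N + m)" using I J by auto
    ultimately show ?thesis by (rule ent_zeroI)
  qed
  then show "string_mat r a $$ (i, j) = 0" using i j by (simp add: string_mat_def)
next
  fix i j' j
  assume sj: "succ_of j' j" and i: "i < n" "c i = 0"
  have n: "j < n" "j' < n" using sj by (auto simp: succ_of_def)
  have "ent r a i j' = 0"
  proof (cases "N + m \<le> i \<or> N + m \<le> j'")
    case True
    then show ?thesis using ent_zero[OF r] by blast
  next
    case False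
    then have ij: "i < N + m" "j' < N + m" by auto
    then have "j < N + m" using succ_string_rest[OF sj] by force
    note J = sj[unfolded succ_string_iff[OF this]] and I = c_zero_string[OF i(2)]
    have "\<not> (r \<and> link i j')"
    proof
      assume rl: "r \<and> link i j'"
      then have b: "linkable b" using r by blast
      from rl have l: "link i j'" by blast
      from b l show False
      proof (cases rule: link_cases)
        case (1 D)
        then have "i < t" using I by auto
        have "Suc D * t \<le> b * t" using 1 by (intro mult_le_mono1) simp
        then show False using 1 b \<open>i < t\<close> by (simp add: linkable_def)
      next
        case (2 x)
        then have "x * w < w" using I t by linarith
        then have "x = 0" by (cases x) auto
        then show False using 2 J by auto
      qed
    qed
    moreover have "\<not> (i = Suc j' \<and> i \<noteq> N \<and> i < N + m)" using I J ij t by auto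
    ultimately show ?thesis by (rule ent_zeroI)
  qed
  then show "string_mat r a $$ (i, j') = 0" using i n by (simp add: string_mat_def)
qed

text \<open>A plain step from \<open>j\<close> to \<open>Suc j\<close> that keeps the quotient
  raises the residue, that is, the label of the string. Links join strings of different lengths, so
  the strict order does not constrain them.\<close>

lemma strict_comm_string_mat:
  fixes a :: "'a::field"
  assumes r: "r \<Longrightarrow> linkable b"
  shows "strict_comm (string_mat r a)"
  unfolding strict_comm_def
proof (intro conjI comm_string_mat[OF r] allI impI)
  fix i j assume ij: "i < n" "j < n" "c i = c j" "sz (g i) = sz (g j)" "string_mat r a $$ (i, j) \<noteq> 0"
  have nz: "ent r a i j \<noteq> 0" using ij by (simp add: string_mat_def)
  have dm: "k mod s < Suc k mod s" if "0 < s" "Suc k div s = k div s" for k s :: nat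
    using that by (auto simp: div_Suc mod_Suc split: if_splits)
  have "\<not> (r \<and> link i j)"
  proof
    assume rl: "r \<and> link i j"
    then have b: "linkable b" using r by blast
    have T: "b < sz (g k)" if "k < N" for k
    proof -
      have "g k < t" using that t by (simp add: g_def)
      then have "b * t \<le> N - 1 - g k" using b unfolding linkable_def mult_Suc by linarith
      then have "b \<le> (N - 1 - g k) div t" using t by (simp add: less_eq_div_iff_mult_less_eq)
      then show ?thesis using \<open>g k < t\<close> by (simp add: sz_def)
    qed
    have V: "sz (g k) \<le> b" if "N \<le> k" "k < N + m" for k
    proof -
      have gk: "t \<le> g k" "g k - t < w" using that w by (auto simp: g_def)
      have "m - 1 - (g k - t) < b * w" using b w unfolding linkable_def by linarith
      then have "(m - 1 - (g k - t)) div w < b" using w by (simp add: div_less_iff_less_mult)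
      then show ?thesis using gk by (simp add: sz_def)
    qed
    from rl have l: "link i j" by blast
    from b l show False
    proof (cases rule: link_cases)
      case 1
      then show False using T[of i] V[of j] ij by simp
    next
      case 2
      then show False using T[of j] V[of i] ij by simp
    qed
  qed
  from ent_zeroI[OF this, of a] have i: "i = Suc j" "i \<noteq> N" "i < N + m" using nz by blast+
  show "g j < g i"
  proof (cases "i < N")
    case True
    then show ?thesis using ij(3) i dm[OF t(1), of j] by (simp add: g_def c_def)
  next
    case False
    then have "Suc (j - N) = i - N" "i - N < m" "N \<le> j" using i by auto
    then show ?thesis using ij(3) False dm[OF w(1), of "j - N"] by (simp add: g_def c_def)
  qed
qed

lemma string_mat_mem:
  fixes a :: "'a::field"
  assumes "r \<Longrightarrow> linkable b"
  shows "string_mat r a \<in> nilp_commutator n S"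
  using strict_comm_nilpotent[OF strict_comm_string_mat[OF assms]] comm_string_mat[OF assms]
  unfolding nilp_commutator_def comm_def by blast

text \<open>\<open>U\<close> undoes the step from one basis vector to the next and \<open>V\<close>
  restores the two heads \<open>0\<close> and \<open>N\<close>, so that the sum is the
  identity.\<close>

lemma nullity_witness:
  assumes "l = 0"
  shows "\<exists>U V :: 'a::field mat. U \<in> carrier_mat n n \<and> V \<in> carrier_mat n n \<and> det (string_mat False 1 * U + V) \<noteq> 0
    \<and> (\<forall>i<n. \<forall>k<n. k \<noteq> 0 \<longrightarrow> k \<noteq> N \<longrightarrow> V $$ (i, k) = 0)"
proof -
  define U where "U = mat n n (\<lambda>(i, j). if j = Suc i \<and> j \<noteq> N then 1 else 0 :: 'a)"
  define V where "V = mat n n (\<lambda>(i, j). if i = j \<and> (j = 0 \<or> j = N) then 1 else 0 :: 'a)"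
  let ?A = "string_mat False 1 :: 'a mat"
  have c: "?A \<in> carrier_mat n n" "U \<in> carrier_mat n n" "V \<in> carrier_mat n n"
    by (simp_all add: string_mat_def U_def V_def)
  have "?A * U + V = 1\<^sub>m n"
  proof (rule eq_matI)
    fix i j assume "i < dim_row (1\<^sub>m n :: 'a mat)" "j < dim_col (1\<^sub>m n :: 'a mat)"
    then have ij: "i < n" "j < n" by auto
    have "(?A * U) $$ (i, j) = (\<Sum>k<n. ?A $$ (i, k) * U $$ (k, j))"
      by (rule mult_mat_entry[OF c(1,2) ij])
    also have "\<dots> = (\<Sum>k<n. if k = i - 1 then (if i = j \<and> i \<noteq> 0 \<and> i \<noteq> N then 1 else 0) else 0)"
    proof (rule sum.cong[OF refl])
      fix k assume "k \<in> {..<n}"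
      then have k: "k < n" by simp
      have "i < N + m" using ij(1) assms n_def by simp
      then have "?A $$ (i, k) = (if i = Suc k \<and> i \<noteq> N then 1 else 0)"
        using ij(1) k by (simp add: string_mat_def ent_def)
      moreover have "U $$ (k, j) = (if j = Suc k \<and> j \<noteq> N then 1 else 0)" using ij(2) k by (simp add: U_def)
      ultimately show "?A $$ (i, k) * U $$ (k, j)
          = (if k = i - 1 then (if i = j \<and> i \<noteq> 0 \<and> i \<noteq> N then 1 else 0) else 0)" by auto
    qed
    also have "\<dots> = (if i = j \<and> i \<noteq> 0 \<and> i \<noteq> N then 1 else 0)" using ij by auto
    finally show "(?A * U + V) $$ (i, j) = 1\<^sub>m n $$ (i, j)"
      using ij c by (simp del: index_mult_mat(1)) (simp add: V_def)
  qed (use c in auto)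
  then have "det (?A * U + V) \<noteq> 0" by simp
  then show ?thesis using c by (intro exI[of _ U] exI[of _ V]) (auto simp: V_def)
qed

section \<open>Walks on linked strings, counted by polynomials\<close>

text \<open>Column 0 of the \<open>k\<close>-th power of \<open>string_mat True a\<close>, with
  \<open>a\<close> replaced by an indeterminate. Contributions of different walks may cancel at
  particular values of \<open>a\<close>; a single coefficient can be followed instead.\<close>

fun chain_poly :: "nat \<Rightarrow> nat \<Rightarrow> 'a::field poly" where
  "chain_poly 0 i = (if i = 0 then 1 else 0)"
| "chain_poly (Suc k) i = (\<Sum>j<n.
     ((if i = Suc j \<and> i \<noteq> N \<and> i < N + m then (if i < N then 1 else [:0, 1:]) else 0)
       + (if link i j then 1 else 0)) * chain_poly k j)"

lemma chain_poly_eval: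
  fixes a :: "'a::field"
  assumes b: "linkable b" and i: "i < n"
  shows "(string_mat True a ^\<^sub>m k) $$ (i, 0) = poly (chain_poly k i) a"
  using i
proof (induction k arbitrary: i)
  case 0
  then show ?case using t by (simp add: string_mat_def)
next
  case (Suc k)
  let ?A = "string_mat True a :: 'a mat"
  have A: "?A \<in> carrier_mat n n" by (simp add: string_mat_def)
  have "?A ^\<^sub>m Suc k = ?A * ?A ^\<^sub>m k"
  proof (induction k)
    case (Suc k)
    have "?A ^\<^sub>m Suc (Suc k) = (?A * ?A ^\<^sub>m k) * ?A" using Suc by simp
    also have "\<dots> = ?A * (?A ^\<^sub>m k * ?A)" by (rule assoc_mult_mat[OF A pow_carrier_mat[OF A] A])
    finally show ?case by simp
  qed (use A in simp)
  then have "(?A ^\<^sub>m Suc k) $$ (i, 0) = (\<Sum>j<n. ?A $$ (i, j) * (?A ^\<^sub>m k) $$ (j, 0))"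
    using mult_mat_entry[OF A pow_carrier_mat[OF A] Suc.prems, of 0] Suc.prems by simp
  also have "\<dots> = (\<Sum>j<n. ent True a i j * poly (chain_poly k j) a)"
    using Suc by (intro sum.cong) (auto simp: string_mat_def)
  also have "\<dots> = poly (chain_poly (Suc k) i) a"
    by (simp add: poly_sum) (auto intro!: sum.cong simp: ent_def)
  finally show ?case .
qed

end

context strings
begin

definition link_sum :: "nat \<Rightarrow> nat \<Rightarrow> 'a::field poly" where
  "link_sum k i = (\<Sum>j<n. if link i j then chain_poly k j else 0)"

lemma chain_poly_Suc:
  assumes "i < N + m"
  shows "chain_poly (Suc k) i
    = (if i = 0 \<or> i = N then 0 else (if i < N then 1 else [:0, 1:]) * chain_poly k (i - 1)) + link_sum k i"
proof -
  have "chain_poly (Suc k) i = (\<Sum>j<n. (if i = Suc j \<and> i \<noteq> N \<and> i < N + m then (if i < N then 1 else [:0, 1:]) else 0) * chain_poly k j)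
      + link_sum k i"
    unfolding link_sum_def
    by (simp only: chain_poly.simps distrib_right sum.distrib if_distrib[of "\<lambda>x. x * _"] mult_1_left mult_zero_left)
  also have "(\<Sum>j<n. (if i = Suc j \<and> i \<noteq> N \<and> i < N + m then (if i < N then 1 else [:0, 1:]) else 0) * chain_poly k j)
      = (\<Sum>j<n. if j = i - 1 then (if i = 0 \<or> i = N then 0 else (if i < N then 1 else [:0, 1:]) * chain_poly k (i - 1)) else 0)"
    using assms by (intro sum.cong) (auto simp del: chain_poly.simps)
  also have "\<dots> = (if i = 0 \<or> i = N then 0 else (if i < N then 1 else [:0, 1:]) * chain_poly k (i - 1))"
    using assms n_def by (auto simp del: chain_poly.simps)
  finally show ?thesis .
qed

lemma link_sum_coeff_zero:
  assumes "\<And>j. link i j \<Longrightarrow> coeff (chain_poly k j :: 'a::field poly) d = 0"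
  shows "coeff (link_sum k i :: 'a poly) d = 0"
  unfolding link_sum_def coeff_sum using assms by (intro sum.neutral) auto

lemma link_sum_eq:
  assumes "\<And>j. link i j \<longleftrightarrow> j = j0" "j0 < n"
  shows "link_sum k i = chain_poly k j0"
  unfolding link_sum_def using assms by simp

text \<open>The degree of \<open>chain_poly k i\<close> counts the steps spent on the second string. It is at most
  \<open>m - 1\<close>, and this value forces the walk to visit that string exactly once, from end to end.\<close>

lemma chain_poly_degrees:
  assumes b: "linkable b" and m: "2 \<le> m"
  shows "(\<forall>i. i + b * t < N \<longrightarrow> chain_poly k i = (if k = i then 1 else 0 :: 'a::field poly))
    \<and> (\<forall>i<N. \<forall>x<b. \<forall>d. i + x * t < N \<longrightarrow> m \<le> d + x * w \<longrightarrow> coeff (chain_poly k i :: 'a poly) d = 0)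
    \<and> (\<forall>y<m. \<forall>d. y < d \<longrightarrow> coeff (chain_poly k (N + y) :: 'a poly) d = 0)
    \<and> (\<forall>y<m. coeff (chain_poly k (N + y) :: 'a poly) y = (if k = t + y then 1 else 0))
    \<and> (\<forall>s<t. coeff (chain_poly k (N - t + s) :: 'a poly) (m - 1) = (if k = t + m + s then 1 else 0))"
proof (induction k)
  case 0
  have xw: "x * w < m" if "x < b" for x using that b by (simp add: linkable_def)
  have "t < N"
  proof -
    have "2 * t \<le> Suc b * t" using b by (intro mult_le_mono1) (simp add: linkable_def)
    then show ?thesis using b t unfolding linkable_def by linarith
  qed
  then show ?case using xw t w m by (force simp: coeff_1)
next
  case (Suc k)
  note IH = Suc
  let ?c = "chain_poly :: nat \<Rightarrow> nat \<Rightarrow> 'a poly"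
  have IHa: "?c k i = (if k = i then 1 else 0)" if "i + b * t < N" for i using IH that by blast
  have IHb: "coeff (?c k i) d = 0" if "i < N" "x < b" "i + x * t < N" "m \<le> d + x * w" for i x d
    using IH that by blast
  have IHc: "coeff (?c k (N + y)) d = 0" if "y < m" "y < d" for y d using IH that by blast
  have IHc': "coeff (?c k (N + y)) y = (if k = t + y then 1 else 0)" if "y < m" for y using IH that by blast
  have IHd: "coeff (?c k (N - t + s)) (m - 1) = (if k = t + m + s then 1 else 0)" if "s < t" for s
    using IH that by blast
  have b0: "0 < b" "Suc b * t \<le> N" "m \<le> b * w" using b by (auto simp: linkable_def)
  have xw: "x * w < m" if "x < b" for x using that b by (simp add: linkable_def)
  have "2 * t \<le> Suc b * t" using b0 by (intro mult_le_mono1) simp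
  then have tN: "2 * t \<le> N" using b0(2) by linarith
  have recT: "?c (Suc k) i = (if i = 0 then 0 else ?c k (i - 1)) + link_sum k i" if "i < N" for i
  proof -
    have "i < N + m" using that by simp
    from chain_poly_Suc[OF this, of k, where 'a = 'a] show ?thesis using that by (simp del: chain_poly.simps)
  qed
  have recV: "?c (Suc k) (N + y) = (if y = 0 then 0 else [:0, 1:] * ?c k (N + (y - 1))) + link_sum k (N + y)"
    if "y < m" for y
  proof -
    have "N + y < N + m" using that by simp
    from chain_poly_Suc[OF this, of k, where 'a = 'a] show ?thesis
      using t by (cases y) (simp_all del: chain_poly.simps mult_pCons_left)
  qed
  \<comment> \<open>Links back to the first string end at \<open>N - b * t\<close> or later; before
    that point only the plain walk arrives.\<close>
  have no_link: "\<not> link i j" if "i + b * t < N" for i j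
  proof
    assume l: "link i j"
    show False using b l
    proof (cases rule: link_cases)
      case (1 D)
      have "Suc D * t \<le> b * t" using 1 by (intro mult_le_mono1) simp
      then show False using 1(2) that by linarith
    next
      case 2
      then show False using that by simp
    qed
  qed
  have a: "?c (Suc k) i = (if Suc k = i then 1 else 0)" if i: "i + b * t < N" for i
  proof -
    have ls: "link_sum k i = (0 :: 'a poly)" unfolding link_sum_def using no_link[OF i] by simp
    have "i < N" using i by simp
    from recT[OF this] have "?c (Suc k) i = (if i = 0 then 0 else ?c k (i - 1))" unfolding ls by simp
    also have "\<dots> = (if Suc k = i then 1 else 0)"
      using IHa[of "i - 1"] i by (cases i) (auto simp del: chain_poly.simps)
    finally show ?thesis .
  qed
  \<comment> \<open>A link back that ends below \<open>N - x * t\<close> starts at least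
    \<open>x\<close> shift steps before the socle of the second string, where the degree is below
    \<open>m - x * w\<close>.\<close>
  have lower: "coeff (link_sum k i) d = (0 :: 'a)" if i: "i < N" "i + x * t < N" "m \<le> d + x * w" for i x d
  proof (rule link_sum_coeff_zero)
    fix j assume l: "link i j"
    show "coeff (?c k j) d = 0" using b l
    proof (cases rule: link_cases)
      case (1 D)
      have "x * t < Suc D * t" using i 1(2) by linarith
      then have "x \<le> D" by (metis less_Suc_eq_le mult_less_cancel2)
      then have "x * w \<le> D * w" by (rule mult_le_mono1)
      then have "j - N < m" "j - N < d" using 1(3,4) i(3) by linarith+
      then show ?thesis using IHc[of "j - N" d] 1(4) by simp
    next
      case 2
      then show ?thesis using i by simp
    qed
  qed
  have bb: "coeff (?c (Suc k) i) d = 0" if i: "i < N" "x < b" "i + x * t < N" "m \<le> d + x * w" for i x d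
  proof -
    have "?c (Suc k) i = (if i = 0 then 0 else ?c k (i - 1)) + link_sum k i"
      by (rule recT[OF i(1)])
    moreover have "coeff (?c k (i - 1)) d = 0" using IHb[of "i - 1" x d] i by simp
    ultimately show ?thesis using lower[OF i(1,3,4)] by (simp del: chain_poly.simps)
  qed
  \<comment> \<open>An entry into the second string at \<open>N + x * w\<close> with
    \<open>x > 0\<close> comes from below \<open>N - (b - x) * t\<close>, hence with degree below
    \<open>m - (b - x) * w\<close>, which is at most \<open>x * w\<close>. For \<open>x = 0\<close>
    it comes from the plain walk, with a constant polynomial. So entering late, or for a second
    time, never contributes to the top coefficient.\<close>
  have entry: "coeff (link_sum k (N + y)) d = (0 :: 'a)" if y: "y < m" "y \<le> d" "0 < d" for y d
  proof (rule link_sum_coeff_zero)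
    fix j assume l: "link (N + y) j"
    show "coeff (?c k j) d = 0" using b l
    proof (cases rule: link_cases)
      case 1
      then show ?thesis by simp
    next
      case (2 x)
      then have yx: "y = x * w" by simp
      show ?thesis
      proof (cases "x = 0")
        case True
        then have "j + b * t < N" using 2 by simp
        then show ?thesis using IHa y by (simp add: coeff_1)
      next
        case False
        have *: "(b - x) * t + x * t = b * t" "(b - x) * w + x * w = b * w"
          using 2(1) by (simp_all add: add_mult_distrib[symmetric])
        show ?thesis
          by (rule IHb[of _ "b - x"]) (use 2 * False yx y b0 in linarith)+
      qed
    qed
  qed
  have shift_coeff: "coeff ([:0, 1:] * p) (Suc d) = coeff p d" for p :: "'a poly" and d by simp
  have cc: "coeff (?c (Suc k) (N + y)) d = 0" if y: "y < m" "y < d" for y d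
  proof -
    have "?c (Suc k) (N + y) = (if y = 0 then 0 else [:0, 1:] * ?c k (N + (y - 1))) + link_sum k (N + y)"
      by (rule recV[OF y(1)])
    moreover have "coeff ([:0, 1:] * ?c k (N + (y - 1))) d = 0" if "y \<noteq> 0"
    proof -
      obtain d' where d: "d = Suc d'" using y by (cases d) auto
      show ?thesis unfolding d shift_coeff by (rule IHc) (use y that d in auto)
    qed
    ultimately show ?thesis using entry[of y d] y by (auto simp del: chain_poly.simps)
  qed
  have cc': "coeff (?c (Suc k) (N + y)) y = (if Suc k = t + y then 1 else 0)" if y: "y < m" for y
  proof (cases y)
    case 0
    have "link N j \<longleftrightarrow> j = t - 1" for j
    proof
      assume l: "link N j"
      show "j = t - 1" using b l
      proof (cases rule: link_cases)
        case (2 x)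
        then have "x = 0" using w by simp
        then show ?thesis using 2 by simp
      qed (use t in simp)
    qed (use t w in \<open>auto simp: link_def intro!: exI[of _ 0]\<close>)
    then have "link_sum k N = ?c k (t - 1)" by (rule link_sum_eq) (use t n_def in simp)
    moreover have "?c k (t - 1) = (if k = t - 1 then 1 else 0)"
      by (rule IHa) (use b0 t in \<open>simp add: algebra_simps\<close>)
    ultimately show ?thesis using recV[of 0] y 0 t by (auto simp del: chain_poly.simps)
  next
    case (Suc y')
    have "?c (Suc k) (N + y) = [:0, 1:] * ?c k (N + y') + link_sum k (N + y)"
      using recV[OF y] Suc by (simp del: chain_poly.simps mult_pCons_left)
    moreover have "coeff ([:0, 1:] * ?c k (N + y')) y = (if k = t + y' then 1 else 0)"
      unfolding Suc shift_coeff by (rule IHc') (use y Suc in simp)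
    ultimately show ?thesis using entry[of y y] y Suc by (simp del: chain_poly.simps)
  qed
  have dd: "coeff (?c (Suc k) (N - t + s)) (m - 1) = (if Suc k = t + m + s then 1 else 0)" if s: "s < t" for s
  proof (cases s)
    case (Suc s')
    have "coeff (link_sum k (N - t + s)) (m - 1) = (0 :: 'a)"
    proof (rule link_sum_coeff_zero)
      fix j assume l: "link (N - t + s) j"
      show "coeff (?c k j) (m - 1) = 0" using b l
      proof (cases rule: link_cases)
        case (1 D)
        then have "t + D * t + s = t" using t by simp
        then show ?thesis using Suc by simp
      next
        case 2
        then show ?thesis using s t by simp
      qed
    qed
    moreover have "?c (Suc k) (N - t + s) = ?c k (N - t + s') + link_sum k (N - t + s)"
      using recT[of "N - t + s"] s t Suc by (simp del: chain_poly.simps)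
    ultimately show ?thesis using IHd[of s'] s Suc by (simp del: chain_poly.simps)
  next
    case 0
    \<comment> \<open>The only link into \<open>N - t\<close> comes from the socle of the second
      string. What arrives along the first string has no term of degree
      \<open>m - 1\<close>.\<close>
    have "link (N - t) j \<longleftrightarrow> j = N + (m - 1)" for j
    proof
      assume l: "link (N - t) j"
      show "j = N + (m - 1)" using b l
      proof (cases rule: link_cases)
        case (1 D)
        then have "t + D * t = t" using t by simp
        then have "D = 0" using t by simp
        then show ?thesis using 1 by simp
      qed (use t in simp)
    qed (use t w in \<open>auto simp: link_def intro!: exI[of _ 0]\<close>)
    then have "link_sum k (N - t) = ?c k (N + (m - 1))" by (rule link_sum_eq) (use m n_def in simp)
    then have "?c (Suc k) (N - t) = ?c k (N - t - 1) + ?c k (N + (m - 1))"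
      using recT[of "N - t"] t tN by (simp del: chain_poly.simps)
    moreover have "coeff (?c k (N - t - 1)) (m - 1) = 0"
    proof (cases "b = 1")
      case True
      then show ?thesis using IHa[of "N - t - 1"] tN t m by (simp add: coeff_1)
    next
      case False
      then show ?thesis using IHb[of "N - t - 1" 1 "m - 1"] b0 tN t w m by simp
    qed
    ultimately show ?thesis using IHc'[of "m - 1"] m 0 by (auto simp del: chain_poly.simps)
  qed
  show ?case using a bb cc cc' dd by blast
qed

text \<open>The entry in row \<open>N - 1\<close> and column 0 is a polynomial in \<open>a\<close>
  whose coefficient of degree \<open>m - 1\<close> is 1, so it is nonzero at some
  \<open>a\<close>.\<close>

lemma ex_long_string_mat:
  assumes b: "linkable b" and m: "2 \<le> m" and inf: "infinite (UNIV :: 'a::field set)"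
  shows "\<exists>a :: 'a. string_mat True a ^\<^sub>m (2 * t + m - 1) \<noteq> 0\<^sub>m n n"
proof -
  let ?p = "chain_poly (2 * t + m - 1) (N - 1) :: 'a poly"
  have all: "\<forall>s<t. coeff (chain_poly (2 * t + m - 1) (N - t + s) :: 'a poly) (m - 1)
    = (if 2 * t + m - 1 = t + m + s then 1 else 0)"
    using chain_poly_degrees[OF b m, of "2 * t + m - 1", where 'a = 'a] by blast
  then have *: "coeff (chain_poly (2 * t + m - 1) (N - t + (t - 1)) :: 'a poly) (m - 1)
    = (if 2 * t + m - 1 = t + m + (t - 1) then 1 else 0)"
  proof -
    have "t - 1 < t" using t by simp
    from all[rule_format, OF this] show ?thesis .
  qed
  have eq: "N - t + (t - 1) = N - 1" "2 * t + m - 1 = t + m + (t - 1)" using t by auto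
  have "coeff ?p (m - 1) = 1" using * unfolding eq by simp
  then have "?p \<noteq> 0" by (metis coeff_0 one_neq_zero zero_neq_one)
  then have "finite {a. poly ?p a = 0}" by (rule poly_roots_finite)
  then obtain a where a: "poly ?p a \<noteq> 0" using inf by (metis (mono_tags, lifting) UNIV_eq_I mem_Collect_eq)
  have "N - 1 < n" "0 < n" using t n_def by auto
  then have "(string_mat True a ^\<^sub>m (2 * t + m - 1)) $$ (N - 1, 0) \<noteq> 0"
    using a chain_poly_eval[OF b, of "N - 1" a "2 * t + m - 1"] by metis
  moreover have "0\<^sub>m n n $$ (N - 1, 0) = (0 :: 'a)" using \<open>N - 1 < n\<close> \<open>0 < n\<close> by simp
  ultimately show ?thesis by metis
qed

end

section \<open>The generic Jordan type\<close>

lemma nilp_jordan_matrix_similar: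
  assumes "shift_model n G sz g c" "shift_type G sz = P"
  shows "\<exists>R R'. similar_mat_wit (nilp_jordan_matrix P :: 'a::field mat) (shift_mat n g c) R R'"
proof -
  have "similar_mat (shift_mat n g c :: 'a mat) (nilp_jordan_matrix P)"
    using has_jordan_type_shift_mat[OF assms(1), where 'a = 'a] assms(2)
    unfolding has_jordan_type_def jordan_nf_def nilp_jordan_matrix_def by blast
  from similar_mat_sym[OF this] show ?thesis unfolding similar_mat_def .
qed

lemma nilp_commutator_unconj:
  fixes A B B' :: "'a::field mat"
  assumes w: "similar_mat_wit B' B R R'" and B: "B \<in> carrier_mat n n" and A: "A \<in> nilp_commutator n B'"
  shows "R' * A * R \<in> nilp_commutator n B" "R * (R' * A * R) * R' = A"
proof -
  have "n = dim_row B'" using carrier_matD(1)[OF similar_mat_witD(5)[OF refl w]] carrier_matD(1)[OF B] by metis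
  from similar_mat_witD(4)[OF this w] have B': "B' \<in> carrier_mat n n" .
  note W = similar_mat_witD2[OF B' w]
  show "R' * A * R \<in> nilp_commutator n B"
    by (rule nilp_commutator_conj[OF similar_mat_wit_sym[OF w] B' A])
  have Ac: "A \<in> carrier_mat n n" using A by (simp add: nilp_commutator_def)
  have "similar_mat_wit (R' * A * R) A R' R"
    by (rule similar_mat_witI[OF W(2,1) refl _ Ac W(7,6)]) (use W(6,7) Ac in auto)
  from similar_mat_witD2(3)[OF Ac similar_mat_wit_sym[OF this]] show "R * (R' * A * R) * R' = A" by simp
qed

lemma nilp_commutator_jordan_irreducible:
  fixes f1 f2 :: "'a::field mat \<Rightarrow> 'a"
  assumes m: "shift_model n G sz g c" "shift_type G sz = P"
    and inf: "infinite (UNIV :: 'a set)" and f: "regular n f1" "regular n f2"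
    and A: "A1 \<in> nilp_commutator n (nilp_jordan_matrix P)" "A2 \<in> nilp_commutator n (nilp_jordan_matrix P)"
    and nz: "f1 A1 \<noteq> 0" "f2 A2 \<noteq> 0"
  shows "\<exists>A\<in>nilp_commutator n (nilp_jordan_matrix P). f1 A \<noteq> 0 \<and> f2 A \<noteq> 0"
proof -
  interpret shift n G sz g c using m(1) by unfold_locales
  obtain R R' where w: "similar_mat_wit (nilp_jordan_matrix P :: 'a mat) S R R'"
    using nilp_jordan_matrix_similar[OF m] by blast
  have "n = dim_row (nilp_jordan_matrix P :: 'a mat)"
    using carrier_matD(1)[OF similar_mat_witD(5)[OF refl w]] by simp
  note R = similar_mat_witD(6,7)[OF this w]
  note un = nilp_commutator_unconj[OF w shift_mat_carrier]
  have "\<exists>A\<in>nilp_commutator n S. f1 (R * A * R') \<noteq> 0 \<and> f2 (R * A * R') \<noteq> 0"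
    by (rule nilp_commutator_irreducible[OF inf regular_conj[OF f(1) R] regular_conj[OF f(2) R]
          un(1)[OF A(1)] un(1)[OF A(2)]]) (use nz un(2)[OF A(1)] un(2)[OF A(2)] in simp_all)
  then show ?thesis using nilp_commutator_conj[OF w shift_mat_carrier] by blast
qed

lemma two_part_multiset:
  fixes Q :: "nat multiset" and u n :: nat
  assumes s: "size Q \<le> 2" and n: "sum_mset Q = n" "u < n" and le: "\<forall>s\<in>#Q. s \<le> u" and u: "\<not> (\<forall>s\<in>#Q. s \<le> u - 1)"
  shows "Q = {#u, n - u#}"
proof -
  obtain s where s': "s \<in># Q" "\<not> s \<le> u - 1" using u by blast
  have "s \<le> u" using le s'(1) by blast
  then have "s = u" using s'(2) by linarith
  then obtain Q' where Q: "Q = add_mset u Q'" using multi_member_split[OF s'(1)] by blast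
  have "size Q' \<le> 1" using s Q by simp
  moreover have "Q' \<noteq> {#}" using n Q by auto
  moreover from this have "size Q' \<noteq> 0" by simp
  ultimately have "size Q' = 1" by linarith
  then obtain v where "Q' = {#v#}" using size_1_singleton_mset by blast
  then show ?thesis using Q n(1) by auto
qed

text \<open>\<open>A1\<close> shows that corank at most 2 occurs, \<open>A2\<close> that the bound
  \<open>u\<close> on the index is attained. Transported to the Jordan matrix, \<open>f1\<close> and
  \<open>f2\<close> are the corresponding open conditions. Where both hold, the type has at most two
  parts and largest part \<open>u\<close>. Any other nonempty open set meets this locus, so no other
  type can be generic.\<close>

lemma generic_type_eqI:
  fixes A1 A2 U V :: "'a::field mat"
  assumes inf: "infinite (UNIV :: 'a set)"
    and m1: "shift_model n G1 sz1 g1 c1" "shift_type G1 sz1 = P"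
    and A1: "A1 \<in> nilp_commutator n (shift_mat n g1 c1)"
    and UV: "U \<in> carrier_mat n n" "V \<in> carrier_mat n n" "det (A1 * U + V) \<noteq> 0"
    and V: "\<And>i l. i < n \<Longrightarrow> l < n \<Longrightarrow> l \<noteq> s1 \<Longrightarrow> l \<noteq> s2 \<Longrightarrow> V $$ (i, l) = 0"
    and m2: "shift_model n G2 sz2 g2 c2" "shift_type G2 sz2 = P"
    and A2: "A2 \<in> nilp_commutator n (shift_mat n g2 c2)" "A2 ^\<^sub>m (u - 1) \<noteq> 0\<^sub>m n n"
    and ob: "\<And>i. 1 \<le> i \<Longrightarrow> oblak i P \<le> u" and un: "u < n"
  shows "generic_type TYPE('a) P = {#u, n - u#}"
proof -
  let ?J = "nilp_jordan_matrix P :: 'a mat"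
  let ?N = "nilp_commutator n ?J"
  have nP: "sum_mset P = n" using shift_model_dim[OF m1(1)] m1(2) by simp
  obtain R R' where w1: "similar_mat_wit ?J (shift_mat n g1 c1) R R'"
    using nilp_jordan_matrix_similar[OF m1] by blast
  obtain T T' where w2: "similar_mat_wit ?J (shift_mat n g2 c2) T T'"
    using nilp_jordan_matrix_similar[OF m2] by blast
  have nJ: "n = dim_row ?J" using carrier_matD(1)[OF similar_mat_witD(5)[OF refl w1]] by simp
  note R = similar_mat_witD[OF nJ w1] and T = similar_mat_witD[OF nJ w2]
  have c1: "A1 \<in> carrier_mat n n" and c2: "A2 \<in> carrier_mat n n"
    using A1 A2 by (auto simp: nilp_commutator_def)

  define B1 where "B1 = R * A1 * R'"
  define B2 where "B2 = T * A2 * T'"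
  have B1: "B1 \<in> ?N" unfolding B1_def by (rule nilp_commutator_conj[OF w1 shift_mat_carrier A1])
  have B2: "B2 \<in> ?N" unfolding B2_def by (rule nilp_commutator_conj[OF w2 shift_mat_carrier A2(1)])
  have RU: "R * U \<in> carrier_mat n n" and RV: "R * V \<in> carrier_mat n n" using R UV by auto
  have dR: "det R \<noteq> 0" using det_mult[OF R(6,7)] R(1) by auto
  have "B1 * (R * U) + R * V = R * (A1 * U + V)"
  proof -
    have RA: "R * A1 \<in> carrier_mat n n" using R(6) c1 by simp
    have "B1 * (R * U) = R * A1 * (R' * (R * U))"
      unfolding B1_def by (rule assoc_mult_mat[OF RA R(7) RU])
    also have "R' * (R * U) = R' * R * U" by (rule assoc_mult_mat[symmetric, OF R(7,6) UV(1)])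
    also have "\<dots> = U" using R(2) UV(1) by simp
    also have "R * A1 * U = R * (A1 * U)" by (rule assoc_mult_mat[OF R(6) c1 UV(1)])
    finally have "B1 * (R * U) = R * (A1 * U)" .
    moreover have "A1 * U \<in> carrier_mat n n" using c1 UV by simp
    ultimately show ?thesis by (simp only: mult_add_distrib_mat[OF R(6) _ UV(2)])
  qed
  moreover have "det (R * (A1 * U + V)) \<noteq> 0"
    using det_mult[OF R(6), of "A1 * U + V"] dR UV c1 by simp
  ultimately have d1: "det (B1 * (R * U) + R * V) \<noteq> 0" by simp
  have RVz: "(R * V) $$ (i, l) = 0" if "i < n" "l < n" "l \<noteq> s1" "l \<noteq> s2" for i l
    unfolding mult_mat_entry[OF R(6) UV(2) that(1,2)] using V that by (intro sum.neutral) auto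
  have B2c: "B2 \<in> carrier_mat n n" using B2 by (simp add: nilp_commutator_def)
  have wA2: "similar_mat_wit B2 A2 T T'" unfolding B2_def
    by (rule similar_mat_witI[OF T(1,2) refl _ c2 T(6,7)]) (use T(6,7) c2 in auto)
  have "B2 ^\<^sub>m (u - 1) \<noteq> 0\<^sub>m n n"
    using similar_mat_wit_pow_zero_iff[OF wA2 B2c] A2(2) by blast
  obtain i j where ij: "i < n" "j < n" "(B2 ^\<^sub>m (u - 1)) $$ (i, j) \<noteq> 0"
  proof (rule ccontr)
    assume "\<not> thesis"
    then have "B2 ^\<^sub>m (u - 1) = 0\<^sub>m n n" using that B2c by (intro eq_matI) auto
    then show False using \<open>B2 ^\<^sub>m (u - 1) \<noteq> 0\<^sub>m n n\<close> by simp
  qed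

  define f1 where "f1 = (\<lambda>A :: 'a mat. det (A * (R * U) + R * V))"
  define f2 where "f2 = (\<lambda>A :: 'a mat. (A ^\<^sub>m (u - 1)) $$ (i, j))"
  have f: "regular n f1" "regular n f2"
    unfolding f1_def f2_def using regular_det_affine[OF RU RV] regular_pow_entry[OF ij(1,2)] by blast+
  obtain h where h: "h \<in> mat_poly_fun n" "\<And>A. A \<in> carrier_mat n n \<Longrightarrow> f1 A * f2 A = h A"
    using regular_mult[OF f] by (rule regularE) blast
  let ?U0 = "?N - {A \<in> carrier_mat n n. \<forall>f\<in>{h}. f A = 0}"
  have Nc: "A \<in> carrier_mat n n" if "A \<in> ?N" for A using that by (simp add: nilp_commutator_def)
  have open0: "zariski_open_in n ?N ?U0" unfolding zariski_open_in_def using h(1) by blast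
  have type0: "has_jordan_type A {#u, n - u#}" if A: "A \<in> ?U0" for A
  proof -
    have AN: "A \<in> ?N" and "h A \<noteq> 0" using A Nc by auto
    then have nz: "f1 A \<noteq> 0" "f2 A \<noteq> 0" using h(2)[OF Nc[OF AN]] by auto
    have Ac: "A \<in> carrier_mat n n" by (rule Nc[OF AN])
    obtain m where "A ^\<^sub>m m = 0\<^sub>m n n" using AN by (auto simp: nilp_commutator_def)
    then obtain Q where Q: "has_jordan_type A Q" using nilpotent_has_jordan_type[OF Ac] by blast
    interpret shift n G1 sz1 g1 c1 using m1(1) by unfold_locales
    have "R' * A * R \<in> nilp_commutator n S" by (rule nilp_commutator_unconj(1)[OF w1 shift_mat_carrier AN])
    then have "(R' * A * R) ^\<^sub>m u = 0\<^sub>m n n"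
      using comm_nilpotent_pow_zero[of "R' * A * R" _ u] ob unfolding m1(2) nilp_commutator_def comm_def by blast
    moreover have "similar_mat_wit (R' * A * R) A R' R"
      by (rule similar_mat_witI[OF R(2,1) refl _ Ac R(7,6)]) (use R(6,7) Ac in auto)
    ultimately have "A ^\<^sub>m u = 0\<^sub>m n n"
      using similar_mat_wit_pow_zero_iff[of "R' * A * R" A R' R n u] R(6,7) Ac by auto
    moreover have "A ^\<^sub>m (u - 1) \<noteq> 0\<^sub>m n n"
    proof
      assume "A ^\<^sub>m (u - 1) = 0\<^sub>m n n"
      then show False using nz(2) ij(1,2) by (simp add: f2_def)
    qed
    moreover have "size Q \<le> 2"
      by (rule jordan_type_size_le_2[OF Ac Q RU RV nz(1)[unfolded f1_def] RVz])
    moreover note has_jordan_type_pow_zero_iff[OF Ac Q]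
    ultimately have "Q = {#u, n - u#}" using un by (intro two_part_multiset) auto
    then show ?thesis using Q by simp
  qed
  have irr: "\<exists>A\<in>?N. f A \<noteq> 0 \<and> f' A \<noteq> 0"
    if "regular n f" "regular n f'" "X \<in> ?N" "Y \<in> ?N" "f X \<noteq> 0" "f' Y \<noteq> 0" for f f' X Y
    by (rule nilp_commutator_jordan_irreducible[OF m1 inf that])
  obtain X where X: "X \<in> ?N" "f1 X \<noteq> 0" "f2 X \<noteq> 0"
    using irr[OF f B1 B2] d1 ij(3) by (auto simp: f1_def f2_def)
  then have hX: "h X \<noteq> 0" using h(2)[OF Nc[OF X(1)]] by auto
  then have ne0: "?U0 \<noteq> {}" using X(1) by auto
  have uniq: "Q = {#u, n - u#}"
    if U: "zariski_open_in n ?N U" "U \<noteq> {}" "\<forall>A\<in>U. has_jordan_type A Q" for Q U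
  proof -
    obtain F where F: "F \<subseteq> mat_poly_fun n" "U = ?N - {A \<in> carrier_mat n n. \<forall>f\<in>F. f A = 0}"
      using U(1) unfolding zariski_open_in_def by blast
    obtain Y where Y: "Y \<in> U" using U(2) by blast
    then have YN: "Y \<in> ?N" using F(2) by blast
    then obtain f where f: "f \<in> F" "f Y \<noteq> 0" using Y F(2) Nc by blast
    have rf: "regular n f" using f F(1) by (intro regularI[of f]) auto
    have rh: "regular n h" using h(1) by (intro regularI[of h]) auto
    obtain Z where Z: "Z \<in> ?N" "h Z \<noteq> 0" "f Z \<noteq> 0" using irr[OF rh rf X(1) YN hX f(2)] by blast
    have "Z \<in> ?U0" using Z by auto
    moreover have "Z \<in> U" using Z f(1) F(2) by auto
    ultimately show ?thesis using type0 U(3) has_jordan_type_unique by blast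
  qed
  show ?thesis
    unfolding generic_type_def nP
    by (rule the_equality) (use open0 ne0 type0 uniq in blast)+
qed

text \<open>Followed backwards from \<open>N - 1\<close>, the unlinked walk is forced, so the entry
  is a single product and nothing can cancel.\<close>

lemma (in strings) string_mat_long: "string_mat False (1 :: 'a::field) ^\<^sub>m (N - 1) \<noteq> 0\<^sub>m n n"
proof -
  let ?A = "string_mat False 1 :: 'a mat"
  have A: "?A \<in> carrier_mat n n" by (simp add: string_mat_def)
  have N: "N - 1 < n" using t n_def by simp
  have row: "(?A ^\<^sub>m k) $$ (N - 1, i) = (if i + k = N - 1 then 1 else 0)" if "k < N" "i < n" for k i
    using that
  proof (induction k arbitrary: i)
    case 0
    then show ?case using N A by auto
  next
    case (Suc k)
    have "(?A ^\<^sub>m Suc k) $$ (N - 1, i) = (\<Sum>j<n. (?A ^\<^sub>m k) $$ (N - 1, j) * ?A $$ (j, i))"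
      using mult_mat_entry[OF pow_carrier_mat[OF A] A N Suc.prems(2)] by simp
    also have "\<dots> = (\<Sum>j<n. if j = N - 1 - k then ?A $$ (j, i) else 0)"
    proof (rule sum.cong[OF refl])
      fix j assume "j \<in> {..<n}"
      then have "(?A ^\<^sub>m k) $$ (N - 1, j) = (if j + k = N - 1 then 1 else 0)" using Suc by simp
      moreover have "j + k = N - 1 \<longleftrightarrow> j = N - 1 - k" using Suc.prems(1) by linarith
      ultimately show "(?A ^\<^sub>m k) $$ (N - 1, j) * ?A $$ (j, i) = (if j = N - 1 - k then ?A $$ (j, i) else 0)"
        by simp
    qed
    also have "\<dots> = ?A $$ (N - 1 - k, i)" using N by auto
    also have "\<dots> = (if i + Suc k = N - 1 then 1 else 0)"
      using Suc.prems N by (auto simp: string_mat_def ent_def)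
    finally show ?case .
  qed
  have "(?A ^\<^sub>m (N - 1)) $$ (N - 1, 0) = 1" using row[of "N - 1" 0] N t by simp
  moreover have "(0\<^sub>m n n :: 'a mat) $$ (N - 1, 0) = 0" using N by simp
  ultimately show ?thesis by (metis zero_neq_one)
qed

lemma ex_strings:
  assumes "0 < t" "t \<le> N" "0 < w" "w \<le> m" "e \<le> l" "e = 0 \<Longrightarrow> l = 0" "n = N + (m + l)"
  shows "\<exists>sz g c. strings N t m w l e n sz g c"
  unfolding strings_def using assms by auto

text \<open>The arrangement with index 1 has no third string and certifies the corank; the other one
  certifies the index, either through \<open>z\<close> alone or through the links.\<close>

lemma generic_type_strings:
  fixes u n :: nat
  assumes inf: "infinite (UNIV :: 'a::field set)"
    and s1: "strings N1 t1 m1 w1 0 0 n sz1 g1 c1" "P = strip N1 t1 + strip m1 w1"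
    and s2: "strings N t m w l e n sz g c" "P = strip N t + (strip m w + strip l e)"
    and u: "u = N \<or> u = 2 * t + m \<and> 2 \<le> m \<and> (\<exists>b. strings.linkable N t m w b)"
    and ob: "\<And>i. 1 \<le> i \<Longrightarrow> oblak i P \<le> u" and un: "u < n"
  shows "generic_type TYPE('a) P = {#u, n - u#}"
proof -
  interpret s1: strings N1 t1 m1 w1 0 0 n sz1 g1 c1 by (rule s1(1))
  interpret s2: strings N t m w l e n sz g c by (rule s2(1))
  have P1: "shift_type {..<t1 + (w1 + 0)} sz1 = P" using s1.string_type s1(2) by (simp add: strip_def shift_type_def)
  have P2: "shift_type {..<t + (w + e)} sz = P" using s2.string_type s2(2) by simp
  obtain U V :: "'a mat" where UV: "U \<in> carrier_mat n n" "V \<in> carrier_mat n n"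
      "det (s1.string_mat False 1 * U + V) \<noteq> 0" "\<forall>i<n. \<forall>k<n. k \<noteq> 0 \<longrightarrow> k \<noteq> N1 \<longrightarrow> V $$ (i, k) = 0"
    using s1.nullity_witness[where 'a = 'a] by blast
  have V: "V $$ (i, k) = 0" if "i < n" "k < n" "k \<noteq> 0" "k \<noteq> N1" for i k using UV(4) that by blast
  have mem1: "s1.string_mat False (1 :: 'a) \<in> nilp_commutator n (shift_mat n g1 c1)"
    by (rule s1.string_mat_mem) simp
  have "\<exists>A :: 'a mat. A \<in> nilp_commutator n (shift_mat n g c) \<and> A ^\<^sub>m (u - 1) \<noteq> 0\<^sub>m n n"
    using u
  proof (elim disjE conjE exE)
    assume "u = N"
    then show ?thesis using s2.string_mat_long[where 'a = 'a] s2.string_mat_mem[of False] by blast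
  next
    fix b assume a: "u = 2 * t + m" "2 \<le> m" "s2.linkable b"
    obtain x :: 'a where "s2.string_mat True x ^\<^sub>m (2 * t + m - 1) \<noteq> 0\<^sub>m n n"
      using s2.ex_long_string_mat[OF a(3,2) inf] by blast
    then show ?thesis using s2.string_mat_mem[of True b x] a by blast
  qed
  then obtain A2 :: "'a mat" where A2: "A2 \<in> nilp_commutator n (shift_mat n g c)" "A2 ^\<^sub>m (u - 1) \<noteq> 0\<^sub>m n n"
    by blast
  show ?thesis
    by (rule generic_type_eqI[OF inf s1.string_model P1 mem1 UV(1-3) V s2.string_model P2 A2 ob un])
qed

text \<open>Only the chains of index \<open>a\<close> and \<open>b\<close> compete, and that of
  index \<open>a - 1\<close> if it joins the parts \<open>a - 1\<close> to the parts
  \<open>b = a - 2\<close>. Any other chain is dominated by one of these, since a part of size at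
  least 2 counts in full at least as much as through its two ends.\<close>

lemma oblak_four_part:
  assumes P: "four_part P a na na' b nb nb'" and i: "1 \<le> i"
    and A: "a * na + (a - 1) * na' \<le> u"
    and B: "2 * na + 2 * na' + b * nb + (b - 1) * nb' \<le> u"
    and C: "a = b + 2 \<Longrightarrow> 2 * na + (a - 1) * na' + b * nb \<le> u"
  shows "oblak i P \<le> u"
proof -
  define f where "f s = (if s = i \<or> Suc s = i then s else if i < s then 2 else 0)" for s
  have "oblak i P = na * f a + na' * f (a - 1) + nb * f b + nb' * f (b - 1)"
    using P unfolding oblak_def four_part_def f_def[abs_def] by simp
  moreover have h: "b + 2 \<le> a" "1 \<le> b" "b = 1 \<Longrightarrow> nb' = 0" using P unfolding four_part_def by auto
  moreover have m: "2 * na \<le> a * na" "2 * na' \<le> (a - 1) * na'" "2 \<le> b \<Longrightarrow> 2 * nb \<le> b * nb"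
      "3 \<le> b \<Longrightarrow> 2 * nb' \<le> (b - 1) * nb'"
    using h by (auto intro!: mult_le_mono1)
  ultimately have o: "oblak i P = f a * na + f (a - 1) * na' + f b * nb + f (b - 1) * nb'" by (simp only: mult.commute)
  consider "a + 1 < i" | "i = a + 1" | "i = a" | "i = a - 1" | "b + 1 < i" "i < a - 1" | "i = b + 1" "i < a - 1"
    | "i = b" | "i = b - 1" "2 \<le> b" | "i < b - 1" "3 \<le> b" using h i by linarith
  then show ?thesis
  proof cases
    case 1
    have "f a = 0" "f (a - 1) = 0" "f b = 0" "f (b - 1) = 0" using h 1 by (auto simp: f_def)
    then show ?thesis using o by simp
  next
    case 2
    have "f a = a" "f (a - 1) = 0" "f b = 0" "f (b - 1) = 0" using h 2 by (auto simp: f_def)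
    then show ?thesis using o A by simp
  next
    case 3
    have "f a = a" "f (a - 1) = a - 1" "f b = 0" "f (b - 1) = 0" using h 3 by (auto simp: f_def)
    then show ?thesis using o A by simp
  next
    case 4
    have f: "f a = 2" "f (a - 1) = a - 1" "f b = (if a = b + 2 then b else 0)" "f (b - 1) = 0"
      using h 4 by (auto simp: f_def)
    then have o': "oblak i P = 2 * na + (a - 1) * na' + (if a = b + 2 then b else 0) * nb" using o by simp
    show ?thesis
    proof (cases "a = b + 2")
      case True
      then show ?thesis using o' C by simp
    next
      case False
      then have "oblak i P = 2 * na + (a - 1) * na'" using o' by simp
      then show ?thesis using A m(1) by linarith
    qed
  next
    case 5
    have "f a = 2" "f (a - 1) = 2" "f b = 0" "f (b - 1) = 0" using h 5 by (auto simp: f_def)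
    then show ?thesis using o B by simp
  next
    case 6
    have "f a = 2" "f (a - 1) = 2" "f b = b" "f (b - 1) = 0" using h 6 by (auto simp: f_def)
    then show ?thesis using o B by simp
  next
    case 7
    have "f a = 2" "f (a - 1) = 2" "f b = b" "f (b - 1) = b - 1" using h 7 by (auto simp: f_def)
    then show ?thesis using o B by simp
  next
    case 8
    have "f a = 2" "f (a - 1) = 2" "f b = 2" "f (b - 1) = b - 1" using h 8 by (auto simp: f_def)
    then have "oblak i P = 2 * na + 2 * na' + 2 * nb + (b - 1) * nb'" using o by simp
    then show ?thesis using B m(3)[OF 8(2)] by linarith
  next
    case 9
    have "f a = 2" "f (a - 1) = 2" "f b = 2" "f (b - 1) = 2" using h 9 by (auto simp: f_def)
    then have "oblak i P = 2 * na + 2 * na' + 2 * nb + 2 * nb'" using o by simp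
    moreover have "2 \<le> b" using 9 by simp
    ultimately show ?thesis using B m(3) m(4)[OF 9(2)] by linarith
  qed
qed

text \<open>The chain of index \<open>a\<close> is realised by \<open>z\<close>, that of index
  \<open>b\<close> by links between the two pieces, and that of index \<open>a - 1\<close> by links
  after regrouping, where the second piece has shift strings of lengths \<open>b + 1\<close> and
  \<open>b\<close>.\<close>

lemma generic_type_four_part:
  assumes inf: "infinite (UNIV :: 'a::field set)" and P: "four_part P a na na' b nb nb'"
    and u: "u = a * na + (a - 1) * na' \<or> u = 2 * na + 2 * na' + b * nb + (b - 1) * nb'
      \<or> a = b + 2 \<and> u = 2 * na + (a - 1) * na' + b * nb \<and> (0 < na' \<or> nb' = 0)"
    and A: "a * na + (a - 1) * na' \<le> u"
    and B: "2 * na + 2 * na' + b * nb + (b - 1) * nb' \<le> u"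
    and C: "a = b + 2 \<Longrightarrow> 2 * na + (a - 1) * na' + b * nb \<le> u"
    and n: "sum_mset P = n" "u < n"
  shows "generic_type TYPE('a) P = {#u, n - u#}"
proof -
  have P': "P = replicate_mset na a + replicate_mset na' (a - 1) + (replicate_mset nb b + replicate_mset nb' (b - 1))"
    and h: "b + 2 \<le> a" "1 \<le> b" "0 < na" "0 < nb" "b = 1 \<Longrightarrow> nb' = 0" using P unfolding four_part_def by auto
  define N t m w where d: "N = a * na + (a - 1) * na'" "t = na + na'" "m = b * nb + (b - 1) * nb'" "w = nb + nb'"
  have ob: "oblak i P \<le> u" if "1 \<le> i" for i by (rule oblak_four_part[OF P that A B C])
  have Nt: "Suc b * t \<le> N"
  proof -
    have "Suc b * na \<le> a * na" by (rule mult_le_mono1) (use h in linarith)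
    moreover have "Suc b * na' \<le> (a - 1) * na'" by (rule mult_le_mono1) (use h in linarith)
    ultimately show ?thesis unfolding d add_mult_distrib2 by linarith
  qed
  then have tN: "t \<le> N" by simp
  have nb': "nb' \<le> (b - 1) * nb'" using h by (cases "b = 1") auto
  have wm: "w \<le> m" using nb' h unfolding d by (intro add_mono) auto
  have t0: "0 < t" and w0: "0 < w" using h d by auto
  have sA: "strip N t = replicate_mset na a + replicate_mset na' (a - 1)" unfolding d using h by (intro strip_eq) auto
  have "1 < b \<or> nb' = 0" using h(2,5) by linarith
  then have sB: "strip m w = replicate_mset nb b + replicate_mset nb' (b - 1)"
    unfolding d using h by (intro strip_eq) auto
  have s00: "strip 0 0 = {#}" by (simp add: strip_def shift_type_def)
  have P1: "P = strip N t + strip m w" using P' sA sB by simp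
  have P2: "P = strip N t + (strip m w + strip 0 0)" using P1 s00 by simp
  have nN: "n = N + (m + 0)" using n(1) unfolding P' d by (simp add: mult.commute)
  obtain sz g c where s1: "strings N t m w 0 0 n sz g c"
    using ex_strings[OF t0 tN w0 wm _ _ nN] by auto
  note gt = generic_type_strings[OF inf s1 P1 _ _ _ ob n(2)]
  have caseA: ?thesis if "u = N" by (rule gt[OF s1 P2]) (use that in simp)
  have caseB: ?thesis if "u = 2 * na + 2 * na' + b * nb + (b - 1) * nb'"
  proof (cases "2 \<le> m")
    case True
    have "x * w < m" if "x < b" for x
    proof -
      have "x * nb' \<le> (b - 1) * nb'" by (rule mult_le_mono1) (use that in linarith)
      moreover have "x * nb < b * nb" using that h by simp
      ultimately show ?thesis unfolding d add_mult_distrib2 by linarith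
    qed
    moreover have "m \<le> b * w" unfolding d by (simp add: add_mult_distrib2)
    ultimately have "strings.linkable N t m w b"
      using Nt h(2) unfolding strings.linkable_def[OF s1] by auto
    then show ?thesis using True that by (intro gt[OF s1 P2]) (auto simp: d)
  next
    \<comment> \<open>Here \<open>m = 1\<close>, and the chain of index \<open>b\<close> is no
      longer than that of index \<open>a\<close>.\<close>
    case False
    have "2 * na < a * na" using h by simp
    moreover have "2 * na' \<le> (a - 1) * na'" by (rule mult_le_mono1) (use h in linarith)
    ultimately have "u \<le> N" using False that unfolding d by linarith
    then show ?thesis using caseA A d(1) by simp
  qed
  have caseC: ?thesis if c: "a = b + 2" "u = 2 * na + (a - 1) * na' + b * nb" "0 < na'"
  proof -
    define m' where "m' = (b + 1) * na' + b * nb"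
    define w' where "w' = na' + nb"
    define l where "l = (b - 1) * nb'"
    have a: "a - 1 = b + 1" using c by simp
    have tN': "na \<le> a * na" using h by simp
    have w0': "0 < w'" using h by (simp add: w'_def)
    have bn: "nb \<le> b * nb" using h by simp
    then have wm': "w' \<le> m'" unfolding w'_def m'_def by (intro add_mono) auto
    have el: "nb' \<le> l" "nb' = 0 \<Longrightarrow> l = 0" using nb' by (auto simp: l_def)
    have n': "n = a * na + (m' + l)" using nN unfolding d m'_def l_def a by simp
    obtain sz' g' c' where s2: "strings (a * na) na m' w' l nb' n sz' g' c'"
      using ex_strings[OF h(3) tN' w0' wm' el n'] by auto
    have "strip (a * na) na = replicate_mset na a" using strip_eq[of na a 0] h by simp
    moreover have "strip m' w' = replicate_mset na' (b + 1) + replicate_mset nb b"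
      using strip_eq[of na' "b + 1" nb] h c unfolding m'_def w'_def by simp
    moreover have "strip l nb' = replicate_mset nb' (b - 1)"
    proof (cases "nb' = 0")
      case True
      then show ?thesis using s00 by (simp add: l_def)
    next
      case False
      then show ?thesis using strip_eq[of nb' "b - 1" 0] h unfolding l_def by (cases "b = 1") auto
    qed
    ultimately have P2: "P = strip (a * na) na + (strip m' w' + strip l nb')"
      using P' unfolding a by (simp add: add.assoc)
    have "x * w' < m'" if "x < b + 1" for x
    proof -
      have "x * nb \<le> b * nb" by (rule mult_le_mono1) (use that in linarith)
      moreover have "x * na' < (b + 1) * na'" by (rule mult_strict_right_mono) (use that c in linarith)+
      ultimately show ?thesis unfolding m'_def w'_def add_mult_distrib2 by linarith
    qed
    moreover have "m' \<le> (b + 1) * w'" unfolding m'_def w'_def by (simp add: add_mult_distrib2)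
    ultimately have "strings.linkable (a * na) na m' w' (b + 1)"
      unfolding strings.linkable_def[OF s2] using c(1) by simp
    moreover have "2 \<le> m'" using c(3) h by (cases na') (auto simp: m'_def)
    moreover have "u = 2 * na + m'" using c(2) unfolding a m'_def by simp
    ultimately show ?thesis by (intro gt[OF s2 P2]) auto
  qed
  show ?thesis using u
  proof (elim disjE conjE)
    assume c: "a = b + 2" "u = 2 * na + (a - 1) * na' + b * nb" "nb' = 0"
    show ?thesis
    proof (cases "na' = 0")
      \<comment> \<open>Without parts \<open>a - 1\<close> and \<open>b - 1\<close> this chain has
        the same size as the one of index \<open>b\<close>.\<close>
      case True
      then have "u = 2 * na + 2 * na' + b * nb + (b - 1) * nb'" using c by simp
      then show ?thesis by (rule caseB)
    qed (use caseC c(1,2) in blast)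
  qed (use caseA caseB caseC d(1) in auto)
qed

section \<open>Partitions of types A, B and C\<close>

lemma nat_ceiling_le_iff:
  assumes "0 < y"
  shows "nat \<lceil>x / y\<rceil> \<le> k \<longleftrightarrow> x \<le> real k * y"
proof -
  have "nat \<lceil>x / y\<rceil> \<le> k \<longleftrightarrow> x / y \<le> real k" by (simp add: nat_le_iff ceiling_le_iff)
  then show ?thesis using assms by (simp add: divide_le_eq)
qed

section \<open>Explicit form of almost rectangular partitions\<close>

text \<open>All parts are \<open>p'\<close> or \<open>p' + 1\<close>, where \<open>p' + 1\<close>
  occurs \<open>x'\<close> times. The sum is \<open>p'\<close> times the number of parts plus
  \<open>x'\<close>, with \<open>x'\<close> between 1 and the number of parts, and this determines
  \<open>p'\<close> and \<open>x'\<close>.\<close>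

lemma alm_rect_unique:
  fixes Q :: "nat multiset" and p x y :: nat
  assumes Q: "is_partition (p * (x + y) + x) Q" "size Q = x + y" "\<forall>x\<in>#Q. \<forall>y\<in>#Q. x \<le> y + 1"
    and x: "0 < x"
  shows "Q = replicate_mset x (Suc p) + replicate_mset y p"
proof -
  define m where "m = Max (set_mset Q)"
  have "Q \<noteq> {#}" using Q(2) x by auto
  then have m: "m \<in># Q" "\<forall>s\<in>#Q. s \<le> m" unfolding m_def by auto
  then have "0 < m" using Q(1) by (auto simp: is_partition_def)
  then obtain p' where p': "m = Suc p'" by (cases m) auto
  have s: "s = Suc p' \<or> s = p'" if "s \<in># Q" for s
  proof -
    have "s \<le> m" using m(2) that by blast
    moreover have "m \<le> s + 1" using Q(3) m(1) that by blast
    ultimately show ?thesis using p' by linarith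
  qed
  define x' y' where d: "x' = count Q (Suc p')" "y' = count Q p'"
  have Q': "Q = replicate_mset x' (Suc p') + replicate_mset y' p'"
  proof (rule multiset_eqI)
    fix s show "count Q s = count (replicate_mset x' (Suc p') + replicate_mset y' p') s"
    proof (cases "s \<in># Q")
      case True
      then show ?thesis using s[OF True] by (auto simp: d)
    next
      case False
      then show ?thesis by (auto simp: d not_in_iff)
    qed
  qed
  have xy: "x' + y' = x + y" using Q(2) arg_cong[OF Q', of size] by simp
  have "x' * Suc p' + y' * p' = p * (x + y) + x"
    using Q(1) arg_cong[OF Q', of sum_mset] by (simp add: is_partition_def)
  then have "p' * (x' + y') + x' = p * (x + y) + x" by (simp add: algebra_simps)
  then have e: "p' * (x + y) + x' = p * (x + y) + x" unfolding xy .
  have x'0: "0 < x'" using m(1) p' d by simp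
  have "p' = p"
  proof (rule ccontr)
    assume "p' \<noteq> p"
    then consider "Suc p' \<le> p" | "Suc p \<le> p'" by linarith
    then show False
    proof cases
      case 1
      then have "Suc p' * (x + y) \<le> p * (x + y)" by (rule mult_le_mono1)
      then show False using e xy x by simp
    next
      case 2
      then have "Suc p * (x + y) \<le> p' * (x + y)" by (rule mult_le_mono1)
      then show False using e x'0 by simp
    qed
  qed
  then show ?thesis using Q' e xy by simp
qed

lemma alm_rect_eq:
  assumes "0 < x" "p = 0 \<longrightarrow> y = 0" "n = p * (x + y) + x" "k = x + y"
  shows "alm_rect n k = replicate_mset x (Suc p) + replicate_mset y p"
  unfolding alm_rect_def assms(3,4)
proof (rule the_equality, intro conjI)
  show "is_partition (p * (x + y) + x) (replicate_mset x (Suc p) + replicate_mset y p)"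
    using assms(2) by (auto simp: is_partition_def algebra_simps)
qed (use alm_rect_unique[OF _ _ _ assms(1)] in auto)

lemma alm_rectE:
  assumes "1 \<le> k" "k \<le> n"
  obtains p x y where "0 < x" "p = 0 \<longrightarrow> y = 0" "x + y = k" "n = p * k + x"
    "alm_rect n k = replicate_mset x (Suc p) + replicate_mset y p"
proof -
  \<comment> \<open>Dividing \<open>n - 1\<close> lets \<open>x\<close> range from 1 to
    \<open>k\<close>, so the larger part size always occurs, as \<open>four_part\<close> demands of
    \<open>a\<close> and \<open>b\<close>.\<close>
  define p where "p = (n - 1) div k"
  define x where "x = (n - 1) mod k + 1"
  define y where "y = k - x"
  have x: "0 < x" "x \<le> k" using assms unfolding x_def by (auto simp: Suc_le_eq)
  have n: "n = p * k + x" using assms div_mult_mod_eq[of "n - 1" k] unfolding p_def x_def by linarith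
  have y: "x + y = k" using x by (simp add: y_def)
  have z: "p = 0 \<longrightarrow> y = 0" using n assms by (auto simp: y_def)
  show thesis using that[OF x(1) z y n] alm_rect_eq[OF x(1) z] n y by simp
qed

lemma size_alm_rect:
  assumes "1 \<le> k" "k \<le> n"
  shows "size (alm_rect n k) = k"
  by (rule alm_rectE[OF assms]) simp

lemma sum_alm_rect:
  assumes "1 \<le> k" "k \<le> n"
  shows "sum_mset (alm_rect n k) = n"
  by (rule alm_rectE[OF assms]) (auto simp: algebra_simps)

section \<open>Uniqueness of the form with four part sizes\<close>

lemma four_part_mem:
  assumes "four_part P a na na' b nb nb'" "s \<in># P"
  shows "s = a \<or> s = a - 1 \<or> s = b \<or> s = b - 1"
  using assms unfolding four_part_def by (auto split: if_splits)

lemma four_part_count: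
  assumes "four_part P a na na' b nb nb'"
  shows "na = count P a" "na' = count P (a - 1)" "nb = count P b" "nb' = count P (b - 1)"
  using assms unfolding four_part_def by auto

lemma four_part_le:
  assumes P: "four_part P a na na' b nb nb'" and Q: "four_part P a' ma ma' b' mb mb'"
  shows "a \<le> a'" "a = a' \<Longrightarrow> b \<le> b'"
proof -
  have o: "b' + 2 \<le> a'" "b + 2 \<le> a" using P Q by (auto simp: four_part_def)
  have a: "a \<in># P" and b: "b \<in># P" using P by (auto simp: four_part_def)
  show "a \<le> a'" using four_part_mem[OF Q a] o by linarith
  show "b \<le> b'" if "a = a'" using four_part_mem[OF Q b] o that by linarith
qed

text \<open>\<open>a\<close> is the largest part and \<open>b\<close> the largest part below
  \<open>a - 1\<close>; the multiplicities are then counts. Hence a type can be tested, or excluded,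
  on any one such form.\<close>

lemma four_part_unique:
  assumes P: "four_part P a na na' b nb nb'" and Q: "four_part P a' ma ma' b' mb mb'"
  shows "a' = a \<and> ma = na \<and> ma' = na' \<and> b' = b \<and> mb = nb \<and> mb' = nb'"
proof -
  have a: "a = a'" using four_part_le(1)[OF P Q] four_part_le(1)[OF Q P] by simp
  moreover have "b = b'" using four_part_le(2)[OF P Q a] four_part_le(2)[OF Q P a[symmetric]] by simp
  ultimately show ?thesis using four_part_count[OF P] four_part_count[OF Q] by simp
qed

lemma type_A_iff:
  assumes "four_part P a na na' b nb nb'"
  shows "type_A u P \<longleftrightarrow> u = a * na + (a - 1) * na'"
  unfolding type_A_def using assms four_part_unique[OF assms] by metis

lemma type_B_iff:
  assumes "four_part P a na na' b nb nb'"
  shows "type_B u P \<longleftrightarrow> u = 2 * na + 2 * na' + b * nb + (b - 1) * nb'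
    \<or> b = a - 2 \<and> nb' = 0 \<and> u = 2 * na + (a - 1) * na' + b * nb"
  unfolding type_B_def using assms four_part_unique[OF assms] by metis

lemma two_rectangles:
  fixes p x y p' x' y' :: nat
  assumes r: "0 < x" "p = 0 \<longrightarrow> y = 0" "x + y = k" "n = p * k + x"
    "alm_rect n k = replicate_mset x (Suc p) + replicate_mset y p"
    and r': "0 < x'" "p' = 0 \<longrightarrow> y' = 0" "x' + y' = l" "m = p' * l + x'"
    "alm_rect m l = replicate_mset x' (Suc p') + replicate_mset y' p'"
    and p: "p' + 2 \<le> p"
  shows "four_part (alm_rect n k + alm_rect m l) (Suc p) x y (Suc p') x' y'"
    "Suc p * x + (Suc p - 1) * y = n" "Suc p' * x' + (Suc p' - 1) * y' = m"
  using assms by (auto simp: four_part_def algebra_simps)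

text \<open>Write \<open>v = p' * l + x'\<close>. The hypothesis at \<open>p = p'\<close> says that
  \<open>(p' + 2) * k\<close> is at most \<open>r + v - x'\<close>. This forces a gap of at least 2
  between the largest parts of the pieces; if the gap is exactly 2, it says
  \<open>x' \<le> x\<close>, so the chain of index \<open>a - 1\<close> is not longer than that of
  index \<open>a\<close>. At \<open>p = 0\<close> it says \<open>2 * k \<le> r\<close>, which does
  the same for the chain of index \<open>b\<close>.\<close>

lemma generic_type_alm_rect_A:
  assumes inf: "infinite (UNIV :: 'a::field set)"
    and k: "1 \<le> k" and l: "1 \<le> l" "l \<le> v"
    and le: "\<And>p. p * l < v \<Longrightarrow> (p + 2) * k \<le> r + p * l"
  defines "P \<equiv> alm_rect (r + v) k + alm_rect v l"
  shows "type_A (r + v) P" "generic_type TYPE('a) P = {#r + v, v#}"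
    "\<exists>a na na' b nb nb'. four_part P a na na' b nb nb' \<and> k = na + na' \<and> l = nb + nb'"
proof -
  have "2 * k \<le> r" using le[of 0] l by simp
  then have k': "k \<le> r + v" by simp
  obtain p x y where r: "0 < x" "p = 0 \<longrightarrow> y = 0" "x + y = k" "r + v = p * k + x"
    "alm_rect (r + v) k = replicate_mset x (Suc p) + replicate_mset y p" using alm_rectE[OF k k'] by metis
  obtain p' x' y' where r': "0 < x'" "p' = 0 \<longrightarrow> y' = 0" "x' + y' = l" "v = p' * l + x'"
    "alm_rect v l = replicate_mset x' (Suc p') + replicate_mset y' p'" using alm_rectE[OF l] by metis
  have le': "(p' + 2) * k \<le> r + p' * l" using r'(1,4) by (intro le) simp
  then have "(p' + 2) * k < r + v" using r'(1,4) by simp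
  moreover have "r + v \<le> (p + 1) * k" using r(3,4) by simp
  ultimately have "(p' + 2) * k < (p + 1) * k" by (rule less_le_trans)
  then have "p' + 2 < p + 1" by (simp only: mult_less_cancel2)
  then have p: "p' + 2 \<le> p" by simp
  note F = two_rectangles[OF r r' p, folded P_def]
  show "\<exists>a na na' b nb nb'. four_part P a na na' b nb nb' \<and> k = na + na' \<and> l = nb + nb'"
    using F(1) r(3) r'(3) by blast
  show "type_A (r + v) P" unfolding type_A_iff[OF F(1)] F(2) ..
  have "2 * x + (Suc p - 1) * y + Suc p' * x' \<le> r + v" if "Suc p = Suc p' + 2"
  proof -
    have pp: "p = p' + 2" using that by simp
    have "x' \<le> x" using le' r'(4) r(4) unfolding pp by (simp add: algebra_simps)
    then have "Suc p' * x' \<le> Suc p' * x" by (rule mult_le_mono2)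
    moreover have "Suc p' * x + 2 * x + (Suc p - 1) * y = r + v"
      unfolding F(2)[symmetric] pp by (simp add: algebra_simps)
    ultimately show ?thesis by linarith
  qed
  moreover have "2 * x + 2 * y + Suc p' * x' + (Suc p' - 1) * y' \<le> r + v"
    using \<open>2 * k \<le> r\<close> r(3) F(3) by linarith
  moreover have "sum_mset P = r + v + v" unfolding P_def using sum_alm_rect[OF k k'] sum_alm_rect[OF l] by simp
  moreover have "Suc p * x + (Suc p - 1) * y \<le> r + v" using F(2) by simp
  ultimately have "generic_type TYPE('a) P = {#r + v, r + v + v - (r + v)#}"
    using F(2) l by (intro generic_type_four_part[OF inf F(1)]) auto
  then show "generic_type TYPE('a) P = {#r + v, v#}" by simp
qed

text \<open>The first piece has \<open>t - d\<close> parts \<open>q + 2\<close> and \<open>d\<close>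
  parts \<open>q + 1\<close>. The last inequality says that the second piece, of size
  \<open>r + v - 2 * t\<close>, falls short of \<open>w\<close> parts equal to \<open>q\<close> by
  at least \<open>d\<close>. So its parts are at most \<open>q\<close>, and if \<open>q\<close>
  occurs there are at least \<open>d\<close> parts \<open>q - 1\<close>, which keeps the chain of
  index \<open>a - 1\<close> from exceeding that of index \<open>b\<close>.\<close>

lemma generic_type_alm_rect_B1:
  fixes t q d w r v :: nat
  assumes inf: "infinite (UNIV :: 'a::field set)"
    and t: "2 * t < r" and q: "t * q = v + d" "d < t"
    and w: "1 \<le> w" "w + 2 * t \<le> r + v" "r + t * q \<le> q * w + 2 * t"
  defines "P \<equiv> alm_rect (v + 2 * t) t + alm_rect (r + v - 2 * t) w"
  shows "type_B (r + v) P" "\<not> type_A (r + v) P" "generic_type TYPE('a) P = {#r + v, v#}"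
    "\<exists>a na na' b nb nb'. four_part P a na na' b nb nb' \<and> t = na + na' \<and>
       r + v = 2 * na + 2 * na' + b * nb + (b - 1) * nb'"
proof -
  have w': "w \<le> r + v - 2 * t" using w(2) by linarith
  obtain p x y where r': "0 < x" "p = 0 \<longrightarrow> y = 0" "x + y = w" "r + v - 2 * t = p * w + x"
    "alm_rect (r + v - 2 * t) w = replicate_mset x (Suc p) + replicate_mset y p" using alm_rectE[OF w(1) w'] by metis
  have top: "alm_rect (v + 2 * t) t = replicate_mset (t - d) (Suc (Suc q)) + replicate_mset d (Suc q)"
    using q by (intro alm_rect_eq) (auto simp: algebra_simps)
  have "r + v - 2 * t \<le> q * w" using w(3) q t by simp
  then have "p * w < q * w" using r'(1,4) by linarith
  then have "p < q" by (simp only: mult_less_cancel2)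
  then have pq: "p + 2 \<le> Suc q" by simp
  have e1: "0 < t - d" "Suc q = 0 \<longrightarrow> d = 0" "t - d + d = t" "v + 2 * t = Suc q * t + (t - d)"
    using q by (auto simp: algebra_simps)
  note F = two_rectangles[OF e1 top r' pq, folded P_def]
  have UB: "2 * (t - d) + 2 * d + Suc p * x + (Suc p - 1) * y = r + v" using F(3) t q(2) by linarith
  show "type_B (r + v) P" unfolding type_B_iff[OF F(1)] UB by simp
  show "\<not> type_A (r + v) P" unfolding type_A_iff[OF F(1)] F(2) using t by simp
  show "\<exists>a na na' b nb nb'. four_part P a na na' b nb nb' \<and> t = na + na' \<and>
       r + v = 2 * na + 2 * na' + b * nb + (b - 1) * nb'"
    using F(1) UB e1(3) by metis
  have "2 * (t - d) + (Suc (Suc q) - 1) * d + Suc p * x \<le> r + v" if "Suc (Suc q) = Suc p + 2"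
  proof -
    have qp: "q = Suc p" using that by simp
    have "q * w = r + v - 2 * t + y" using r'(3,4) unfolding qp by (simp add: algebra_simps)
    then have "d \<le> y" using w(3) q t by linarith
    then have "p * d \<le> p * y" by (rule mult_le_mono2)
    moreover have "2 * (t - d) + (Suc (Suc q) - 1) * d = 2 * (t - d) + 2 * d + p * d" unfolding qp by simp
    ultimately show ?thesis using UB[unfolded diff_Suc_1] by linarith
  qed
  moreover have "sum_mset P = r + v + v"
    unfolding P_def using sum_alm_rect[OF w(1) w'] sum_alm_rect[of t "v + 2 * t"] t q(2) by simp
  moreover have "Suc (Suc q) * (t - d) + (Suc (Suc q) - 1) * d \<le> r + v" unfolding F(2) using t by simp
  moreover have "t \<le> t * q" using pq by simp
  then have "0 < v" using q by linarith
  ultimately have "generic_type TYPE('a) P = {#r + v, r + v + v - (r + v)#}"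
    using UB by (intro generic_type_four_part[OF inf F(1)]) auto
  then show "generic_type TYPE('a) P = {#r + v, v#}" by simp
qed

text \<open>With \<open>d = 0\<close> the first piece is a rectangle of \<open>t\<close> parts
  \<open>q + 2\<close>. The conditions on \<open>k\<close> put at least one part
  \<open>q + 1\<close> and more than \<open>t\<close> parts \<open>q\<close> into the second piece,
  so its larger parts take the role of \<open>a - 1\<close>: this is the second clause of type
  B.\<close>

lemma generic_type_alm_rect_B2:
  fixes t q k r :: nat
  assumes inf: "infinite (UNIV :: 'a::field set)"
    and t: "0 < t" "2 * t < r" and q: "0 < q"
    and k: "r + 1 + t * q \<le> k * (q + 1) + t" "k * q + 2 * t < r + t * q"
  defines "P \<equiv> alm_rect (t * q + 2 * t) t + alm_rect (r + t * q - 2 * t) k"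
  shows "type_B (r + t * q) P" "\<not> type_A (r + t * q) P" "generic_type TYPE('a) P = {#r + t * q, t * q#}"
    "\<exists>na' b nb. four_part P (b + 2) t na' b nb 0 \<and> 0 < na' \<and> b = q \<and>
       r + t * q = 2 * t + (b + 1) * na' + b * nb"
proof -
  define x where "x = r + t * q - 2 * t - q * k"
  define y where "y = k * (q + 1) - (r + t * q - 2 * t)"
  have x: "0 < x" "r + t * q - 2 * t = q * k + x" using k(2) by (auto simp: x_def algebra_simps)
  have y: "t < y" "r + t * q - 2 * t + y = k * (q + 1)" using k(1) t(2) unfolding y_def by linarith+
  have xy: "x + y = k" using x y by (simp add: algebra_simps)
  have bot: "alm_rect (r + t * q - 2 * t) k = replicate_mset x (Suc q) + replicate_mset y q"
    using x xy q by (intro alm_rect_eq) auto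
  have top: "alm_rect (t * q + 2 * t) t = replicate_mset t (q + 2)"
    using alm_rect_eq[of t "q + 1" 0 "t * q + 2 * t" t] t by (simp add: algebra_simps)
  have F: "four_part P (q + 2) t x q y 0" unfolding P_def bot top four_part_def using t q y by auto
  have m: "r + t * q - 2 * t = (q + 1) * x + q * y" unfolding x(2) xy[symmetric] by (simp add: algebra_simps)
  then have UC: "2 * t + (q + 1) * x + q * y = r + t * q" using t(2) by linarith
  have ty: "q * t < q * y" using y q by simp
  have UA: "(q + 2) * t + (q + 1) * x < r + t * q" unfolding add_mult_distrib[of q 2 t] using UC ty by linarith
  have UB: "2 * t + 2 * x + q * y \<le> r + t * q"
  proof -
    have "2 * x \<le> (q + 1) * x" by (rule mult_le_mono1) (use q in simp)
    then show ?thesis using UC by linarith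
  qed
  show "type_B (r + t * q) P" unfolding type_B_iff[OF F] using UC by simp
  show "\<not> type_A (r + t * q) P" unfolding type_A_iff[OF F] using UA by simp
  show "\<exists>na' b nb. four_part P (b + 2) t na' b nb 0 \<and> 0 < na' \<and> b = q \<and>
       r + t * q = 2 * t + (b + 1) * na' + b * nb"
    using F x(1) UC by metis
  have k0: "1 \<le> k" using xy x by simp
  have kn: "k \<le> r + t * q - 2 * t" using x q by (cases q) auto
  have "sum_mset P = r + t * q + t * q"
    unfolding P_def using sum_alm_rect[OF k0 kn] sum_alm_rect[of t "t * q + 2 * t"] t by simp
  then have "generic_type TYPE('a) P = {#r + t * q, r + t * q + t * q - (r + t * q)#}"
    using UA UB UC t q by (intro generic_type_four_part[OF inf F]) auto
  then show "generic_type TYPE('a) P = {#r + t * q, t * q#}" by simp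
qed

text \<open>The parts are \<open>q + 2\<close>, \<open>q + 1\<close>, \<open>q\<close>,
  \<open>q - 1\<close> with multiplicities \<open>t - d\<close>, \<open>d + x\<close>,
  \<open>y\<close>, \<open>d\<close>. The conditions on \<open>k\<close> say
  \<open>y > t - d\<close> and \<open>x > 0\<close>; the former makes the chain of index
  \<open>a\<close> strictly shorter than that of index \<open>a - 1\<close>, the latter the chain of
  index \<open>b\<close>. The second clause of type B fails because of \<open>d > 0\<close>.\<close>

lemma generic_type_alm_rect_C:
  fixes t q d k r v :: nat
  assumes inf: "infinite (UNIV :: 'a::field set)"
    and t: "2 * t < r" "t \<le> v" and q: "t * q = v + d" "d < t" "0 < d"
    and k: "r + 1 + t * q \<le> k * (q + 1) + t" "k * q + 2 * t < r + t * q"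
  defines "P \<equiv> alm_rect (v + 2 * t) t + alm_rect (r + v - 2 * t - d * (q - 1)) (k - d) + replicate_mset d (q - 1)"
  shows "type_C (r + v) P" "\<not> type_A (r + v) P" "\<not> type_B (r + v) P"
    "generic_type TYPE('a) P = {#r + v, v#}"
    "size P = k + t" "\<exists>a na na' b nb nb'. four_part P a na na' b nb nb' \<and> t = na + nb'"
proof -
  \<comment> \<open>From \<open>t \<le> v < t * q\<close> follows \<open>q \<ge> 2\<close>, so
    \<open>q - 1\<close> is a genuine part size.\<close>
  have "t * q \<noteq> 0" "t * q \<noteq> t * 1" using q t by auto
  then obtain q' where q': "q = Suc (Suc q')" by (metis One_nat_def mult_0_right not0_implies_Suc)
  have tk: "t < k"
  proof (rule ccontr)
    assume "\<not> t < k"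
    then have "k * (q + 1) \<le> t * (q + 1)" by (intro mult_le_mono1) simp
    then show False using k(1) t(1) by simp
  qed
  define j where "j = k - d"
  have j: "k = j + d" using tk q(2) by (simp add: j_def)
  define M where "M = r + v - 2 * t - d * (q - 1)"
  have dq: "d * q \<le> k * q" using j by simp
  have dq': "d * q = d * (q - 1) + d" by (simp add: q')
  have M: "M + 2 * t + d * (q - 1) = r + v" using dq dq' k(2) q(1) unfolding M_def by linarith
  define x where "x = M - q * j"
  define y where "y = (q + 1) * j - M"
  have kq: "k * q = q * j + d * q" "k * (q + 1) = (q + 1) * j + d * q + d" unfolding j by (simp_all add: algebra_simps)
  have x: "0 < x" "M = q * j + x" using k(2) M dq' kq(1) q(1) unfolding x_def by linarith+
  have y: "t < y + d" "M + y = (q + 1) * j" using k(1) M dq' kq(2) q(1,2) unfolding y_def by linarith+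
  have xy: "x + y = j" using x y by simp
  have M': "M = (q + 1) * x + q * y" unfolding x(2) xy[symmetric] by (simp add: algebra_simps)
  have mid: "alm_rect M j = replicate_mset x (Suc q) + replicate_mset y q"
    using x xy q' by (intro alm_rect_eq) auto
  have top: "alm_rect (v + 2 * t) t = replicate_mset (t - d) (Suc (Suc q)) + replicate_mset d (Suc q)"
    using q by (intro alm_rect_eq) (auto simp: algebra_simps)
  have P: "P = replicate_mset (t - d) (q + 2) + replicate_mset (d + x) (q + 1) + replicate_mset y q
      + replicate_mset d (q - 1)"
    unfolding P_def M_def[symmetric] j_def[symmetric] mid top
    by (rule multiset_eqI) simp
  have y0: "0 < y" using y q by simp
  have F: "four_part P (q + 2) (t - d) (d + x) q y d" unfolding four_part_def P using q q' y0 by auto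
  have UC: "2 * (t - d) + (q + 1) * (d + x) + q * y = r + v"
  proof -
    have "2 * (t - d) + (q + 1) * (d + x) + q * y = 2 * (t - d) + (d * (q - 1) + 2 * d) + M"
      unfolding M' q' by (simp add: algebra_simps)
    then show ?thesis using M q(2) by simp
  qed
  have "q * (t - d) < q * y" using y q q' by (intro mult_strict_left_mono) auto
  then have UA: "(q + 2) * (t - d) + (q + 1) * (d + x) < r + v"
    unfolding add_mult_distrib[of q 2 "t - d"] using UC by linarith
  have UB: "2 * (t - d) + 2 * (d + x) + q * y + (q - 1) * d < r + v"
  proof -
    have "0 < (q - 1) * x" using q' x by simp
    moreover have "(q + 1) * (d + x) = 2 * (d + x) + (q - 1) * d + (q - 1) * x" unfolding q' by (simp add: algebra_simps)
    ultimately show ?thesis using UC by linarith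
  qed
  show "type_C (r + v) P" unfolding type_C_def
  proof (intro exI conjI)
    show "r + v = 2 * (t - d) + (q + 2 - 1) * (d + x) + q * y" using UC by simp
  qed (use F q x y0 in simp_all)
  show "\<not> type_A (r + v) P" unfolding type_A_iff[OF F] using UA by simp
  show "\<not> type_B (r + v) P" unfolding type_B_iff[OF F] using UB q(3) by simp
  show "\<exists>a na na' b nb nb'. four_part P a na na' b nb nb' \<and> t = na + nb'"
    using F q(2) by (metis le_add_diff_inverse2 less_imp_le_nat)
  show "size P = k + t" unfolding P using q(2) j xy by simp
  have "sum_mset P = r + v + v"
  proof -
    \<comment> \<open>Adding \<open>d\<close> completes the parts \<open>q - 1\<close> to
      \<open>d * q\<close>, which together with \<open>q * (t - d)\<close> gives
      \<open>t * q\<close>.\<close>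
    have "sum_mset P + d = (q + 2) * (t - d) + (q + 1) * (d + x) + q * y + (q - 1) * d + d"
      unfolding P by (simp add: mult.commute)
    also have "\<dots> = q * (t - d) + (2 * (t - d) + (q + 1) * (d + x) + q * y) + d * q"
      unfolding q' by (simp add: algebra_simps)
    also have "\<dots> = t * q + (r + v)"
    proof -
      have "q * (t - d) + q * d = q * t" using q(2) by (simp flip: add_mult_distrib2)
      then show ?thesis unfolding UC by (simp add: mult.commute)
    qed
    finally show ?thesis using q(1) by simp
  qed
  then have "generic_type TYPE('a) P = {#r + v, r + v + v - (r + v)#}"
    using UA UB UC t q x by (intro generic_type_four_part[OF inf F]) auto
  then show "generic_type TYPE('a) P = {#r + v, v#}" by simp
qed

section \<open>The table\<close>

text \<open>Here and in the next lemma the difference of the two sides is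
  \<open>(r - 2 * t) * (q - 1)\<close>.\<close>

lemma mult_slack:
  fixes t r q :: nat
  assumes "2 * t < r" "1 \<le> q"
  shows "r + 2 * (t * q) \<le> r * q + 2 * t"
proof -
  obtain s where s: "r = 2 * t + s" using le_Suc_ex[OF less_imp_le[OF assms(1)]] by blast
  have "s * 1 \<le> s * q" using assms(2) by (rule mult_le_mono2)
  then show ?thesis unfolding s by (simp add: algebra_simps)
qed

lemma mult_slack_diff:
  fixes t r q :: nat
  assumes "2 * t < r" "1 \<le> q"
  shows "r + t * q \<le> (r - t) * q + 2 * t"
proof -
  obtain s where s: "r = 2 * t + s" using le_Suc_ex[OF less_imp_le[OF assms(1)]] by blast
  then have "r - t = t + s" by simp
  moreover have "s * 1 \<le> s * q" using assms(2) by (rule mult_le_mono2)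
  ultimately show ?thesis using s by (simp add: add_mult_distrib)
qed

locale table =
  fixes u r v :: nat
  assumes r: "2 \<le> r" and v: "0 < v" and u: "u = r + v"
begin

abbreviation "tm \<equiv> t_max u r"
abbreviation "q \<equiv> q_inv u r"
abbreviation "d \<equiv> d_inv u r"
abbreviation "\<kappa> \<equiv> k_inv u r"
abbreviation "\<gamma> \<equiv> c_inv u r"

lemma u_minus: "u - r = v" using u by simp

lemma k_0: "\<kappa> 0 = 1" by (simp add: k_inv_def)

lemma t_max_le: "tm \<le> v" "2 * tm < r"
  using r by (auto simp: t_max_def u_minus)

section \<open>The invariants as integer inequalities\<close>

lemma q_le_iff: "1 \<le> t \<Longrightarrow> q t \<le> k \<longleftrightarrow> v \<le> k * t"
  unfolding q_inv_def by (subst nat_ceiling_le_iff) (simp_all add: u flip: of_nat_mult)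

lemma q_bounds:
  assumes "1 \<le> t"
  shows "v \<le> q t * t" "q t * t < v + t" "1 \<le> q t"
proof -
  show "v \<le> q t * t" using q_le_iff[OF assms, of "q t"] by simp
  then show q1: "1 \<le> q t" using v by (cases "q t") auto
  have "\<not> q t \<le> q t - 1" using q1 by simp
  then have "(q t - 1) * t < v" unfolding q_le_iff[OF assms] by simp
  moreover have "q t * t = (q t - 1) * t + t" using q1 by (cases "q t") auto
  ultimately show "q t * t < v + t" by simp
qed

lemma d_eq:
  assumes "1 \<le> t"
  shows "t * q t = v + d t" "d t < t"
  using q_bounds[OF assms] by (auto simp: d_inv_def u_minus mult.commute)

text \<open>Clear the denominator and use \<open>t * q t = v + d t\<close>, which absorbs
  \<open>d t\<close>. The same works for \<open>c_inv\<close>, and the two inequalities are the ones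
  that govern the chains in the constructions.\<close>

lemma k_le_iff:
  assumes "1 \<le> t"
  shows "\<kappa> t \<le> k \<longleftrightarrow> r + 1 + t * q t \<le> k * (q t + 1) + t"
proof -
  have "\<kappa> t \<le> k \<longleftrightarrow> real u + 1 - real t + real (d t) \<le> real k * (real (q t) + 1)"
    using assms unfolding k_inv_def by (subst if_not_P, simp, subst nat_ceiling_le_iff) simp_all
  also have "\<dots> \<longleftrightarrow> real (r + 1 + (v + d t)) \<le> real (k * (q t + 1) + t)"
    unfolding u by (simp add: algebra_simps)
  finally show ?thesis unfolding of_nat_le_iff d_eq(1)[OF assms] .
qed

lemma c_le_iff:
  assumes "1 \<le> t" "0 < d t"
  shows "\<gamma> t \<le> k \<longleftrightarrow> r + t * q t \<le> k * q t + 2 * t"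
proof -
  have "\<gamma> t \<le> k \<longleftrightarrow> real u - 2 * real t + real (d t) \<le> real k * real (q t)"
    using assms q_bounds(3)[OF assms(1)] unfolding c_inv_def by (subst if_not_P, simp, subst nat_ceiling_le_iff) simp_all
  also have "\<dots> \<longleftrightarrow> real (r + (v + d t)) \<le> real (k * q t + 2 * t)"
    unfolding u by (simp add: algebra_simps)
  finally show ?thesis unfolding of_nat_le_iff d_eq(1)[OF assms(1)] .
qed

lemma k_gt:
  assumes "1 \<le> t" "2 * t < r"
  shows "t < \<kappa> t"
proof -
  have "\<not> \<kappa> t \<le> t" unfolding k_le_iff[OF assms(1)] using assms(2) by simp
  then show ?thesis by simp
qed

lemma k_le:
  assumes "1 \<le> t" "2 * t < r"
  shows "\<kappa> t \<le> r - t"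
proof -
  have e: "(r - t) * (q t + 1) + t = r * q t + r - t * q t"
  proof -
    obtain s where "r = t + s" using assms(2) less_imp_add_positive[of t r] by auto
    then show ?thesis by (simp add: algebra_simps)
  qed
  show ?thesis unfolding k_le_iff[OF assms(1)] e
    using mult_slack[OF assms(2) q_bounds(3)[OF assms(1)]] assms(2) by linarith
qed

text \<open>With \<open>k_inv u r t = t + j\<close> the defining inequality reads
  \<open>r + 1 \<le> j * (q t + 1) + 2 * t\<close>. Passing to a smaller index \<open>s\<close> only
  increases \<open>q\<close>, and the difference \<open>t - s\<close> is compensated because
  \<open>q s\<close> is at least 1.\<close>

lemma k_mono:
  assumes "s \<le> t" "t \<le> tm"
  shows "\<kappa> s \<le> \<kappa> t"
proof (cases "s = 0")
  case True
  show ?thesis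
  proof (cases "t = 0")
    case False
    then have "t < \<kappa> t" using k_gt[of t] assms(2) t_max_le by simp
    then show ?thesis using True by (simp add: k_inv_def)
  qed (use assms True in simp)
next
  case False
  then have s: "1 \<le> s" and t: "1 \<le> t" using assms by auto
  have "t < \<kappa> t" using k_gt[OF t] assms(2) t_max_le by simp
  then obtain j where j: "\<kappa> t = t + j" using le_Suc_ex[OF less_imp_le] by blast
  obtain i where i: "t = s + i" using le_Suc_ex[OF assms(1)] by blast
  have "v \<le> q s * s" by (rule q_bounds(1)[OF s])
  also have "\<dots> \<le> q s * t" by (rule mult_le_mono2[OF assms(1)])
  finally have qq: "q t \<le> q s" unfolding q_le_iff[OF t] .
  have "r + 1 + t * q t \<le> \<kappa> t * (q t + 1) + t" using k_le_iff[OF t] by blast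
  then have 1: "r + 1 \<le> j * q t + j + 2 * t" unfolding j by (simp add: algebra_simps)
  have 2: "j * q t \<le> j * q s" by (rule mult_le_mono2[OF qq])
  have 3: "i * 1 \<le> i * q s" by (rule mult_le_mono2[OF q_bounds(3)[OF s]])
  have 4: "t * q s = s * q s + i * q s" unfolding i by (rule add_mult_distrib)
  have "r + 1 + s * q s \<le> \<kappa> t * (q s + 1) + s"
    unfolding j add_mult_distrib add_mult_distrib2 using 1 2 3 4 i by linarith
  then show ?thesis unfolding k_le_iff[OF s] .
qed

text \<open>For \<open>k > t\<close> the inequality of \<open>c_inv\<close> implies that of
  \<open>k_inv\<close>, by adding \<open>t + 1 \<le> k\<close>. At \<open>k = r - t\<close> it holds
  by \<open>mult_slack_diff\<close>.\<close>

lemma c_bounds: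
  assumes "1 \<le> t" "2 * t < r"
  shows "\<kappa> t \<le> \<gamma> t" "\<gamma> t \<le> r - t"
proof -
  have "\<kappa> t \<le> \<gamma> t \<and> \<gamma> t \<le> r - t"
  proof (cases "d t = 0")
    case True
    then show ?thesis using k_le[OF assms] by (simp add: c_inv_def)
  next
    case False
    then have d: "0 < d t" by simp
    have "\<not> \<gamma> t \<le> t" unfolding c_le_iff[OF assms(1) d] using assms(2) by simp
    moreover have "r + t * q t \<le> \<gamma> t * q t + 2 * t" using c_le_iff[OF assms(1) d] by blast
    ultimately have "r + 1 + t * q t \<le> \<gamma> t * (q t + 1) + t" by (simp add: algebra_simps)
    moreover have "r + t * q t \<le> (r - t) * q t + 2 * t"
      by (rule mult_slack_diff[OF assms(2) q_bounds(3)[OF assms(1)]])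
    ultimately show ?thesis unfolding k_le_iff[OF assms(1)] c_le_iff[OF assms(1) d] ..
  qed
  then show "\<kappa> t \<le> \<gamma> t" "\<gamma> t \<le> r - t" by auto
qed

text \<open>If \<open>tm < v\<close>, the other bound in \<open>t_max\<close> is attained, so
  \<open>r \<le> 2 * tm + 2\<close>; for positive \<open>tm\<close> moreover
  \<open>q tm \<ge> 2\<close>. This makes \<open>k_inv\<close> as small as \<open>k_gt\<close>
  permits.\<close>

lemma k_tm:
  assumes "tm < v"
  shows "\<kappa> tm = tm + 1" "tm = (r - 1) div 2"
proof -
  show tm: "tm = (r - 1) div 2" using assms by (auto simp: t_max_def u_minus)
  show "\<kappa> tm = tm + 1"
  proof (cases "tm = 0")
    case True
    then show ?thesis by (simp add: k_inv_def)
  next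
    case False
    then have t: "1 \<le> tm" by simp
    have "\<not> q tm \<le> 1" unfolding q_le_iff[OF t] using assms by simp
    moreover have "r \<le> 2 * tm + 2" using tm by linarith
    ultimately have "\<kappa> tm \<le> tm + 1" unfolding k_le_iff[OF t] by (simp add: algebra_simps)
    then show ?thesis using k_gt[OF t t_max_le(2)] by simp
  qed
qed

text \<open>Nonemptiness means \<open>tm < v\<close> and, by \<open>k_tm\<close>,
  \<open>tm + 1 = r - (tm + 1)\<close>.\<close>

lemma A_T_nonempty_iff: "A_set u r (T_idx u r) \<noteq> {} \<longleftrightarrow> even r \<and> 3 * r \<le> 2 * u"
proof -
  have ne: "A_set u r (T_idx u r) \<noteq> {} \<longleftrightarrow> \<kappa> tm = r - (tm + 1) \<and> tm + 1 \<le> v"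
    by (auto simp: A_set_def T_idx_def u_minus)
  show ?thesis
  proof
    assume "A_set u r (T_idx u r) \<noteq> {}"
    then have "\<kappa> tm = r - (tm + 1)" "tm < v" unfolding ne by auto
    then have "r = 2 * (tm + 1)" "tm < v" using k_tm(1) t_max_le(2) by auto
    moreover have "3 * r \<le> 2 * u" if "r = 2 * (x + 1)" "x < v" for x unfolding u using that by simp
    ultimately show "even r \<and> 3 * r \<le> 2 * u" by (metis dvd_triv_left)
  next
    assume a: "even r \<and> 3 * r \<le> 2 * u"
    then obtain h where h: "r = 2 * h" by blast
    then have hv: "h \<le> v" "1 \<le> h" using a r unfolding u by auto
    have "(r - 1) div 2 = h - 1" using h hv(2) by presburger
    then have "tm = h - 1" "tm < v" using hv by (auto simp: t_max_def u_minus)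
    then show "A_set u r (T_idx u r) \<noteq> {}" unfolding ne using k_tm(1) h hv(2) by simp
  qed
qed

lemma A_T_values:
  assumes "A_set u r (T_idx u r) \<noteq> {}"
  shows "\<kappa> tm = T_idx u r" "r = 2 * T_idx u r"
proof -
  have "\<kappa> tm = r - (tm + 1)" "tm < v" using assms by (auto simp: A_set_def T_idx_def u_minus)
  then show "\<kappa> tm = T_idx u r" "r = 2 * T_idx u r" using k_tm(1) t_max_le(2) by (auto simp: T_idx_def)
qed

text \<open>With \<open>k = t + j\<close>, lying below \<open>k_inv u r t\<close> means
  \<open>j * (q t + 1) + 2 * t \<le> r\<close>. The relevant \<open>p\<close> satisfy
  \<open>p + 1 \<le> q t\<close>, so the last claim holds with \<open>t\<close> in place of
  \<open>l\<close>, and \<open>t \<le> l\<close>. For the last index it reduces to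
  \<open>r = 2 * k\<close> and \<open>k \<le> l\<close>.\<close>

lemma A_setD:
  assumes t: "t \<in> {1..T_idx u r}" and kl: "(k, l) \<in> A_set u r t"
  shows "1 \<le> k" "1 \<le> l" "l \<le> v" "\<And>p. p * l < v \<Longrightarrow> (p + 2) * k \<le> r + p * l"
proof -
  show l: "1 \<le> l" "l \<le> v" using t kl by (auto simp: A_set_def u_minus split: if_splits)
  show "1 \<le> k"
  proof (cases "t \<le> tm")
    case True
    then have "\<kappa> (t - 1) \<le> k" using kl by (simp add: A_set_def)
    moreover have "\<kappa> 0 \<le> \<kappa> (t - 1)" by (rule k_mono) (use True in auto)
    ultimately show ?thesis using k_0 by linarith
  next
    case False
    then have "t = T_idx u r" using t by (simp add: T_idx_def)
    then have "A_set u r (T_idx u r) \<noteq> {}" using kl by blast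
    then have "\<kappa> tm = tm + 1" using A_T_values(1) by (simp add: T_idx_def)
    then show ?thesis using kl False by (simp add: A_set_def)
  qed
  fix p assume p: "p * l < v"
  show "(p + 2) * k \<le> r + p * l"
  proof (cases "t \<le> tm")
    case False
    then have t': "t = T_idx u r" using t by (simp add: T_idx_def)
    then have "A_set u r (T_idx u r) \<noteq> {}" using kl by blast
    note A = A_T_values[OF this]
    have "k = \<kappa> tm" "t \<le> l" using False kl by (auto simp: A_set_def)
    then have "r = 2 * k" "k \<le> l" using A t' by simp_all
    then show ?thesis using mult_le_mono2[of k l p] by (simp add: algebra_simps)
  next
    case True
    then have k: "k < \<kappa> t" and tl: "t \<le> l" using kl by (auto simp: A_set_def)
    have t1: "1 \<le> t" using t by simp
    have tr: "2 * t < r" using True t_max_le(2) by simp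
    have "\<not> \<kappa> t \<le> k" using k by simp
    then have K: "k * (q t + 1) + t \<le> r + t * q t" unfolding k_le_iff[OF t1] by simp
    have "v \<le> q t * l" using q_bounds(1)[OF t1] mult_le_mono2[OF tl, of "q t"] by linarith
    then have "p * l < q t * l" using p by linarith
    then have "p < q t" by (simp only: mult_less_cancel2)
    then have pq: "p + 1 \<le> q t" by simp
    have "(p + 2) * k \<le> r + p * t"
    proof (cases "k \<le> t")
      case True
      then show ?thesis unfolding add_mult_distrib using mult_le_mono2[OF True, of p] tr by linarith
    next
      case False
      then have "t \<le> k" by simp
      then obtain j where j: "k = t + j" using le_Suc_ex by blast
      have "(p + 2) * j \<le> (q t + 1) * j" by (rule mult_le_mono1) (use pq in simp)
      then show ?thesis using K unfolding j by (simp add: algebra_simps)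
    qed
    also have "\<dots> \<le> r + p * l" using tl by simp
    finally show ?thesis .
  qed
qed

text \<open>The last claim sorts positions by the construction that applies. The arm
  \<open>k = r - t\<close>, and for \<open>d t > 0\<close> also the arm \<open>l = t\<close>, fall
  under the first; for \<open>d t = 0\<close> the arm \<open>l = t\<close> begins already at
  \<open>k_inv\<close>, and its initial positions may require the second.\<close>

lemma B_setD:
  assumes t: "t \<in> {1..tm}" and kl: "(k, l) \<in> B_set u r t"
  shows "1 \<le> t" "t \<le> v" "2 * t < r" "t < k" "k \<le> r - t" "t \<le> l" "l \<le> v" "k = r - t \<or> l = t"
    "r + t * q t \<le> q t * (k + l - t) + 2 * t \<or>
     l = t \<and> d t = 0 \<and> r + 1 + t * q t \<le> k * (q t + 1) + t \<and> k * q t + 2 * t < r + t * q t"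
proof -
  show t1: "1 \<le> t" using t by simp
  show t2: "t \<le> v" "2 * t < r" using t t_max_le by auto
  note C = c_bounds[OF t1 t2(2)]
  have K: "t < \<kappa> t" by (rule k_gt[OF t1 t2(2)])
  show k: "k \<le> r - t" and tk: "t < k" and l: "t \<le> l" "l \<le> v" and kl': "k = r - t \<or> l = t"
    using kl C K t2 by (auto simp: B_set_def u_minus)
  have full: "r + t * q t \<le> q t * (k + l - t) + 2 * t" if "k = r - t"
  proof -
    have "q t * (r - t) \<le> q t * (k + l - t)" by (rule mult_le_mono2) (use that l(1) in simp)
    moreover have "r + t * q t \<le> q t * (r - t) + 2 * t"
      using mult_slack_diff[OF t2(2) q_bounds(3)[OF t1]] by (simp only: mult.commute[of "q t"])
    ultimately show ?thesis by linarith
  qed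
  show "r + t * q t \<le> q t * (k + l - t) + 2 * t \<or>
     l = t \<and> d t = 0 \<and> r + 1 + t * q t \<le> k * (q t + 1) + t \<and> k * q t + 2 * t < r + t * q t"
  proof (cases "k = r - t")
    case True
    then show ?thesis using full by blast
  next
    case False
    then have l: "l = t" and c: "\<gamma> t \<le> k" using kl kl' by (auto simp: B_set_def)
    have "\<kappa> t \<le> k" using C(1) c by simp
    then have 1: "r + 1 + t * q t \<le> k * (q t + 1) + t" unfolding k_le_iff[OF t1] .
    show ?thesis
    proof (cases "0 < d t")
      case True
      then show ?thesis using c l unfolding c_le_iff[OF t1 True] by (simp add: mult.commute)
    next
      case False
      then show ?thesis using l 1 by (auto simp: mult.commute not_le)
    qed
  qed
qed

lemma C_setD:
  assumes t: "t \<in> {1..tm}" and kl: "(k, l) \<in> C_set u r t"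
  shows "1 \<le> t" "t \<le> v" "2 * t < r" "l = t" "0 < d t"
    "r + 1 + t * q t \<le> k * (q t + 1) + t" "k * q t + 2 * t < r + t * q t" "\<kappa> t \<le> k" "k < \<gamma> t" "k < r - t"
proof -
  show t1: "1 \<le> t" using t by simp
  show t2: "t \<le> v" "2 * t < r" using t t_max_le by auto
  show l: "l = t" and k: "\<kappa> t \<le> k" "k < \<gamma> t" using kl by (auto simp: C_set_def)
  show d: "0 < d t" using k by (auto simp: c_inv_def split: if_splits)
  show "r + 1 + t * q t \<le> k * (q t + 1) + t" using k(1) unfolding k_le_iff[OF t1] .
  have "\<not> \<gamma> t \<le> k" using k(2) by simp
  then show "k * q t + 2 * t < r + t * q t" unfolding c_le_iff[OF t1 d] by simp
  show "k < r - t" using c_bounds(2)[OF t1 t2(2)] k(2) by simp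
qed

section \<open>The partitions placed at the positions\<close>

lemma A_part_props:
  assumes inf: "infinite (UNIV :: 'a::field set)" and t: "t \<in> {1..T_idx u r}" and kl: "(k, l) \<in> A_set u r t"
  defines "P \<equiv> A_part u r k l"
  shows "type_A u P" "generic_type TYPE('a) P = {#u, v#}" "size P = k + l"
    "\<exists>a na na' b nb nb'. four_part P a na na' b nb nb' \<and> k = na + na' \<and> l = nb + nb'"
proof -
  note D = A_setD[OF t kl]
  note g = generic_type_alm_rect_A[OF inf D]
  have P: "P = alm_rect (r + v) k + alm_rect v l" unfolding P_def A_part_def u by simp
  show "type_A u P" "generic_type TYPE('a) P = {#u, v#}"
    "\<exists>a na na' b nb nb'. four_part P a na na' b nb nb' \<and> k = na + na' \<and> l = nb + nb'"
    using g unfolding P u by auto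
  have "k \<le> r + v" using D(4)[of 0] v by simp
  then show "size P = k + l" using D unfolding P by (simp add: size_alm_rect)
qed

text \<open>The final claim records how \<open>t\<close> is recovered from the multiplicities under
  each clause of type B. The rider for \<open>b = 1\<close> comes from \<open>t * q t = v\<close>
  and separates the clauses when both apply.\<close>

lemma B_part_props:
  assumes inf: "infinite (UNIV :: 'a::field set)" and t: "t \<in> {1..tm}" and kl: "(k, l) \<in> B_set u r t"
  defines "P \<equiv> B_part u r t k l"
  shows "type_B u P" "\<not> type_A u P" "generic_type TYPE('a) P = {#u, v#}" "size P = k + l"
    "\<exists>a na na' b nb nb'. four_part P a na na' b nb nb' \<and>
       (t = na + na' \<and> u = 2 * na + 2 * na' + b * nb + (b - 1) * nb' \<or>
        t = na \<and> 0 < na' \<and> nb' = 0 \<and> a = b + 2 \<and> u = 2 * na + (a - 1) * na' + b * nb \<and> (b = 1 \<longrightarrow> t = v))"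
proof -
  note D = B_setD[OF t kl]
  define w where "w = k + l - t"
  have w: "1 \<le> w" using D(4) unfolding w_def by simp
  have w': "w + 2 * t \<le> r + v" using D(3,5,6,7) unfolding w_def by simp
  have P: "P = alm_rect (v + 2 * t) t + alm_rect (r + v - 2 * t) w"
    unfolding P_def B_part_def w_def u by simp
  have "size (alm_rect (v + 2 * t) t) = t" using D(1) by (intro size_alm_rect) auto
  moreover have "size (alm_rect (r + v - 2 * t) w) = w" using w w' by (intro size_alm_rect) auto
  moreover have "t + w = k + l" using D(6) by (simp add: w_def)
  ultimately show "size P = k + l" unfolding P by simp
  have "type_B u P \<and> \<not> type_A u P \<and> generic_type TYPE('a) P = {#u, v#} \<and> (\<exists>a na na' b nb nb'. four_part P a na na' b nb nb' \<and>
       (t = na + na' \<and> u = 2 * na + 2 * na' + b * nb + (b - 1) * nb' \<or>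
        t = na \<and> 0 < na' \<and> nb' = 0 \<and> a = b + 2 \<and> u = 2 * na + (a - 1) * na' + b * nb \<and> (b = 1 \<longrightarrow> t = v)))"
    using D(9)
  proof
    assume le: "r + t * q t \<le> q t * (k + l - t) + 2 * t"
    show ?thesis
      using generic_type_alm_rect_B1[OF inf D(3) d_eq[OF D(1)] w w' le[folded w_def]] unfolding P u by blast
  next
    assume c: "l = t \<and> d t = 0 \<and> r + 1 + t * q t \<le> k * (q t + 1) + t \<and> k * q t + 2 * t < r + t * q t"
    then have tq: "t * q t = v" and wk: "w = k" using d_eq[OF D(1)] by (auto simp: w_def)
    have "0 < t" "0 < q t" using D(1) q_bounds(3)[OF D(1)] by auto
    note g = generic_type_alm_rect_B2[OF inf this(1) D(3) this(2), of k, unfolded tq, folded P[unfolded wk] u]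
    have c': "r + 1 + v \<le> k * (q t + 1) + t" "k * q t + 2 * t < r + v" using c unfolding tq by auto
    obtain na' b nb where F: "four_part P (b + 2) t na' b nb 0" "0 < na'" "b = q t"
        "u = 2 * t + (b + 1) * na' + b * nb"
      using g(4) c' unfolding u by blast
    have "b = 1 \<longrightarrow> t = v" unfolding F(3) using tq by auto
    moreover have "u = 2 * t + (b + 2 - 1) * na' + b * nb" using F(4) by simp
    ultimately show ?thesis using g(1-3) c' F(1,2) unfolding u by blast
  qed
  then show "type_B u P" "\<not> type_A u P" "generic_type TYPE('a) P = {#u, v#}"
    "\<exists>a na na' b nb nb'. four_part P a na na' b nb nb' \<and>
       (t = na + na' \<and> u = 2 * na + 2 * na' + b * nb + (b - 1) * nb' \<or>
        t = na \<and> 0 < na' \<and> nb' = 0 \<and> a = b + 2 \<and> u = 2 * na + (a - 1) * na' + b * nb \<and> (b = 1 \<longrightarrow> t = v))"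
    by blast+
qed

lemma C_part_props:
  assumes inf: "infinite (UNIV :: 'a::field set)" and t: "t \<in> {1..tm}" and kl: "(k, l) \<in> C_set u r t"
  defines "P \<equiv> C_part u r t k"
  shows "type_C u P" "\<not> type_A u P" "\<not> type_B u P" "generic_type TYPE('a) P = {#u, v#}" "size P = k + l"
    "\<exists>a na na' b nb nb'. four_part P a na na' b nb nb' \<and> t = na + nb'"
proof -
  note D = C_setD[OF t kl]
  have P: "P = alm_rect (v + 2 * t) t + alm_rect (r + v - 2 * t - d t * (q t - 1)) (k - d t)
      + replicate_mset (d t) (q t - 1)"
    unfolding P_def C_part_def u by simp
  note g = generic_type_alm_rect_C[OF inf D(3,2) d_eq[OF D(1)] D(5-7)]
  show "type_C u P" "\<not> type_A u P" "\<not> type_B u P" "generic_type TYPE('a) P = {#u, v#}" "size P = k + l"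
    "\<exists>a na na' b nb nb'. four_part P a na na' b nb nb' \<and> t = na + nb'"
    using g unfolding P D(4) u by blast+
qed

end

context table
begin

text \<open>A position \<open>(k, l)\<close> outside the sets \<open>A_set u r t\<close> lies on the hook with corner
  \<open>(r - t, t)\<close>, and this hook is the one with \<open>t = min l (r - k)\<close>.\<close>

definition hook :: "nat \<Rightarrow> nat \<Rightarrow> nat" where
  "hook k l = min l (r - k)"

lemma hook_B:
  assumes "t \<in> {1..tm}" "(k, l) \<in> B_set u r t"
  shows "t = hook k l"
  using B_setD(3-8)[OF assms] unfolding hook_def by linarith

lemma hook_C:
  assumes "t \<in> {1..tm}" "(k, l) \<in> C_set u r t"
  shows "t = hook k l"
  using C_setD(3,4,10)[OF assms] unfolding hook_def by linarith

lemma not_B_and_C: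
  assumes "t \<in> {1..tm}" "(k, l) \<in> B_set u r t"
  shows "(k, l) \<notin> C_set u r t"
proof
  assume C: "(k, l) \<in> C_set u r t"
  from C_setD(4,9,10)[OF assms(1) C] assms(2) show False by (auto simp: B_set_def)
qed

section \<open>The sets partition the rectangle of positions\<close>

text \<open>A position of index \<open>t\<close> of kind B or C has
  \<open>k_inv u r t \<le> k\<close>, whereas kind A with index \<open>s \<le> tm\<close> has
  \<open>k < k_inv u r s\<close>; monotonicity excludes \<open>s \<le> t\<close>. If
  \<open>t < s \<le> l\<close>, the position is on the arm \<open>k = r - t\<close>, which lies
  beyond \<open>r - s\<close> and hence beyond \<open>k_inv u r s\<close>.\<close>

lemma A_disjoint_hook:
  assumes s: "s \<in> {1..T_idx u r}" "(k, l) \<in> A_set u r s"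
    and t: "t \<in> {1..tm}" "(k, l) \<in> B_set u r t \<union> C_set u r t"
  shows False
proof -
  have t': "1 \<le> t" "2 * t < r" using t(1) t_max_le by auto
  have kt: "\<kappa> t \<le> k \<and> t \<le> l \<and> (l = t \<or> k = r - t)"
    using t(2) B_setD(6,8)[OF t(1)] C_setD(4,8)[OF t(1)] c_bounds[OF t'] k_le[OF t']
    by (fastforce simp: B_set_def)
  show False
  proof (cases "s \<le> tm")
    case True
    have A: "k < \<kappa> s" "s \<le> l" using s(2) True by (auto simp: A_set_def)
    have s': "1 \<le> s" "2 * s < r" using s(1) True t_max_le by auto
    consider "s \<le> t" | "t < s" by linarith
    then show False
    proof cases
      case 1
      then have "\<kappa> s \<le> \<kappa> t" using t(1) by (intro k_mono) auto
      then show False using A kt by simp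
    next
      case 2
      then have "k = r - t" using kt A(2) by auto
      then show False using A(1) k_le[OF s'] 2 by simp
    qed
  next
    case False
    then have "k = r - s" "s \<le> l" "s = T_idx u r" using s by (auto simp: A_set_def T_idx_def)
    then show False using kt t t' by (auto simp: T_idx_def)
  qed
qed

text \<open>By monotonicity of \<open>k_inv\<close> the ranges of \<open>k\<close> for the indices
  up to \<open>tm\<close> are consecutive intervals, and the last index starts where they
  end.\<close>

lemma A_unique:
  assumes s: "s \<in> {1..T_idx u r}" "(k, l) \<in> A_set u r s"
    and t: "t \<in> {1..T_idx u r}" "(k, l) \<in> A_set u r t"
  shows "s = t"
proof -
  have *: False if "s \<in> {1..T_idx u r}" "(k, l) \<in> A_set u r s" "(k, l) \<in> A_set u r t" "t \<le> T_idx u r" "s < t" for s t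
  proof -
    have s: "s \<le> t - 1" "t - 1 \<le> tm" "s \<le> tm" using that(4,5) by (auto simp: T_idx_def)
    then have "k < \<kappa> s" using that(2) by (simp add: A_set_def)
    moreover have "\<kappa> s \<le> \<kappa> (t - 1)" by (rule k_mono) (use s in auto)
    moreover have "\<kappa> (t - 1) \<le> k"
    proof (cases "t \<le> tm")
      case False
      then have "t - 1 = tm" using s by simp
      then show ?thesis using that(3) False by (simp add: A_set_def)
    qed (use that(3) in \<open>simp add: A_set_def\<close>)
    ultimately show False by simp
  qed
  show ?thesis
  proof (rule ccontr)
    assume "s \<noteq> t"
    then consider "s < t" | "t < s" by linarith
    then show False by cases (use * s t in auto)
  qed
qed

lemma cover:
  assumes k: "k \<in> {1..r - 1}" and l: "l \<in> {1..v}"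
  obtains t where "t \<in> {1..T_idx u r}" "(k, l) \<in> A_set u r t"
  | t where "t \<in> {1..tm}" "(k, l) \<in> B_set u r t"
  | t where "t \<in> {1..tm}" "(k, l) \<in> C_set u r t"
proof -
  \<comment> \<open>Only rows up to \<open>tm\<close> are corners of hooks, hence the cap.\<close>
  define L where "L = min l tm"
  have L: "L \<le> l" "L \<le> tm" "L = l \<or> L = tm" by (auto simp: L_def)
  show thesis
  proof (cases "k < \<kappa> L")
    case True
    define s where "s = (LEAST s. k < \<kappa> s)"
    have s: "k < \<kappa> s" "s \<le> L" unfolding s_def using True by (auto intro: LeastI Least_le)
    have "s \<noteq> 0" using s(1) k k_0 by (cases "s = 0") auto
    then have "\<not> k < \<kappa> (s - 1)" unfolding s_def by (intro not_less_Least) simp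
    then have "(k, l) \<in> A_set u r s" using s L l by (simp add: A_set_def u_minus)
    then show thesis using that(1)[of s] s L \<open>s \<noteq> 0\<close> by (simp add: T_idx_def)
  next
    case False
    then have kL: "\<kappa> L \<le> k" by simp
    show thesis
    proof (cases "r - L < k")
      case True
      \<comment> \<open>The position is on the arm of constant \<open>k\<close>, beyond the corner
        of its hook.\<close>
      define t where "t = r - k"
      have t: "t \<in> {1..tm}" "k = r - t" "t < l" using True k L t_max_le unfolding t_def by auto
      then have "(k, l) \<in> B_set u r t" using l by (auto simp: B_set_def u_minus)
      then show thesis using that(2) t(1) by blast
    next
      case kr: False
      show thesis
      proof (cases "l \<le> tm")
        case True
        then have l': "L = l" "l \<in> {1..tm}" using l by (auto simp: L_def)
        show thesis
        proof (cases "k < \<gamma> l")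
          case True
          then have "(k, l) \<in> C_set u r l" using kL l' by (simp add: C_set_def)
          then show thesis using that(3) l' by blast
        next
          case False
          then have "(k, l) \<in> B_set u r l" using kr l' by (simp add: B_set_def)
          then show thesis using that(2) l' by blast
        qed
      next
        case False
        then have l': "L = tm" "tm < l" by (auto simp: L_def)
        then have "tm < v" using l by simp
        note K = k_tm[OF this]
        \<comment> \<open>Since \<open>r \<le> 2 * tm + 2\<close>, at most two values lie between
          \<open>tm + 1\<close> and \<open>r - tm\<close>; the smaller one, if different, is the
          column of the last set of kind A.\<close>
        consider "k = r - tm" | "k = \<kappa> tm" "k = r - (tm + 1)"
        proof -
          have "\<kappa> tm \<le> k" "k \<le> r - tm" using kL kr unfolding l'(1) by auto
          moreover have "r \<le> 2 * tm + 2" using K(2) by linarith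
          ultimately have "k = r - tm \<or> k = \<kappa> tm \<and> k = r - (tm + 1)" unfolding K(1) by linarith
          then show thesis using that by blast
        qed
        then show thesis
        proof cases
          case 1
          then have "tm \<in> {1..tm}" using k by auto
          moreover have "(k, l) \<in> B_set u r tm" using 1 l l' by (simp add: B_set_def u_minus)
          ultimately show thesis using that(2) by blast
        next
          case 2
          then have "(k, l) \<in> A_set u r (T_idx u r)" using l l' by (simp add: A_set_def T_idx_def u_minus)
          moreover have "T_idx u r \<in> {1..T_idx u r}" by (simp add: T_idx_def)
          ultimately show thesis using that(1) by blast
        qed
      qed
    qed
  qed
qed

section \<open>The filled table and the distinctness of its entries\<close>

text \<open>A set of kind B or C that contains \<open>(k, l)\<close> has index
  \<open>hook k l\<close>, so only this index is tested. All remaining positions default to kind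
  A.\<close>

definition cell :: "nat \<Rightarrow> nat \<Rightarrow> nat multiset" where
  "cell k l = (let t = hook k l in
     if t \<in> {1..tm} \<and> (k, l) \<in> B_set u r t then B_part u r t k l
     else if t \<in> {1..tm} \<and> (k, l) \<in> C_set u r t then C_part u r t k
     else A_part u r k l)"

lemma cell_B: "t \<in> {1..tm} \<Longrightarrow> (k, l) \<in> B_set u r t \<Longrightarrow> cell k l = B_part u r t k l"
  using hook_B[of t k l] by (simp add: cell_def)

lemma cell_C: "t \<in> {1..tm} \<Longrightarrow> (k, l) \<in> C_set u r t \<Longrightarrow> cell k l = C_part u r t k"
  using hook_C[of t k l] not_B_and_C[of t k l] by (auto simp: cell_def Let_def)

lemma cell_A: "t \<in> {1..T_idx u r} \<Longrightarrow> (k, l) \<in> A_set u r t \<Longrightarrow> cell k l = A_part u r k l"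
  using A_disjoint_hook[of t k l "hook k l"] by (auto simp: cell_def Let_def)

lemma cell_props:
  assumes inf: "infinite (UNIV :: 'a::field set)" and k: "k \<in> {1..r - 1}" and l: "l \<in> {1..v}"
  shows "generic_type TYPE('a) (cell k l) = {#u, v#}" "size (cell k l) = k + l"
proof -
  have "generic_type TYPE('a) (cell k l) = {#u, v#} \<and> size (cell k l) = k + l"
    by (rule cover[OF k l])
      (simp_all add: cell_A cell_B cell_C A_part_props(2,3)[OF inf] B_part_props(3,4)[OF inf] C_part_props(4,5)[OF inf])
  then show "generic_type TYPE('a) (cell k l) = {#u, v#}" "size (cell k l) = k + l" by auto
qed

text \<open>A total of 1 says both that only one kind of set contains the position and that it does
  so for a single index.\<close>

lemma card_indices:
  assumes k: "k \<in> {1..r - 1}" and l: "l \<in> {1..v}"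
  shows "card {t \<in> {1..T_idx u r}. (k, l) \<in> A_set u r t} + card {t \<in> {1..tm}. (k, l) \<in> B_set u r t}
    + card {t \<in> {1..tm}. (k, l) \<in> C_set u r t} = 1" (is "card ?A + card ?B + card ?C = 1")
proof (rule cover[OF k l])
  fix t assume t: "t \<in> {1..T_idx u r}" "(k, l) \<in> A_set u r t"
  have "?A = {t}" using t A_unique by blast
  moreover have "?B = {}" "?C = {}" using A_disjoint_hook[OF t] by blast+
  ultimately show ?thesis by simp
next
  fix t assume t: "t \<in> {1..tm}" "(k, l) \<in> B_set u r t"
  have "?B = {t}" using t hook_B by blast
  moreover have "?A = {}" using A_disjoint_hook t by blast
  moreover have "?C = {}" using hook_B[OF t] hook_C not_B_and_C[OF t] by blast
  ultimately show ?thesis by simp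
next
  fix t assume t: "t \<in> {1..tm}" "(k, l) \<in> C_set u r t"
  have "?C = {t}" using t hook_C by blast
  moreover have "?A = {}" using A_disjoint_hook t by blast
  moreover have "?B = {}" using hook_C[OF t] hook_B not_B_and_C t(2) by blast
  ultimately show ?thesis by simp
qed

text \<open>If both partitions satisfy the same clause, \<open>t\<close> is the same function of the
  multiplicities. If they satisfy different ones, \<open>(b + 1) * na' = 2 * na'\<close> with
  \<open>na' > 0\<close> forces \<open>b = 1\<close>; then one index is \<open>na = v\<close> and
  the other \<open>na + na' > v\<close>, which is impossible. Given \<open>t\<close>, the number of
  parts \<open>k + l\<close> fixes the place on the hook.\<close>

lemma B_part_inj:
  assumes inf: "infinite (UNIV :: 'a::field set)"
    and t: "t \<in> {1..tm}" "(k, l) \<in> B_set u r t" and t': "t' \<in> {1..tm}" "(k', l') \<in> B_set u r t'"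
    and eq: "B_part u r t k l = B_part u r t' k' l'"
  shows "(k, l) = (k', l')"
proof -
  let ?P = "B_part u r t k l"
  note p = B_part_props[OF inf t] and p' = B_part_props[OF inf t', folded eq]
  obtain a na na' b nb nb' where F: "four_part ?P a na na' b nb nb'"
    and c: "t = na + na' \<and> u = 2 * na + 2 * na' + b * nb + (b - 1) * nb' \<or>
        t = na \<and> 0 < na' \<and> nb' = 0 \<and> a = b + 2 \<and> u = 2 * na + (a - 1) * na' + b * nb \<and> (b = 1 \<longrightarrow> t = v)"
    using p(5) by blast
  have c': "t' = na + na' \<and> u = 2 * na + 2 * na' + b * nb + (b - 1) * nb' \<or>
        t' = na \<and> 0 < na' \<and> nb' = 0 \<and> a = b + 2 \<and> u = 2 * na + (a - 1) * na' + b * nb \<and> (b = 1 \<longrightarrow> t' = v)"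
    using p'(5) four_part_unique[OF F] by blast
  have mixed: False
    if "t1 = na + na'" "t2 = na" "0 < na'" "nb' = 0" "a = b + 2" "b = 1 \<longrightarrow> t2 = v" "t1 \<le> v"
      "u = 2 * na + 2 * na' + b * nb + (b - 1) * nb'" "u = 2 * na + (a - 1) * na' + b * nb" for t1 t2
  proof -
    have "(b + 1) * na' = 2 * na'" using that(4,5,8,9) by simp
    then have "b = 1" using that(3) by simp
    then show False using that by simp
  qed
  have tv: "t \<le> v" "t' \<le> v" using t t' t_max_le by auto
  have "t = t'" using c c' mixed[of t t'] mixed[of t' t] tv by (elim disjE conjE) simp_all
  then show ?thesis
    using p(4) p'(4) B_setD(4-8)[OF t] B_setD(4-8)[OF t'] by auto
qed

text \<open>Different kinds are told apart by the types: kind A has type A and the others do not,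
  and type B separates kind B from kind C. Within kind A the multiplicities give \<open>k\<close>
  and \<open>l\<close>; within kind C they give \<open>t = na + nb'\<close>, and the number of parts
  gives \<open>k\<close>.\<close>

lemma cell_inj:
  assumes inf: "infinite (UNIV :: 'a::field set)"
  shows "inj_on (\<lambda>(k, l). cell k l) ({1..r - 1} \<times> {1..v})"
proof (rule inj_onI, clarify)
  fix k l k' l'
  assume "k \<in> {1..r - 1}" "l \<in> {1..v}" "k' \<in> {1..r - 1}" "l' \<in> {1..v}" and eq: "cell k l = cell k' l'"
  then have kl: "k \<in> {1..r - 1}" "l \<in> {1..v}" and kl': "k' \<in> {1..r - 1}" "l' \<in> {1..v}" by auto
  note A = A_part_props[OF inf] and B = B_part_props[OF inf] and C = C_part_props[OF inf]
  have s: "k + l = k' + l'" using cell_props(2)[OF inf kl] cell_props(2)[OF inf kl'] eq by simp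
  show "k = k' \<and> l = l'"
  proof (rule cover[OF kl]; rule cover[OF kl'])
    fix t t'
    assume t: "t \<in> {1..T_idx u r}" "(k, l) \<in> A_set u r t" and t': "t' \<in> {1..T_idx u r}" "(k', l') \<in> A_set u r t'"
    have "A_part u r k l = A_part u r k' l'" using eq cell_A[OF t] cell_A[OF t'] by simp
    then show ?thesis using A(4)[OF t] A(4)[OF t'] four_part_unique by metis
  next
    fix t t'
    assume t: "t \<in> {1..tm}" "(k, l) \<in> B_set u r t" and t': "t' \<in> {1..tm}" "(k', l') \<in> B_set u r t'"
    have "B_part u r t k l = B_part u r t' k' l'" using eq cell_B[OF t] cell_B[OF t'] by simp
    then show ?thesis using B_part_inj[OF inf t t'] by simp
  next
    fix t t'
    assume t: "t \<in> {1..tm}" "(k, l) \<in> C_set u r t" and t': "t' \<in> {1..tm}" "(k', l') \<in> C_set u r t'"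
    have e: "C_part u r t k = C_part u r t' k'" using eq cell_C[OF t] cell_C[OF t'] by simp
    then have "t = t'" using C(6)[OF t] C(6)[OF t'] four_part_unique by metis
    then show ?thesis using C_setD(4)[OF t] C_setD(4)[OF t'] s by simp
  next
    fix t t'
    assume t: "t \<in> {1..T_idx u r}" "(k, l) \<in> A_set u r t" and t': "t' \<in> {1..tm}" "(k', l') \<in> B_set u r t'"
    show ?thesis using A(1)[OF t] B(2)[OF t'] eq cell_A[OF t] cell_B[OF t'] by simp
  next
    fix t t'
    assume t: "t \<in> {1..T_idx u r}" "(k, l) \<in> A_set u r t" and t': "t' \<in> {1..tm}" "(k', l') \<in> C_set u r t'"
    show ?thesis using A(1)[OF t] C(2)[OF t'] eq cell_A[OF t] cell_C[OF t'] by simp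
  next
    fix t t'
    assume t: "t \<in> {1..tm}" "(k, l) \<in> B_set u r t" and t': "t' \<in> {1..T_idx u r}" "(k', l') \<in> A_set u r t'"
    show ?thesis using A(1)[OF t'] B(2)[OF t] eq cell_A[OF t'] cell_B[OF t] by simp
  next
    fix t t'
    assume t: "t \<in> {1..tm}" "(k, l) \<in> B_set u r t" and t': "t' \<in> {1..tm}" "(k', l') \<in> C_set u r t'"
    show ?thesis using B(1)[OF t] C(3)[OF t'] eq cell_B[OF t] cell_C[OF t'] by simp
  next
    fix t t'
    assume t: "t \<in> {1..tm}" "(k, l) \<in> C_set u r t" and t': "t' \<in> {1..T_idx u r}" "(k', l') \<in> A_set u r t'"
    show ?thesis using A(1)[OF t'] C(2)[OF t] eq cell_A[OF t'] cell_C[OF t] by simp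
  next
    fix t t'
    assume t: "t \<in> {1..tm}" "(k, l) \<in> C_set u r t" and t': "t' \<in> {1..tm}" "(k', l') \<in> B_set u r t'"
    show ?thesis using B(1)[OF t'] C(3)[OF t] eq cell_B[OF t'] cell_C[OF t] by simp
  qed
qed

end

theorem theorem3p12:
  fixes u r :: nat
  assumes "infinite (UNIV :: 'a::field set)" and "2 \<le> r" and "r < u"
  shows
   "((A_set u r (T_idx u r) \<noteq> {} \<longleftrightarrow> even r \<and> real u \<ge> 3 * real r / 2)
     \<and> (A_set u r (T_idx u r) \<noteq> {} \<longrightarrow>
          T_idx u r = k_inv u r (t_max u r) \<and> real (k_inv u r (t_max u r)) = real r / 2)
     \<and> (\<forall>t\<in>{1..T_idx u r}. \<forall>(k, l)\<in>A_set u r t.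
          type_A u (A_part u r k l)
          \<and> generic_type TYPE('a) (A_part u r k l) = {#u, u - r#}))
    \<and>
    (\<forall>t\<in>{1..t_max u r}. \<forall>(k, l)\<in>C_set u r t.
       type_C u (C_part u r t k)
       \<and> \<not> type_A u (C_part u r t k) \<and> \<not> type_B u (C_part u r t k)
       \<and> generic_type TYPE('a) (C_part u r t k) = {#u, u - r#})
    \<and>
    (\<forall>t\<in>{1..t_max u r}. \<forall>(k, l)\<in>B_set u r t.
       type_B u (B_part u r t k l)
       \<and> \<not> type_A u (B_part u r t k l)
       \<and> generic_type TYPE('a) (B_part u r t k l) = {#u, u - r#})
    \<and>
    ((\<forall>k\<in>{1..r - 1}. \<forall>l\<in>{1..u - r}.
        card {t \<in> {1..T_idx u r}. (k, l) \<in> A_set u r t}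
        + card {t \<in> {1..t_max u r}. (k, l) \<in> B_set u r t}
        + card {t \<in> {1..t_max u r}. (k, l) \<in> C_set u r t} = 1)
     \<and> (\<exists>P :: nat \<Rightarrow> nat \<Rightarrow> nat multiset.
          (\<forall>t\<in>{1..T_idx u r}. \<forall>(k, l)\<in>A_set u r t. P k l = A_part u r k l)
          \<and> (\<forall>t\<in>{1..t_max u r}. \<forall>(k, l)\<in>B_set u r t. P k l = B_part u r t k l)
          \<and> (\<forall>t\<in>{1..t_max u r}. \<forall>(k, l)\<in>C_set u r t. P k l = C_part u r t k)
          \<and> inj_on (\<lambda>(k, l). P k l) ({1..r - 1} \<times> {1..u - r})
          \<and> card ((\<lambda>(k, l). P k l) ` ({1..r - 1} \<times> {1..u - r})) = (r - 1) * (u - r)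
          \<and> (\<forall>k\<in>{1..r - 1}. \<forall>l\<in>{1..u - r}.
               generic_type TYPE('a) (P k l) = {#u, u - r#}
               \<and> size (P k l) = k + l)))"
proof -
  interpret table u r "u - r" using assms(2,3) by unfold_locales auto
  note A = A_part_props[OF assms(1)] and B = B_part_props[OF assms(1)] and C = C_part_props[OF assms(1)]
  have "real u \<ge> 3 * real r / 2 \<longleftrightarrow> 3 * r \<le> 2 * u" by linarith
  then have ne: "A_set u r (T_idx u r) \<noteq> {} \<longleftrightarrow> even r \<and> real u \<ge> 3 * real r / 2"
    using A_T_nonempty_iff by blast
  have val: "T_idx u r = k_inv u r (t_max u r) \<and> real (k_inv u r (t_max u r)) = real r / 2"
    if "A_set u r (T_idx u r) \<noteq> {}"
    using A_T_values[OF that] by simp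
  have card: "card ((\<lambda>(k, l). cell k l) ` ({1..r - 1} \<times> {1..u - r})) = (r - 1) * (u - r)"
    unfolding card_image[OF cell_inj[OF assms(1)]] by simp
  show ?thesis
    by (intro conjI exI[of _ cell], use ne in blast, use val in blast, use A(1,2) in blast,
        use C(1-4) in blast, use B(1-3) in blast, use card_indices in blast, use cell_A in blast,
        use cell_B in blast, use cell_C in blast, use cell_inj[OF assms(1)] in blast,
        use card in blast, use cell_props[OF assms(1)] in blast)
qed

end
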